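(* Consider the renewal risk model $$R_{m,n}(t)=u+ct-\sum_{i=1}^{N_{m,n}(t)}X_i,\qquad t>0,$$ where the inter-arrival times $T_k$ are each distributed as $\sum_{i=1}^m Y_i+\sum_{j=1}^n Z_j$, with $Y_i\sim\Gamma(r_i,\lambda_{1,i})$ and $Z_j\sim\mathrm{ML}(\mu_j,\lambda_{2,j})$ all independent ($r_i,\lambda_{1,i},\lambda_{2,j}\in\mathbb R^+$, $\mu_j\in(0,1]$). Assume further that the claim sizes $X_i$ are each distributed as a sum of $l$ independent $\Gamma(s_k,\alpha_k)$ distributed random variables for some $s_k,\alpha_k>0$, $k=1,\dots,l$. Let $$\mathcal A_l\left(\frac{\mathrm d}{\mathrm du}\right)=\bigodot_{k=1}^l{}^{\alpha_k}_{\phantom{x}0}\mathrm R_u^{s_k},\qquad \mathcal{A}_{m,n}^{*}\left(c\frac{\mathrm d}{\mathrm du}\right)=\bigodot_{j=1}^{n}\left(c^{\mu_j}\,{}^{\mathrm C}_{u}\mathrm{D}_\infty^{\mu_j}+\lambda_{2,j}\right)\bigodot_{i=1}^m\left(c^{r_i}\,{}^{\lambda_{1,i}/c}_{\phantom{xx}u}\mathrm{R}_\infty^{r_i}\right),$$ $$\Lambda_{m,n}=\prod_{i=1}^m\lambda_{1,i}^{r_i}\prod_{j=1}^n\lambda_{2,j}.$$ Then the non-ruin probability $\phi(u)=1-\psi(u)$ satisfies $$\mathcal A_l\left(\frac{\mathrm d}{\mathrm du}\right)\mathcal A_{m,n}^*\left(c\frac{\mathrm d}{\mathrm du}\right)[\phi](u)=\Lambda_{m,n}\prod_{k=1}^l\alpha_k^{s_k}\,\phi(u)$$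 with the universal boundary condition $\lim_{u\to\infty}\phi(u)=1$ and initial values $$\left({}^{\alpha_1}_{\phantom{x}0}\mathrm R_u^{s_1-k'}\bigodot_{k=2}^l{}^{\alpha_k}_{\phantom{x}0}\mathrm R_u^{s_k}\bigodot_{j=1}^{n}\left(c^{\mu_j}\,{}^{\mathrm C}_{u}\mathrm{D}_\infty^{\mu_j}+\lambda_{2,j}\right)\bigodot_{i=1}^m\left(c^{r_i}\,{}^{\lambda_{1,i}/c}_{\phantom{xx}u}\mathrm{R}_\infty^{r_i}\right)\right)[\phi](0)=0$$ for $k'=1,\dots,\left\lceil\sum_{k=1}^l s_k\right\rceil-1$.
   Context: Risk model: $u$ is the initial capital, $c>0$ the premium rate, the claim sizes $X_1,X_2,\dots$ are i.i.d. positive random variables, the inter-arrival (waiting) times $T_1,T_2,\dots$ are i.i.d. and independent of the claim sizes, and $N_{m,n}(t)$ is the renewal process counting the claims up to time $t$ (the $i$-th claim occurs at time $T_1+\cdots+T_i$). The net profit condition $c\,\mathbb E[T_i]>\mathbb E[X_i]$ is assumed. The ruin probability is $\psi(u)=\mathbb P[\inf\{R_{m,n}(t):t>0\}<0\mid R_{m,n}(0)=u]$. The function $\phi$ is regarded as supported on $[0,\infty)$. The integers $m,n\ge0$ are not both zero, and $l\ge1$. $\Gamma(r,\lambda)$ denotes the gamma distribution with density $\frac{\lambda^r}{\Gamma(r)}x^{r-1}e^{-\lambda x}$, $x>0$. $\mathrm{ML}(\mu,\lambda)$ denotes the Mittag-Leffler distribution with density $\lambda x^{\mu-1}E_{\mu,\mu}(-\lambda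 x^\mu)$, $x>0$, where $E_{\alpha,\beta}(z)=\sum_{k=0}^\infty \frac{z^k}{\Gamma(\alpha k+\beta)}$. Left Riemann-Liouville derivative of order $r>0$: ${}_{0}\mathrm{D}_x^r f(x)=\frac{1}{\Gamma(N-r)}\frac{\mathrm d^N}{\mathrm dx^N}\int_0^x (x-y)^{N-r-1}f(y)\,\mathrm dy$, $N=\lfloor r\rfloor+1$; for order zero it is the identity, and for $s>0$, ${}_{0}\mathrm D_x^{-s}f(x)=\frac{1}{\Gamma(s)}\int_0^x(x-y)^{s-1}f(y)\,\mathrm dy$. Left fractional differential operator: ${}^{\alpha}_{0}\mathrm{R}_x^r[f](x)=e^{-\alpha x}\,{}_{0}\mathrm{D}_x^r\left[e^{\alpha x}f(x)\right]$ (also for $r\le 0$, where ${}_{0}\mathrm D_x^{0}$ is the identity and, for $r=-s<0$, ${}_{0}\mathrm D_x^{r}$ is the fractional integral ${}_{0}\mathrm D_x^{-s}f(x)=\frac{1}{\Gamma(s)}\int_0^x(x-y)^{s-1}f(y)\,\mathrm dy$). Right Caputo derivative of order $r>0$ with upper limit $\infty$: ${}^{\mathrm C}_{x}\mathrm{D}_\infty^r f(x)=\frac{(-1)^N}{\Gamma(N-r)}\int_x^\infty (y-x)^{N-r-1}f^{(N)}(y)\,\mathrm dy$, $N=\lfloor r\rfloor+1$. Right fractional differential operator: ${}^{\alpha}_{x}\mathrm{R}_\infty^r[g](x)=e^{\alpha x}\,{}^{\mathrm C}_{x}\mathrm{D}_\infty^r\left[e^{-\alpha x}g(x)\right]$.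 $\bigodot$ denotes left-composition of operators: $\bigodot_{j=1}^m\mathcal L_j[f]=(\mathcal L_m\circ\cdots\circ\mathcal L_1)[f]$ (an empty composition is the identity, an empty product is $1$); in a juxtaposition of operators, the rightmost acts first. Values at $u=0$ are understood as limits $u\to0^+$. *)

theory Defs
  imports "HOL-Probability.Probability"
begin

text \<open>
  Claims and waiting times are indexed from 1. The mean waiting time may be infinite
  (Mittag-Leffler case), so the net profit condition compares means in \<^typ>\<open>ennreal\<close>.
\<close>

locale renewal_risk_model = prob_space M for M :: "'a measure" +
  fixes c :: real and X T :: "nat \<Rightarrow> 'a \<Rightarrow> real"
  assumes premium_pos: "c > 0"
    and claims_indep: "indep_vars (\<lambda>_. borel) X {1..}"
    and claims_ident: "\<And>i. i \<ge> 1 \<Longrightarrow> distr M borel (X i) = distr M borel (X 1)"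
    and claims_pos: "\<And>i. i \<ge> 1 \<Longrightarrow> AE \<omega> in M. X i \<omega> > 0"
    and waiting_indep: "indep_vars (\<lambda>_. borel) T {1..}"
    and waiting_ident: "\<And>i. i \<ge> 1 \<Longrightarrow> distr M borel (T i) = distr M borel (T 1)"
    and claims_waiting_indep:
      "indep_var (PiM {1..} (\<lambda>_. borel)) (\<lambda>\<omega>. \<lambda>i\<in>{1..}. X i \<omega>)
                 (PiM {1..} (\<lambda>_. borel)) (\<lambda>\<omega>. \<lambda>i\<in>{1..}. T i \<omega>)"
    and net_profit: "\<And>i. i \<ge> 1 \<Longrightarrow>
      (\<integral>\<^sup>+ \<omega>. ennreal (X i \<omega>) \<partial>M) < ennreal c * (\<integral>\<^sup>+ \<omega>. ennreal (T i \<omega>) \<partial>M)"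
begin

definition claim_count :: "real \<Rightarrow> 'a \<Rightarrow> nat" where
  "claim_count t \<omega> = card {k. 1 \<le> k \<and> (\<Sum>i=1..k. T i \<omega>) \<le> t}"

definition surplus :: "real \<Rightarrow> real \<Rightarrow> 'a \<Rightarrow> real" where
  "surplus u t \<omega> = u + c * t - (\<Sum>i=1..claim_count t \<omega>. X i \<omega>)"

text \<open>The infimum is taken in \<^typ>\<open>ereal\<close>, where it is meaningful for unbounded paths too.\<close>

definition ruin_prob :: "real \<Rightarrow> real" where
  "ruin_prob u = prob {\<omega> \<in> space M. (INF t\<in>{0<..}. ereal (surplus u t \<omega>)) < 0}"

definition non_ruin_prob :: "real \<Rightarrow> real" where
  "non_ruin_prob u = (if u \<ge> 0 then 1 - ruin_prob u else 0)"

end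

definition gamma_density :: "real \<Rightarrow> real \<Rightarrow> real \<Rightarrow> real" where
  "gamma_density r lam x =
     (if x > 0 then lam powr r / Gamma r * x powr (r - 1) * exp (- lam * x) else 0)"

definition mittag_leffler :: "real \<Rightarrow> real \<Rightarrow> real \<Rightarrow> real" where
  "mittag_leffler \<alpha> \<beta> z = (\<Sum>k. z ^ k / Gamma (\<alpha> * real k + \<beta>))"

definition mittag_leffler_density :: "real \<Rightarrow> real \<Rightarrow> real \<Rightarrow> real" where
  "mittag_leffler_density \<mu> lam x =
     (if x > 0 then lam * x powr (\<mu> - 1) * mittag_leffler \<mu> \<mu> (- lam * x powr \<mu>) else 0)"

text \<open>
  Operators are partial: the value is \<^const>\<open>None\<close> unless all derivatives and (Lebesgue)
  integrals in the defining formula exist at every \<open>x > 0\<close>. An equation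
  \<open>L f = Some g\<close> thus includes the claim that \<open>L\<close> is applicable to \<open>f\<close>. Only the values of
  \<open>g\<close> on \<open>(0, \<infinity>)\<close> are meaningful; a value at 0 is a limit from the right.
\<close>

type_synonym fun_op = "(real \<Rightarrow> real) \<rightharpoonup> (real \<Rightarrow> real)"

definition times_differentiable :: "nat \<Rightarrow> (real \<Rightarrow> real) \<Rightarrow> bool" where
  "times_differentiable N f \<longleftrightarrow>
     (\<forall>k<N. \<forall>x>0. (deriv ^^ k) f field_differentiable (at x))"

definition left_kernel_integrable :: "real \<Rightarrow> (real \<Rightarrow> real) \<Rightarrow> bool" where
  "left_kernel_integrable s f \<longleftrightarrow>
     (\<forall>x>0. set_integrable lborel {0..x} (\<lambda>y. (x - y) powr (s - 1) * f y))"

definition left_kernel_integral :: "real \<Rightarrow> (real \<Rightarrow> real) \<Rightarrow> real \<Rightarrow> real" where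
  "left_kernel_integral s f x = (LINT y:{0..x}|lborel. (x - y) powr (s - 1) * f y)"

definition RL_left :: "real \<Rightarrow> fun_op" where
  "RL_left r f =
    (if r < 0 then
       if left_kernel_integrable (- r) f
       then Some (\<lambda>x. 1 / Gamma (- r) * left_kernel_integral (- r) f x)
       else None
     else if r = 0 then Some f
     else let N = nat \<lfloor>r\<rfloor> + 1 in
       if left_kernel_integrable (real N - r) f
          \<and> times_differentiable N (left_kernel_integral (real N - r) f)
       then Some (\<lambda>x. 1 / Gamma (real N - r) *
                      (deriv ^^ N) (left_kernel_integral (real N - r) f) x)
       else None)"

definition left_frac_op :: "real \<Rightarrow> real \<Rightarrow> fun_op" where
  "left_frac_op \<alpha> r f =
     map_option (\<lambda>F x. exp (- \<alpha> * x) * F x) (RL_left r (\<lambda>y. exp (\<alpha> * y) * f y))"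

definition caputo_right :: "real \<Rightarrow> fun_op" where
  "caputo_right r f =
    (let N = nat \<lfloor>r\<rfloor> + 1 in
       if times_differentiable N f
          \<and> (\<forall>x>0. set_integrable lborel {x..}
                (\<lambda>y. (y - x) powr (real N - r - 1) * (deriv ^^ N) f y))
       then Some (\<lambda>x. (- 1) ^ N / Gamma (real N - r) *
              (LINT y:{x..}|lborel. (y - x) powr (real N - r - 1) * (deriv ^^ N) f y))
       else None)"

definition right_frac_op :: "real \<Rightarrow> real \<Rightarrow> fun_op" where
  "right_frac_op \<alpha> r g =
     map_option (\<lambda>F x. exp (\<alpha> * x) * F x) (caputo_right r (\<lambda>y. exp (- \<alpha> * y) * g y))"

text \<open>\<open>odot L a b\<close> is \<open>L b \<circ> \<dots> \<circ> L a\<close>, the identity if \<open>b < a\<close>.\<close>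

definition odot :: "(nat \<Rightarrow> fun_op) \<Rightarrow> nat \<Rightarrow> nat \<Rightarrow> fun_op" where
  "odot L a b = fold (\<lambda>j A. L j \<circ>\<^sub>m A) [a..<Suc b] Some"

definition gamma_arrival_op :: "real \<Rightarrow> real \<Rightarrow> real \<Rightarrow> fun_op" where
  "gamma_arrival_op c r lam f =
     map_option (\<lambda>g u. c powr r * g u) (right_frac_op (lam / c) r f)"

definition mittag_leffler_arrival_op :: "real \<Rightarrow> real \<Rightarrow> real \<Rightarrow> fun_op" where
  "mittag_leffler_arrival_op c \<mu> lam f =
     map_option (\<lambda>g u. c powr \<mu> * g u + lam * f u) (caputo_right \<mu> f)"

text \<open>The operators written \<open>A\<^sub>l(d/du)\<close> and \<open>A\<^sup>*(c d/du)\<close>, respectively.\<close>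

definition claim_op :: "nat \<Rightarrow> (nat \<Rightarrow> real) \<Rightarrow> (nat \<Rightarrow> real) \<Rightarrow> fun_op" where
  "claim_op l s \<alpha> = odot (\<lambda>k. left_frac_op (\<alpha> k) (s k)) 1 l"

definition arrival_op :: "nat \<Rightarrow> nat \<Rightarrow> real \<Rightarrow> (nat \<Rightarrow> real) \<Rightarrow> (nat \<Rightarrow> real) \<Rightarrow>
    (nat \<Rightarrow> real) \<Rightarrow> (nat \<Rightarrow> real) \<Rightarrow> fun_op" where
  "arrival_op m n c r lam1 \<mu> lam2 =
     odot (\<lambda>j. mittag_leffler_arrival_op c (\<mu> j) (lam2 j)) 1 n
     \<circ>\<^sub>m odot (\<lambda>i. gamma_arrival_op c (r i) (lam1 i)) 1 m"

end

theory Submission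
  imports Defs "HOL-Complex_Analysis.Complex_Analysis"
begin

text \<open>
  Write \<open>\<psi> = 1 - \<phi>\<close>, extended by \<open>1\<close> to the negative half-line. Conditioning on the first claim,
  \<open>\<psi>(u)\<close> is the mean of \<open>\<psi>(u + cT - X)\<close>, so \<open>\<phi>\<close> arises from itself by convolving with the gamma
  densities of the claims (left-sided fractional integrals) and then averaging over the waiting
  time (right-sided ones). The operators undo these integrals one at a time.

  The Caputo derivatives need \<open>\<phi>\<close> and the intermediate functions to be smooth on the open
  half-line. Both kinds of integrals extend to functions holomorphic on a sector
  \<open>|z| < \<kappa> Re z\<close>; with the weight \<open>exp (- e Re z)\<close> for small \<open>e > 0\<close> and \<open>\<kappa>\<close> close to 1 the net
  profit condition makes the composition a contraction there, so the solution \<open>\<psi>\<close> extends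
  holomorphically, and Cauchy's estimates bound all its derivatives.
\<close>


section \<open>Analytic continuation to sectors\<close>

text \<open>Gamma densities of shape below 1 are singular at the origin and \<phi> is set to 0 to
  its left, so smoothness up to 0 cannot be expected and all estimates are relative to the distance
  from 0. A sector with vertex 0 is invariant under right shifts and under scaling, which is all
  that the two kinds of averages need. Leaving the real axis costs a factor
  \<open>\<kappa> powr s\<close> per gamma average, since \<open>norm z\<close> exceeds
  \<open>Re z\<close>; the strict inequality \<open>E exp (e X) * E exp (- e c T) < 1\<close> leaves
  room for it.

  A gamma waiting time brings a factor \<open>exp (- lam / c * x)\<close>, which makes its
  right-sided integral converge for merely bounded functions. A Mittag-Leffler waiting time brings
  none, so there the decay of \<psi> itself is used, and the constant in \<open>1 - \<psi>\<close>
  is treated apart: the Caputo derivative kills it and the summand \<open>lam * f\<close> restores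
  it. That the Mittag-Leffler series is nonnegative is read off from its being the density of a law,
  not from complete monotonicity.\<close>

lemma holomorphic_on_parametric_integral:
  fixes F :: "complex \<Rightarrow> 'a \<Rightarrow> complex"
  assumes hol: "\<And>x. x \<in> space N \<Longrightarrow> (\<lambda>z. F z x) holomorphic_on U"
    and meas: "\<And>z. z \<in> U \<Longrightarrow> F z \<in> borel_measurable N"
    and dom: "\<And>z. z \<in> U \<Longrightarrow> \<exists>r>0. \<exists>g. integrable N g \<and> ball z r \<subseteq> U \<and>
                (\<forall>w\<in>ball z r. \<forall>x\<in>space N. norm (F w x) \<le> (g x :: real))"
  shows "(\<lambda>z. \<integral>x. F z x \<partial>N) holomorphic_on U"
  unfolding holomorphic_on_def
proof
  fix z assume z: "z \<in> U"
  from dom[OF z] obtain r g where r: "r > 0" and g: "integrable N g" and sub: "ball z r \<subseteq> U"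
    and bd: "\<And>w x. w \<in> ball z r \<Longrightarrow> x \<in> space N \<Longrightarrow> norm (F w x) \<le> g x" by metis
  define B where "B = ball z (r/2)"
  define D where "D x = deriv (\<lambda>z. F z x) z" for x
  have zB: "z \<in> B" using r by (simp add: B_def)
  have BU: "B \<subseteq> ball z r" using r by (auto simp: B_def)
  \<comment> \<open>Half the radius for the quotients and a quarter for Cauchy's estimate keep all
    discs inside \<open>ball z r\<close>, so the bound on \<open>F\<close> alone dominates the
    difference quotients.\<close>
  have dq: "norm ((F y x - F z x) / (y - z)) \<le> 4 / r * g x"
    if y: "y \<in> B" "y \<noteq> z" and x: "x \<in> space N" for y x
  proof -
    have "norm (F y x - F z x) \<le> (4 / r * g x) * norm (y - z)"
    proof (rule field_differentiable_bound[of B _ "deriv (\<lambda>z. F z x)"])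
      show "convex B" by (simp add: B_def)
      fix w assume w: "w \<in> B"
      have cb: "cball w (r/4) \<subseteq> ball z r"
      proof
        fix v assume "v \<in> cball w (r/4)"
        then have "dist w v \<le> r/4" "dist z w < r/2" using w by (auto simp: B_def)
        then show "v \<in> ball z r" using dist_triangle[of z v w] r by simp
      qed
      have h: "(\<lambda>z. F z x) holomorphic_on ball z r"
        using hol[OF x] sub holomorphic_on_subset by blast
      have wr: "w \<in> ball z r" using w BU by blast
      show "((\<lambda>z. F z x) has_field_derivative deriv (\<lambda>z. F z x) w) (at w within B)"
        using holomorphic_derivI[OF h _ wr] has_field_derivative_at_within by blast
      have "norm ((deriv ^^ 1) (\<lambda>z. F z x) w) \<le> fact 1 * g x / (r/4)^1"
      proof (rule Cauchy_inequality)
        show "(\<lambda>z. F z x) holomorphic_on ball w (r/4)"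
          using h cb holomorphic_on_subset ball_subset_cball by blast
        show "continuous_on (cball w (r/4)) (\<lambda>z. F z x)"
          using h cb holomorphic_on_imp_continuous_on continuous_on_subset by blast
        show "r/4 > 0" using r by simp
        fix v assume "norm (w - v) = r/4"
        then have "v \<in> ball z r" using cb by (auto simp: dist_norm)
        then show "norm (F v x) \<le> g x" using bd x by blast
      qed
      then show "norm (deriv (\<lambda>z. F z x) w) \<le> 4 / r * g x" using r by (simp add: field_simps)
    qed (use y zB in auto)
    then show ?thesis using y(2) by (simp add: norm_divide divide_le_eq)
  qed
  have "((\<lambda>z. \<integral>x. F z x \<partial>N) has_field_derivative (\<integral>x. D x \<partial>N)) (at z within B)"
    unfolding has_field_derivative_iff tendsto_at_iff_sequentially
  proof (intro allI impI)
    fix X assume X: "\<forall>i::nat. X i \<in> B - {z}" "X \<longlonglongrightarrow> z"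
    have lim: "(\<lambda>i. (F (X i) x - F z x) / (X i - z)) \<longlonglongrightarrow> D x" if x: "x \<in> space N" for x
    proof -
      have "((\<lambda>z. F z x) has_field_derivative D x) (at z within B)"
        unfolding D_def
        using holomorphic_derivI[of "\<lambda>z. F z x" "ball z r" z] hol[OF x] sub holomorphic_on_subset r
        by (metis centre_in_ball has_field_derivative_at_within open_ball)
      then show ?thesis
        using X unfolding has_field_derivative_iff tendsto_at_iff_sequentially comp_def by blast
    qed
    have XU: "X i \<in> U" for i using X(1) BU sub by blast
    have m: "(\<lambda>x. (F (X i) x - F z x) / (X i - z)) \<in> borel_measurable N" for i
      using meas[OF XU[of i]] meas[OF z] by simp
    have int: "integrable N (F w)" if "w \<in> ball z r" for w
      by (rule Bochner_Integration.integrable_bound[OF g]) (use that meas sub bd in \<open>force+\<close>)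
    have "(\<lambda>i. \<integral>x. (F (X i) x - F z x) / (X i - z) \<partial>N) \<longlonglongrightarrow> (\<integral>x. D x \<partial>N)"
    proof (rule integral_dominated_convergence)
      show "D \<in> borel_measurable N" by (rule borel_measurable_LIMSEQ_metric[OF m lim])
      show "integrable N (\<lambda>x. 4 / r * g x)" using g by simp
      show "AE x in N. (\<lambda>i. (F (X i) x - F z x) / (X i - z)) \<longlonglongrightarrow> D x" using lim by simp
      show "AE x in N. norm ((F (X i) x - F z x) / (X i - z)) \<le> 4 / r * g x" for i
        using dq X(1) by (intro AE_I2) blast
    qed (rule m)
    moreover have "(\<integral>x. (F (X i) x - F z x) / (X i - z) \<partial>N)
        = ((\<integral>x. F (X i) x \<partial>N) - (\<integral>x. F z x \<partial>N)) / (X i - z)" for i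
      using int[of "X i"] int[of z] X(1) BU r
      by (simp add: Bochner_Integration.integral_diff subset_iff)
    moreover have "X i \<noteq> z" for i using X(1) by blast
    ultimately show "((\<lambda>y. ((\<integral>x. F y x \<partial>N) - (\<integral>x. F z x \<partial>N)) / (y - z)) \<circ> X)
        \<longlonglongrightarrow> (\<integral>x. D x \<partial>N)" by (simp add: comp_def)
  qed
  then have "((\<lambda>z. \<integral>x. F z x \<partial>N) has_field_derivative (\<integral>x. D x \<partial>N)) (at z)"
    using at_within_open[OF zB] by (simp add: B_def)
  then show "(\<lambda>z. \<integral>x. F z x \<partial>N) field_differentiable at z within U"
    unfolding field_differentiable_def using has_field_derivative_at_within by blast
qed

text \<open>For \<open>\<kappa> > 1\<close> the open cone
  \<open>|arg z| < arccos (1 / \<kappa>)\<close>, written in the form in which it enters the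
  estimates: \<open>norm z\<close> exceeds \<open>Re z\<close> by at most the factor
  \<kappa>.\<close>

definition sector :: "real \<Rightarrow> complex set" where
  "sector \<kappa> = {z. norm z < \<kappa> * Re z}"

text \<open>The weight is taken in \<open>Re z\<close> because a right shift by \<open>y\<close>
  then gains exactly \<open>exp (- lam * y)\<close>. The extension \<open>F\<close> may be complex
  on the axis, hence \<open>Re\<close>, and \<open>f\<close> stays free on
  \<open>x \<le> 0\<close>.\<close>

definition sectorial :: "real \<Rightarrow> real \<Rightarrow> real \<Rightarrow> (real \<Rightarrow> real) \<Rightarrow> bool" where
  "sectorial \<kappa> lam B f \<longleftrightarrow>
     (\<exists>F. F holomorphic_on sector \<kappa> \<and> (\<forall>z\<in>sector \<kappa>. norm (F z) \<le> B * exp (- lam * Re z))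
        \<and> (\<forall>x>0. f x = Re (F (of_real x))))"

lemma open_sector: "open (sector \<kappa>)"
  unfolding sector_def by (intro open_Collect_less continuous_intros)

lemma sector_Re_pos: "\<kappa> > 1 \<Longrightarrow> z \<in> sector \<kappa> \<Longrightarrow> Re z > 0"
  unfolding sector_def using norm_ge_zero[of z] by (smt (verit) mem_Collect_eq zero_less_mult_iff)

lemma of_real_in_sector: "\<kappa> > 1 \<Longrightarrow> x > 0 \<Longrightarrow> of_real x \<in> sector \<kappa>"
  by (simp add: sector_def)

lemma sector_add: "\<kappa> > 1 \<Longrightarrow> z \<in> sector \<kappa> \<Longrightarrow> x \<ge> 0 \<Longrightarrow> z + of_real x \<in> sector \<kappa>"
proof -
  assume a: "\<kappa> > 1" "z \<in> sector \<kappa>" "x \<ge> 0"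
  have "norm (z + of_real x) \<le> norm z + x" using norm_triangle_ineq[of z "of_real x"] a by simp
  also have "\<dots> < \<kappa> * Re z + \<kappa> * x" using a by (simp add: sector_def add_less_le_mono mult_le_cancel_right1)
  finally show ?thesis by (simp add: sector_def algebra_simps)
qed

lemma sector_scale: "z \<in> sector \<kappa> \<Longrightarrow> x > 0 \<Longrightarrow> z * of_real x \<in> sector \<kappa>"
  by (simp add: sector_def norm_mult)

text \<open>On the disc \<open>norm z \<le> x + d * x\<close> and
  \<open>Re z \<ge> x - d * x\<close>, so \<open>d * (\<kappa> + 1) < \<kappa> - 1\<close> suffices;
  \<open>d\<close> is half of the critical ratio.\<close>

lemma cball_subset_sector:
  assumes k: "\<kappa> > 1" and x: "x > 0" and d: "d = (\<kappa> - 1) / (\<kappa> + 1) / 2"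
  shows "cball (of_real x) (d * x) \<subseteq> sector \<kappa>"
proof
  fix z :: complex assume "z \<in> cball (of_real x) (d * x)"
  then have n: "norm (z - of_real x) \<le> d * x" by (simp add: dist_norm norm_minus_commute)
  have "d * (\<kappa> + 1) = (\<kappa> - 1) / 2" using k by (simp add: d field_simps)
  then have d0: "d * (\<kappa> + 1) < \<kappa> - 1" using k by simp
  have "norm z \<le> x + d * x" using n norm_triangle_ineq[of "z - of_real x" "of_real x"] x by simp
  moreover have "Re z \<ge> x - d * x" using n abs_Re_le_cmod[of "z - of_real x"] by simp
  then have "\<kappa> * Re z \<ge> \<kappa> * (x - d * x)" using k by simp
  moreover have "d * (\<kappa> + 1) * x < (\<kappa> - 1) * x" using d0 x by (rule mult_strict_right_mono)
  ultimately show "z \<in> sector \<kappa>" by (simp add: sector_def algebra_simps)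
qed

lemma deriv_cong_pos:
  fixes f g :: "real \<Rightarrow> real"
  assumes "\<And>x. x > 0 \<Longrightarrow> f x = g x" "x > 0"
  shows "deriv f x = deriv g x"
  using assms by (intro deriv_cong_ev) (auto intro!: eventually_mono[OF eventually_gt_at_top] simp: eventually_nhds intro: exI[of _ "{0<..}"])

text \<open>Iterates of \<open>deriv\<close> are awkward for functions controlled only on the open
  half-line; a family \<open>D\<close> of pointwise candidates replaces them once and for
  all.\<close>

lemma iterated_deriv_eq:
  fixes D :: "nat \<Rightarrow> real \<Rightarrow> real"
  assumes f: "\<And>x. x > 0 \<Longrightarrow> f x = D 0 x"
    and D: "\<And>k x. k < N \<Longrightarrow> x > 0 \<Longrightarrow> (D k has_real_derivative D (Suc k) x) (at x)"
  shows "times_differentiable N f"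
    and "\<And>k x. k \<le> N \<Longrightarrow> x > 0 \<Longrightarrow> (deriv ^^ k) f x = D k x"
proof -
  show *: "(deriv ^^ k) f x = D k x" if "k \<le> N" "x > 0" for k x
    using that
  proof (induction k arbitrary: x)
    case 0 then show ?case using f by simp
  next
    case (Suc k)
    have "(deriv ^^ Suc k) f x = deriv ((deriv ^^ k) f) x" by simp
    also have "\<dots> = deriv (D k) x" by (rule deriv_cong_pos) (use Suc in auto)
    also have "\<dots> = D (Suc k) x" using D[of k x] Suc.prems by (intro DERIV_imp_deriv) auto
    finally show ?case .
  qed
  show "times_differentiable N f"
    unfolding times_differentiable_def
  proof (intro allI impI)
    fix k x :: _ assume k: "k < N" and x: "(0::real) < x"
    have "((deriv ^^ k) f has_real_derivative D (Suc k) x) (at x)"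
      by (rule has_field_derivative_transform_within_open[OF D[OF k x], of "{0<..}"])
        (use x k * in auto)
    then show "(deriv ^^ k) f field_differentiable at x"
      using field_differentiable_def by blast
  qed
qed

text \<open>Cauchy's estimate on the disc of radius \<open>d * x\<close> about \<open>x\<close>.
  Since \<open>d < 1/2\<close>, the disc stays in \<open>Re v \<ge> x / 2\<close>: the exponential
  rate is halved, which is the origin of \<open>lam / 2\<close> in the later estimates.\<close>

lemma sectorial_derivs:
  assumes f: "sectorial \<kappa> lam B f" and k: "\<kappa> > 1"
  shows "x > 0 \<Longrightarrow> ((deriv ^^ n) f has_real_derivative (deriv ^^ Suc n) f x) (at x)"
    and "times_differentiable n f"
    and "lam \<ge> 0 \<Longrightarrow> \<exists>C. \<forall>x>0. \<bar>(deriv ^^ n) f x\<bar> \<le> C * exp (- lam / 2 * x) / x ^ n"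
proof -
  from f obtain F where F: "F holomorphic_on sector \<kappa>"
    and b: "\<And>z. z \<in> sector \<kappa> \<Longrightarrow> norm (F z) \<le> B * exp (- lam * Re z)"
    and r: "\<And>x. x > 0 \<Longrightarrow> f x = Re (F (of_real x))" unfolding sectorial_def by blast
  define D where "D n x = Re ((deriv ^^ n) F (of_real x))" for n x
  have D: "(D n has_real_derivative D (Suc n) x) (at x)" if x: "x > 0" for n x
  proof -
    have "((deriv ^^ n) F has_field_derivative (deriv ^^ Suc n) F (of_real x)) (at (of_real x))"
      by (rule has_field_derivative_higher_deriv[OF F open_sector of_real_in_sector[OF k x]])
    then have "((\<lambda>x. (deriv ^^ n) F (of_real x)) has_vector_derivative (deriv ^^ Suc n) F (of_real x)) (at x)"
      by (rule has_vector_derivative_real_field)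
    then have "((\<lambda>x. Re ((deriv ^^ n) F (of_real x))) has_vector_derivative Re ((deriv ^^ Suc n) F (of_real x))) (at x)"
      by (rule bounded_linear.has_vector_derivative[OF bounded_linear_Re])
    then show ?thesis unfolding D_def has_real_derivative_iff_has_vector_derivative .
  qed
  have e: "(deriv ^^ n) f x = D n x" if "x > 0" for n x
    by (rule iterated_deriv_eq(2)[of f D n]) (use r D that in \<open>auto simp: D_def[of 0]\<close>)
  show "times_differentiable n f" for n
    by (rule iterated_deriv_eq(1)[of f D n]) (use r D in \<open>auto simp: D_def[of 0]\<close>)
  show "((deriv ^^ n) f has_real_derivative (deriv ^^ Suc n) f x) (at x)" if x: "x > 0"
    unfolding e[OF x, of "Suc n"]
    by (rule has_field_derivative_transform_within_open[OF D[OF x], of "{0<..}"]) (use x e in auto)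
  assume lam: "lam \<ge> 0"
  define d where "d = (\<kappa> - 1) / (\<kappa> + 1) / 2"
  have d: "d > 0" "d < 1/2" using k by (auto simp: d_def field_simps)
  have B0: "B \<ge> 0"
  proof -
    have "0 \<le> B * exp (- lam * Re 1)"
      using order_trans[OF norm_ge_zero b[of 1]] of_real_in_sector[OF k, of 1] by simp
    then show ?thesis by (simp add: zero_le_mult_iff)
  qed
  have "\<bar>(deriv ^^ n) f x\<bar> \<le> (fact n * B / d ^ n) * exp (- lam / 2 * x) / x ^ n" if x: "x > 0" for x
  proof -
    note cb = cball_subset_sector[OF k x d_def]
    have "norm ((deriv ^^ n) F (of_real x)) \<le> fact n * (B * exp (- lam / 2 * x)) / (d * x) ^ n"
    proof (rule Cauchy_inequality)
      show "F holomorphic_on ball (of_real x) (d * x)"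
        using F cb holomorphic_on_subset ball_subset_cball by blast
      show "continuous_on (cball (of_real x) (d * x)) F"
        using F cb holomorphic_on_imp_continuous_on continuous_on_subset by blast
      show "0 < d * x" using d x by simp
      fix v :: complex assume v: "norm (of_real x - v) = d * x"
      then have "v \<in> sector \<kappa>" using cb by (auto simp: dist_norm)
      then have "norm (F v) \<le> B * exp (- lam * Re v)" by (rule b)
      also have "x - Re v \<le> d * x" using v abs_Re_le_cmod[of "of_real x - v"] by simp
      then have "Re v \<ge> x / 2" using d(2) x mult_strict_right_mono[of d "1/2" x] by linarith
      then have "B * exp (- lam * Re v) \<le> B * exp (- lam / 2 * x)"
        using lam B0 mult_left_mono[of "x/2" "Re v" lam] by (intro mult_left_mono) auto
      finally show "norm (F v) \<le> B * exp (- lam / 2 * x)" .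
    qed
    then show ?thesis using abs_Re_le_cmod[of "(deriv ^^ n) F (of_real x)"]
      unfolding e[OF x] D_def by (simp add: power_mult_distrib)
  qed
  then show "\<exists>C. \<forall>x>0. \<bar>(deriv ^^ n) f x\<bar> \<le> C * exp (- lam / 2 * x) / x ^ n" by blast
qed

text \<open>Montel's theorem yields a subsequence only, but the limit on the axis is prescribed by
  \<open>g\<close>, so the limit of the subsequence extends \<open>g\<close>.\<close>

lemma sectorial_limit:
  assumes f: "\<And>n. sectorial \<kappa> lam B (f n)" and lim: "\<And>x. x > 0 \<Longrightarrow> (\<lambda>n. f n x) \<longlonglongrightarrow> g x" and k: "\<kappa> > 1"
    and lam: "lam \<ge> 0"
  shows "sectorial \<kappa> lam B g"
proof -
  from f obtain F where F: "\<And>n. F n holomorphic_on sector \<kappa>"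
    and b: "\<And>n z. z \<in> sector \<kappa> \<Longrightarrow> norm (F n z) \<le> B * exp (- lam * Re z)"
    and r: "\<And>n x. x > 0 \<Longrightarrow> f n x = Re (F n (of_real x))" unfolding sectorial_def by metis
  have B: "B \<ge> 0"
  proof -
    have "0 \<le> B * exp (- lam * Re 1)"
      using order_trans[OF norm_ge_zero b[of 1 0]] of_real_in_sector[OF k, of 1] by simp
    then show ?thesis by (simp add: zero_le_mult_iff)
  qed
  have bB: "norm (F n z) \<le> B" if z: "z \<in> sector \<kappa>" for n z
  proof -
    have "exp (- lam * Re z) \<le> 1" using lam sector_Re_pos[OF k z] by simp
    then have "B * exp (- lam * Re z) \<le> B" using B mult_left_le by blast
    then show ?thesis using b[OF z, of n] by linarith
  qed
  obtain G q where G: "G holomorphic_on sector \<kappa>" and q: "strict_mono (q::nat\<Rightarrow>nat)"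
    and l: "\<And>x. x \<in> sector \<kappa> \<Longrightarrow> (\<lambda>n. F (q n) x) \<longlonglongrightarrow> G x"
  proof (rule Montel[of "sector \<kappa>" "range F" F])
    show "open (sector \<kappa>)" by (rule open_sector)
    show "\<exists>B. \<forall>h\<in>range F. \<forall>z\<in>K. norm (h z) \<le> B" if "K \<subseteq> sector \<kappa>" for K
      using bB that by (intro exI[of _ B]) auto
  qed (use F in auto)
  have "norm (G z) \<le> B * exp (- lam * Re z)" if z: "z \<in> sector \<kappa>" for z
    by (rule LIMSEQ_le_const2[OF tendsto_norm[OF l[OF z]]]) (use b z in auto)
  moreover have "g x = Re (G (of_real x))" if x: "x > 0" for x
  proof (rule LIMSEQ_unique)
    show "(\<lambda>n. f (q n) x) \<longlonglongrightarrow> g x" using LIMSEQ_subseq_LIMSEQ[OF lim[OF x] q] by (simp add: comp_def)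
    show "(\<lambda>n. f (q n) x) \<longlonglongrightarrow> Re (G (of_real x))"
      unfolding r[OF x] by (rule tendsto_Re[OF l[OF of_real_in_sector[OF k x]]])
  qed
  ultimately show ?thesis using G unfolding sectorial_def by blast
qed

lemma sectorial_one_minus:
  assumes "sectorial \<kappa> 0 B f" shows "sectorial \<kappa> 0 (1 + B) (\<lambda>x. 1 - f x)"
proof -
  from assms obtain F where F: "F holomorphic_on sector \<kappa>"
    and b: "\<And>z. z \<in> sector \<kappa> \<Longrightarrow> norm (F z) \<le> B"
    and r: "\<And>x. x > 0 \<Longrightarrow> f x = Re (F (of_real x))" unfolding sectorial_def by auto
  have "norm (1 - F z) \<le> 1 + B" if "z \<in> sector \<kappa>" for z
    using b[OF that] norm_triangle_ineq4[of 1 "F z"] by simp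
  then show ?thesis unfolding sectorial_def
    using F r by (intro exI[of _ "\<lambda>z. 1 - F z"]) (auto intro!: holomorphic_intros)
qed

lemma sectorial_exp_mult:
  assumes "sectorial \<kappa> 0 B f" shows "sectorial \<kappa> lam B (\<lambda>x. exp (- lam * x) * f x)"
proof -
  from assms obtain F where F: "F holomorphic_on sector \<kappa>"
    and b: "\<And>z. z \<in> sector \<kappa> \<Longrightarrow> norm (F z) \<le> B"
    and r: "\<And>x. x > 0 \<Longrightarrow> f x = Re (F (of_real x))" unfolding sectorial_def by auto
  show ?thesis unfolding sectorial_def
  proof (intro exI[of _ "\<lambda>z. exp (- of_real lam * z) * F z"] conjI ballI allI impI)
    show "(\<lambda>z. exp (- of_real lam * z) * F z) holomorphic_on sector \<kappa>"
      using F by (intro holomorphic_intros)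
    show "norm (exp (- of_real lam * z) * F z) \<le> B * exp (- lam * Re z)" if "z \<in> sector \<kappa>" for z
      using b[OF that] by (simp add: norm_mult mult.commute mult_right_mono)
    show "exp (- lam * x) * f x = Re (exp (- of_real lam * of_real x) * F (of_real x))" if "x > 0" for x
    proof -
      have "exp (- complex_of_real lam * of_real x) = of_real (exp (- lam * x))"
        by (simp add: exp_of_real[symmetric] del: exp_of_real)
      then show ?thesis using r[OF that] by simp
    qed
  qed
qed

lemma sectorial_mono:
  assumes "sectorial \<kappa> lam B f" "B \<le> B'" "lam' \<le> lam" "0 \<le> B" "\<kappa> > 1"
  shows "sectorial \<kappa> lam' B' f"
proof -
  from assms obtain F where F: "F holomorphic_on sector \<kappa>"
    and b: "\<And>z. z \<in> sector \<kappa> \<Longrightarrow> norm (F z) \<le> B * exp (- lam * Re z)"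
    and r: "\<And>x. x > 0 \<Longrightarrow> f x = Re (F (of_real x))" unfolding sectorial_def by auto
  have "norm (F z) \<le> B' * exp (- lam' * Re z)" if "z \<in> sector \<kappa>" for z
  proof -
    have "B * exp (- lam * Re z) \<le> B' * exp (- lam' * Re z)"
      using assms sector_Re_pos[OF _ that] by (intro mult_mono) (auto intro: mult_right_mono)
    with b[OF that] show ?thesis by linarith
  qed
  then show ?thesis using F r unfolding sectorial_def by blast
qed

section \<open>Averages of sectorial functions over laws on the half-line\<close>

definition avg :: "real \<Rightarrow> real measure \<Rightarrow> (real \<Rightarrow> real) \<Rightarrow> real \<Rightarrow> real" where
  "avg a \<nu> f x = (LINT y|\<nu>. f (x + a * y))"

abbreviation gamma_law :: "real \<Rightarrow> real \<Rightarrow> real measure" where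
  "gamma_law s \<alpha> \<equiv> density lborel (\<lambda>x. ennreal (gamma_density s \<alpha> x))"

lemma gamma_density_nonneg: "s > 0 \<Longrightarrow> a > 0 \<Longrightarrow> gamma_density s a x \<ge> 0"
  unfolding gamma_density_def using Gamma_real_pos[of s] by (auto intro!: mult_nonneg_nonneg)

lemma borel_measurable_gamma_density [measurable]: "gamma_density s a \<in> borel_measurable borel"
  unfolding gamma_density_def by measurable

lemma nn_integral_gamma_density:
  assumes s: "s > 0" and a: "a > 0"
  shows "(\<integral>\<^sup>+x. ennreal (gamma_density s a x) \<partial>lborel) = 1"
proof -
  have "ennreal (Gamma s) = (\<integral>\<^sup>+t. ennreal (indicator {0..} t * t powr (s - 1) / exp t) \<partial>lborel)"
    by (rule Gamma_conv_nn_integral_real[OF s])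
  also have "\<dots> = ennreal \<bar>a\<bar> * (\<integral>\<^sup>+x. ennreal (indicator {0..} (0 + a * x) * (0 + a * x) powr (s - 1) / exp (0 + a * x)) \<partial>lborel)"
    by (rule nn_integral_real_affine) (use a in auto)
  also have "\<dots> = (\<integral>\<^sup>+x. ennreal a * ennreal (indicator {0..} (0 + a * x) * (0 + a * x) powr (s - 1) / exp (0 + a * x)) \<partial>lborel)"
    using a by (subst nn_integral_cmult) auto
  also have "\<dots> = (\<integral>\<^sup>+x. ennreal (Gamma s) * ennreal (gamma_density s a x) \<partial>lborel)"
  proof (rule nn_integral_cong)
    fix x :: real
    show "ennreal a * ennreal (indicator {0..} (0 + a * x) * (0 + a * x) powr (s - 1) / exp (0 + a * x))
        = ennreal (Gamma s) * ennreal (gamma_density s a x)"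
    proof (cases "x > 0")
      case True
      have "a * (a * x) powr (s - 1) = a powr s * x powr (s - 1)"
        using a True by (simp add: powr_mult powr_diff)
      then show ?thesis using True a Gamma_real_pos[OF s]
        by (simp add: gamma_density_def ennreal_mult'[symmetric] exp_minus field_simps)
    next
      case False then show ?thesis
        using a by (cases "x = 0") (auto simp: gamma_density_def indicator_def zero_le_mult_iff)
    qed
  qed
  also have "\<dots> = ennreal (Gamma s) * (\<integral>\<^sup>+x. ennreal (gamma_density s a x) \<partial>lborel)"
    by (rule nn_integral_cmult) auto
  finally have e: "ennreal (Gamma s) * 1 = ennreal (Gamma s) * (\<integral>\<^sup>+x. ennreal (gamma_density s a x) \<partial>lborel)"
    by simp
  have "ennreal (Gamma s) \<noteq> 0" "ennreal (Gamma s) \<noteq> \<infinity>" using Gamma_real_pos[OF s] by auto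
  with e show ?thesis by (metis ennreal_mult_cancel_left infinity_ennreal_def)
qed

lemma prob_space_gamma_law: "s > 0 \<Longrightarrow> a > 0 \<Longrightarrow> prob_space (gamma_law s a)"
  by (rule prob_spaceI) (simp add: emeasure_density nn_integral_gamma_density)

lemma AE_gamma_law_pos: "AE x in gamma_law s a. x > 0"
  by (subst AE_density) (auto simp: gamma_density_def)

lemma integrable_gamma_density: "s > 0 \<Longrightarrow> a > 0 \<Longrightarrow> integrable lborel (gamma_density s a)"
  by (rule integrableI_nonneg) (auto simp: gamma_density_nonneg nn_integral_gamma_density)

lemma integral_gamma_density: "s > 0 \<Longrightarrow> a > 0 \<Longrightarrow> (\<integral>x. gamma_density s a x \<partial>lborel) = 1"
  by (subst integral_eq_nn_integral) (auto simp: gamma_density_nonneg nn_integral_gamma_density)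

text \<open>Exponential tilting stays in the gamma family; integrated over \<open>x\<close>, this is
  the moment generating function.\<close>

lemma gamma_density_tilt:
  assumes "0 \<le> e" "e < a"
  shows "gamma_density s a x * exp (e * x) = (a / (a - e)) powr s * gamma_density s (a - e) x"
  using assms by (auto simp: gamma_density_def powr_divide exp_minus exp_add exp_diff field_simps)

lemma integral_gamma_law:
  assumes "s > 0" "a > 0" "f \<in> borel_measurable borel"
  shows "(LINT y|gamma_law s a. f y) = (LINT y|lborel. gamma_density s a y * (f y :: real))"
  using assms by (subst integral_real_density) (auto simp: gamma_density_nonneg)

text \<open>A sector absorbs right shifts, so \<open>F\<close> can be averaged over
  \<open>z + c * y\<close> directly. In \<open>avg\<close>, the factor \<open>c\<close> goes with
  waiting times (premium income) and \<open>- 1\<close> with claims.\<close>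

lemma sectorial_avg:
  assumes f: "sectorial \<kappa> lam B f" and k: "\<kappa> > 1" and lam: "lam \<ge> 0" and B: "B \<ge> 0" and c: "c > 0"
    and \<nu>: "prob_space \<nu>" and [measurable_cong]: "sets \<nu> = sets borel" and pos: "AE y in \<nu>. y > 0"
    and [measurable]: "f \<in> borel_measurable borel"
  shows "sectorial \<kappa> lam (B * (\<integral>y. exp (- lam * c * y) \<partial>\<nu>)) (avg c \<nu> f)"
proof -
  interpret prob_space \<nu> by fact
  from f obtain F where F: "F holomorphic_on sector \<kappa>"
    and b: "\<And>z. z \<in> sector \<kappa> \<Longrightarrow> norm (F z) \<le> B * exp (- lam * Re z)"
    and r: "\<And>x. x > 0 \<Longrightarrow> f x = Re (F (of_real x))" unfolding sectorial_def by auto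
  \<comment> \<open>Nonpositive \<open>y\<close> form a null set; the value 0 there avoids
    evaluating \<open>F\<close> outside its sector.\<close>
  define G where "G z y = (if y \<in> {0<..} then F (z + of_real (c * y)) else 0)" for z y
  have sh: "z + of_real (c * y) \<in> sector \<kappa>" if "z \<in> sector \<kappa>" "y > 0" for z y
    using sector_add[OF k that(1), of "c * y"] that c by simp
  have meas: "G z \<in> borel_measurable \<nu>" if z: "z \<in> sector \<kappa>" for z
  proof -
    have "continuous_on {0<..} (\<lambda>y. F (z + of_real (c * y)))"
      by (rule continuous_on_compose2[OF holomorphic_on_imp_continuous_on[OF F]])
        (use sh[OF z] in \<open>auto intro!: continuous_intros\<close>)
    then have "(\<lambda>y. if y \<in> {0<..} then F (z + of_real (c * y)) else 0) \<in> borel_measurable borel"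
      by (intro borel_measurable_continuous_on_if) auto
    then show ?thesis unfolding G_def using \<open>sets \<nu> = sets borel\<close> measurable_cong_sets by blast
  qed
  have bG: "norm (G z y) \<le> B * exp (- lam * Re z) * exp (- lam * c * y)" if z: "z \<in> sector \<kappa>" for z y
    using b[OF sh[OF z], of y] B by (auto simp: G_def exp_add[symmetric] ring_distribs mult.assoc)
  have bG': "norm (G z y) \<le> B" if z: "z \<in> sector \<kappa>" for z y
  proof (cases "y > 0")
    case True
    have "exp (- lam * Re (z + of_real (c * y))) \<le> 1"
      using lam sector_Re_pos[OF k sh[OF z True]] by simp
    then have "B * exp (- lam * Re (z + of_real (c * y))) \<le> B" using B mult_left_le by blast
    then show ?thesis using b[OF sh[OF z True]] True by (simp add: G_def)
  qed (use B in \<open>auto simp: G_def\<close>)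
  have intG: "integrable \<nu> (G z)" if z: "z \<in> sector \<kappa>" for z
    by (rule integrable_const_bound[of _ B]) (use bG' meas z in auto)
  have inte: "integrable \<nu> (\<lambda>y. exp (- lam * c * y))"
  proof (rule integrable_const_bound[of _ 1])
    show "AE x in \<nu>. norm (exp (- lam * c * x)) \<le> 1"
      using pos by eventually_elim (use lam c in auto)
  qed auto
  have "(\<lambda>z. \<integral>y. G z y \<partial>\<nu>) holomorphic_on sector \<kappa>"
  proof (rule holomorphic_on_parametric_integral)
    show "(\<lambda>z. G z x) holomorphic_on sector \<kappa>" for x
    proof (cases "x > 0")
      case True
      have "(F \<circ> (\<lambda>z. z + of_real (c * x))) holomorphic_on sector \<kappa>"
        by (rule holomorphic_on_compose_gen[OF _ F]) (use sh True in \<open>auto intro!: holomorphic_intros\<close>)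
      then show ?thesis using True by (simp add: G_def comp_def)
    qed (simp add: G_def)
    show "\<exists>r>0. \<exists>g. integrable \<nu> g \<and> ball z r \<subseteq> sector \<kappa> \<and> (\<forall>w\<in>ball z r. \<forall>x\<in>space \<nu>. norm (G w x) \<le> g x)"
      if "z \<in> sector \<kappa>" for z
    proof -
      from that open_sector obtain r where "r > 0" "ball z r \<subseteq> sector \<kappa>" using openE by blast
      then show ?thesis using bG' by (intro exI[of _ r] conjI exI[of _ "\<lambda>_. B"]) auto
    qed
  qed (rule meas)
  moreover have "norm (\<integral>y. G z y \<partial>\<nu>) \<le> B * (\<integral>y. exp (- lam * c * y) \<partial>\<nu>) * exp (- lam * Re z)"
    if z: "z \<in> sector \<kappa>" for z
  proof -
    have "norm (\<integral>y. G z y \<partial>\<nu>) \<le> (\<integral>y. B * exp (- lam * Re z) * exp (- lam * c * y) \<partial>\<nu>)"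
      by (rule Bochner_Integration.integral_norm_bound_integral) (use bG[OF z] intG[OF z] inte in auto)
    then show ?thesis by (simp add: mult_ac)
  qed
  moreover have "avg c \<nu> f x = Re (\<integral>y. G (of_real x) y \<partial>\<nu>)" if x: "x > 0" for x
  proof -
    note xs = of_real_in_sector[OF k x]
    have "Re (\<integral>y. G (of_real x) y \<partial>\<nu>) = (\<integral>y. Re (G (of_real x) y) \<partial>\<nu>)"
      by (rule integral_Re[OF intG[OF xs], symmetric])
    also have "\<dots> = avg c \<nu> f x" unfolding avg_def
    proof (rule integral_cong_AE)
      show "(\<lambda>y. Re (G (of_real x) y)) \<in> borel_measurable \<nu>" using meas[OF xs] by measurable
      show "AE y in \<nu>. Re (G (of_real x) y) = f (x + c * y)" using pos
      proof eventually_elim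
        fix y :: real assume y: "y > 0"
        have "x + c * y > 0" using x y c by (simp add: add_pos_pos)
        then show "Re (G (of_real x) y) = f (x + c * y)" using y r[of "x + c * y"] by (simp add: G_def)
      qed
    qed measurable
    finally show ?thesis ..
  qed
  ultimately show ?thesis unfolding sectorial_def
    by (intro exI[of _ "\<lambda>z. \<integral>y. G z y \<partial>\<nu>"]) auto
qed

text \<open>Substituting \<open>y = v x\<close> turns the convolution of \<open>f\<close> with a gamma density at \<open>v\<close> into
  \<open>v\<^sup>s\<close> times an integral over a fixed domain, which continues analytically in \<open>v\<close>.\<close>

lemma sectorial_avg_gamma:
  assumes f: "sectorial \<kappa> e B f" and k: "\<kappa> > 1" and s: "s > 0" and e: "0 \<le> e" "e < \<alpha>" and B: "B \<ge> 1"
    and neg: "\<And>x. x < 0 \<Longrightarrow> f x = 1" and [measurable]: "f \<in> borel_measurable borel"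
  shows "sectorial \<kappa> e (B * (\<kappa> * \<alpha> / (\<alpha> - e)) powr s) (avg (- 1) (gamma_law s \<alpha>) f)"
proof -
  from f obtain F where F: "F holomorphic_on sector \<kappa>"
    and b: "\<And>z. z \<in> sector \<kappa> \<Longrightarrow> norm (F z) \<le> B * exp (- e * Re z)"
    and r: "\<And>x. x > 0 \<Longrightarrow> f x = Re (F (of_real x))" unfolding sectorial_def by auto
  have a: "\<alpha> > 0" using e by simp
  define K where "K = \<alpha> powr s / Gamma s"
  have K: "K > 0" using a Gamma_real_pos[OF s] by (simp add: K_def)
  \<comment> \<open>Here \<open>x\<close> is the claim as a fraction of the capital. Beyond
    \<open>x = 1\<close> the capital is negative, where \<open>f\<close> is 1.\<close>
  define H where "H z x = (if x \<in> {0<..<1} then F (z * of_real (1 - x)) else 1)" for z and x :: real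
  define J where "J z x = (if 0 < x then of_real (K * x powr (s - 1)) * exp (- (of_real \<alpha> * z * of_real x)) * H z x else 0)"
    for z and x :: real
  have sc: "z * of_real (1 - x) \<in> sector \<kappa>" if "z \<in> sector \<kappa>" "x < 1" for z x
    using sector_scale[of z \<kappa> "1 - x"] that by simp
  have mH: "H z \<in> borel_measurable borel" if z: "z \<in> sector \<kappa>" for z
  proof -
    have "continuous_on {0<..<1} (\<lambda>x. F (z * of_real (1 - x)))"
      by (rule continuous_on_compose2[OF holomorphic_on_imp_continuous_on[OF F]])
        (use sc[OF z] in \<open>auto intro!: continuous_intros\<close>)
    then show ?thesis unfolding H_def by (intro borel_measurable_continuous_on_if) auto
  qed
  have mJ: "J z \<in> borel_measurable lborel" if z: "z \<in> sector \<kappa>" for z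
    using mH[OF z] unfolding J_def by measurable
  have bH: "norm (H z x) \<le> B * exp (- e * (Re z * (1 - x)))" if z: "z \<in> sector \<kappa>" and x: "x > 0" for z x
  proof (cases "x < 1")
    case True then show ?thesis using b[OF sc[OF z True]] x by (simp add: H_def mult_ac)
  next
    case False
    have "e * (Re z * (1 - x)) \<le> 0" using e(1) False sector_Re_pos[OF k z]
      by (simp add: mult_le_0_iff mult_nonneg_nonpos)
    then have "1 \<le> exp (- e * (Re z * (1 - x)))" by simp
    then have "1 * 1 \<le> B * exp (- e * (Re z * (1 - x)))" using B by (intro mult_mono) auto
    then show ?thesis using False by (simp add: H_def)
  qed
  have bH': "norm (H z x) \<le> B" if z: "z \<in> sector \<kappa>" and x: "x > 0" for z x
  proof (cases "x < 1")
    case True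
    have "e * (Re z * (1 - x)) \<ge> 0" using e(1) True sector_Re_pos[OF k z] by simp
    then have "exp (- e * (Re z * (1 - x))) \<le> 1" by simp
    then have "B * exp (- e * (Re z * (1 - x))) \<le> B" using B mult_left_le by auto
    then show ?thesis using bH[OF z x] by linarith
  qed (use B in \<open>auto simp: H_def\<close>)
  \<comment> \<open>The bound on \<open>F\<close> at \<open>z * (1 - x)\<close> splits into
    \<open>exp (- e * Re z)\<close> and \<open>exp (e * Re z * x)\<close>; the second factor lowers
    the gamma rate from \<alpha> to \<open>\<alpha> - e\<close>. Beyond \<open>x = 1\<close>,
    \<open>B \<ge> 1\<close> puts the constant 1 under the same bound.\<close>
  have bJ: "norm (J z x) \<le> B * exp (- e * Re z) * ((\<alpha> / ((\<alpha> - e) * Re z)) powr s * gamma_density s ((\<alpha> - e) * Re z) x)"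
    if z: "z \<in> sector \<kappa>" for z x
  proof (cases "x > 0")
    case True
    have R: "Re z > 0" using sector_Re_pos[OF k z] .
    have "norm (J z x) = K * x powr (s - 1) * exp (- (\<alpha> * Re z * x)) * norm (H z x)"
      using True K by (simp add: J_def norm_mult)
    also have "\<dots> \<le> K * x powr (s - 1) * exp (- (\<alpha> * Re z * x)) * (B * exp (- e * (Re z * (1 - x))))"
      using bH[OF z True] K by (intro mult_left_mono) auto
    also have "\<dots> = B * exp (- e * Re z) * (K * x powr (s - 1) * exp (- ((\<alpha> - e) * Re z) * x))"
      by (simp add: exp_add[symmetric] algebra_simps)
    also have "K * x powr (s - 1) * exp (- ((\<alpha> - e) * Re z) * x)
        = (\<alpha> / ((\<alpha> - e) * Re z)) powr s * gamma_density s ((\<alpha> - e) * Re z) x"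
      using True R e a by (simp add: gamma_density_def K_def powr_divide)
    finally show ?thesis .
  qed (simp add: J_def gamma_density_def)
  have g0: "(\<alpha> - e) * Re z > 0" if "z \<in> sector \<kappa>" for z using sector_Re_pos[OF k that] e by simp
  have intJ: "integrable lborel (J z)" if z: "z \<in> sector \<kappa>" for z
    by (rule Bochner_Integration.integrable_bound[where f="\<lambda>x. B * exp (- e * Re z) * ((\<alpha> / ((\<alpha> - e) * Re z)) powr s * gamma_density s ((\<alpha> - e) * Re z) x)"])
      (use bJ[OF z] mJ[OF z] integrable_gamma_density[OF s g0[OF z]] in \<open>auto intro: order_trans[OF _ abs_ge_self]\<close>)
  have holJ: "(\<lambda>z. \<integral>x. J z x \<partial>lborel) holomorphic_on sector \<kappa>"
  proof (rule holomorphic_on_parametric_integral)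
    show "(\<lambda>z. J z x) holomorphic_on sector \<kappa>" for x
    proof -
      have "(F \<circ> (\<lambda>z. z * of_real (1 - x))) holomorphic_on sector \<kappa>" if "x < 1"
        by (rule holomorphic_on_compose_gen[OF _ F]) (use sc that in \<open>auto intro!: holomorphic_intros\<close>)
      then have "(\<lambda>z. H z x) holomorphic_on sector \<kappa>"
        by (cases "0 < x \<and> x < 1") (auto simp: H_def comp_def)
      then show ?thesis unfolding J_def by (cases "x > 0") (auto intro!: holomorphic_intros)
    qed
    show "\<exists>r>0. \<exists>g. integrable lborel g \<and> ball z r \<subseteq> sector \<kappa> \<and> (\<forall>w\<in>ball z r. \<forall>x\<in>space lborel. norm (J w x) \<le> g x)"
      if z: "z \<in> sector \<kappa>" for z
    proof -
      have R: "Re z > 0" using sector_Re_pos[OF k z] .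
      from z open_sector obtain r0 where r0: "r0 > 0" "ball z r0 \<subseteq> sector \<kappa>" using openE by blast
      define r where "r = min r0 (Re z / 2)"
      \<comment> \<open>A rate common to all \<open>w\<close> near \<open>z\<close>, because
        \<open>Re w \<ge> Re z / 2\<close> there.\<close>
      define q where "q = \<alpha> * (Re z / 2)"
      have q: "q > 0" using a R by (simp add: q_def)
      have "norm (J w x) \<le> B * ((\<alpha> / q) powr s * gamma_density s q x)" if w: "w \<in> ball z r" for w x
      proof (cases "x > 0")
        case True
        have ws: "w \<in> sector \<kappa>" using w r0 by (auto simp: r_def)
        have "\<bar>Re (z - w)\<bar> < Re z / 2" using w abs_Re_le_cmod[of "z - w"] by (simp add: r_def dist_norm)
        then have "Re z / 2 \<le> Re w" by (simp only: minus_complex.sel)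
        then have "q * x \<le> \<alpha> * Re w * x" using a True by (simp add: q_def)
        then have ex: "exp (- (\<alpha> * Re w * x)) \<le> exp (- q * x)" by simp
        have "norm (J w x) = K * x powr (s - 1) * exp (- (\<alpha> * Re w * x)) * norm (H w x)"
          using True K by (simp add: J_def norm_mult)
        also have "\<dots> \<le> K * x powr (s - 1) * exp (- q * x) * B"
          using bH'[OF ws True] K ex by (intro mult_mono) auto
        also have "\<dots> = B * ((\<alpha> / q) powr s * gamma_density s q x)"
          using True q a by (simp add: gamma_density_def K_def powr_divide)
        finally show ?thesis .
      qed (simp add: J_def gamma_density_def)
      then show ?thesis using r0 R integrable_gamma_density[OF s q]
        by (intro exI[of _ r] conjI exI[of _ "\<lambda>x. B * ((\<alpha> / q) powr s * gamma_density s q x)"])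
          (auto simp: r_def)
    qed
  qed (rule mJ)
  define P where "P z = z powr of_real s * (\<integral>x. J z x \<partial>lborel)" for z
  have "P holomorphic_on sector \<kappa>" unfolding P_def
  proof (intro holomorphic_on_mult holJ)
    show "(\<lambda>z. z powr of_real s) holomorphic_on sector \<kappa>"
      using sector_Re_pos[OF k] by (intro holomorphic_intros) (force simp: complex_nonpos_Reals_iff)
  qed
  moreover have "norm (P z) \<le> B * (\<kappa> * \<alpha> / (\<alpha> - e)) powr s * exp (- e * Re z)" if z: "z \<in> sector \<kappa>" for z
  proof -
    have R: "Re z > 0" using sector_Re_pos[OF k z] .
    have "norm (\<integral>x. J z x \<partial>lborel) \<le> (\<integral>x. B * exp (- e * Re z) * ((\<alpha> / ((\<alpha> - e) * Re z)) powr s * gamma_density s ((\<alpha> - e) * Re z) x) \<partial>lborel)"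
      by (rule Bochner_Integration.integral_norm_bound_integral)
        (use bJ[OF z] intJ[OF z] integrable_gamma_density[OF s g0[OF z]] in auto)
    also have "\<dots> = B * exp (- e * Re z) * (\<alpha> / ((\<alpha> - e) * Re z)) powr s"
      using integral_gamma_density[OF s g0[OF z]] by simp
    finally have 1: "norm (\<integral>x. J z x \<partial>lborel) \<le> B * exp (- e * Re z) * (\<alpha> / ((\<alpha> - e) * Re z)) powr s" .
    \<comment> \<open>The powers of \<open>Re z\<close> in the two factors cancel, and only
      \<open>\<kappa> powr s\<close> survives.\<close>
    have "norm z \<le> \<kappa> * Re z" using z by (simp add: sector_def)
    then have 2: "norm (z powr of_real s) \<le> (\<kappa> * Re z) powr s"
      using s by (simp add: norm_powr_real_powr' powr_mono2)
    have "norm (P z) \<le> (\<kappa> * Re z) powr s * (B * exp (- e * Re z) * (\<alpha> / ((\<alpha> - e) * Re z)) powr s)"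
      unfolding P_def norm_mult using 1 2 by (intro mult_mono) auto
    also have "\<dots> = B * exp (- e * Re z) * ((\<kappa> * Re z) * (\<alpha> / ((\<alpha> - e) * Re z))) powr s"
      using R e a k by (subst powr_mult) auto
    also have "(\<kappa> * Re z) * (\<alpha> / ((\<alpha> - e) * Re z)) = \<kappa> * \<alpha> / (\<alpha> - e)" using R by simp
    finally show ?thesis by (simp add: mult_ac)
  qed
  moreover have "avg (- 1) (gamma_law s \<alpha>) f v = Re (P (of_real v))" if v: "v > 0" for v
  proof -
    note vs = of_real_in_sector[OF k v]
    have "avg (- 1) (gamma_law s \<alpha>) f v = (LINT y|lborel. gamma_density s \<alpha> y * f (v - y))"
      unfolding avg_def by (subst integral_gamma_law[OF s a]) auto
    also have "\<dots> = \<bar>v\<bar> *\<^sub>R (LINT x|lborel. gamma_density s \<alpha> (0 + v * x) * f (v - (0 + v * x)))"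
      by (rule lborel_integral_real_affine) (use v in auto)
    also have "\<dots> = v powr s * (LINT x|lborel. Re (J (of_real v) x))"
    proof -
      \<comment> \<open>At \<open>x = 1\<close> the argument of \<open>f\<close> is 0, where nothing
        is known about \<open>f\<close>; this is a null set.\<close>
      have "v * (gamma_density s \<alpha> (v * x) * f (v - v * x)) = v powr s * Re (J (of_real v) x)" if x1: "x \<noteq> 1" for x
      proof (cases "x > 0")
        case True
        have g: "v * gamma_density s \<alpha> (v * x) = v powr s * (K * x powr (s - 1) * exp (- (\<alpha> * v * x)))"
        proof -
          have "(v * x) powr (s - 1) = v powr (s - 1) * x powr (s - 1)" using v True by (simp add: powr_mult)
          moreover have "v powr s = v * v powr (s - 1)" using v by (simp add: powr_diff)
          ultimately show ?thesis using v True by (simp add: gamma_density_def K_def)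
        qed
        have h: "f (v - v * x) = Re (H (of_real v) x)"
        proof (cases "x < 1")
          case True
          then have "v - v * x > 0" using v by simp
          from r[OF this] show ?thesis using True \<open>x > 0\<close> by (simp add: H_def algebra_simps)
        next
          case False
          then have "v - v * x < 0" using v x1 by simp
          from neg[OF this] show ?thesis using False by (simp add: H_def)
        qed
        have ex: "exp (- (complex_of_real \<alpha> * of_real v * of_real x)) = of_real (exp (- (\<alpha> * v * x)))"
          by (simp add: exp_of_real[symmetric] del: exp_of_real)
        have "J (of_real v) x = of_real (K * x powr (s - 1) * exp (- (\<alpha> * v * x))) * H (of_real v) x"
          using True unfolding J_def ex by simp
        then have "Re (J (of_real v) x) = K * x powr (s - 1) * exp (- (\<alpha> * v * x)) * Re (H (of_real v) x)"
          by simp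
        then show ?thesis using g h by (metis (no_types, lifting) mult.assoc)
      next
        case False
        then have "v * x \<le> 0" using v by (simp add: mult_le_0_iff)
        then show ?thesis using False by (simp add: J_def gamma_density_def)
      qed
      then have "(LINT x|lborel. v * (gamma_density s \<alpha> (v * x) * f (v - v * x))) = (LINT x|lborel. v powr s * Re (J (of_real v) x))"
        using mJ[OF vs] by (intro integral_cong_AE eventually_mono[OF AE_lborel_singleton[of 1]]) auto
      then show ?thesis using v by simp
    qed
    also have "(LINT x|lborel. Re (J (of_real v) x)) = Re (\<integral>x. J (of_real v) x \<partial>lborel)"
      by (rule integral_Re[OF intJ[OF vs]])
    also have "v powr s * Re (\<integral>x. J (of_real v) x \<partial>lborel) = Re (P (of_real v))"
      using v by (simp add: P_def powr_of_real)
    finally show ?thesis .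
  qed
  ultimately show ?thesis unfolding sectorial_def by (intro exI[of _ P]) auto
qed

section \<open>Fractional integrals and convolution kernels\<close>

text \<open>Kernel of the fractional integral of order \<open>a\<close>. Its vanishing for
  \<open>t \<le> 0\<close> moves the limits of integration into the integrand, so that left- and
  right-sided integrals become integrals over the whole line; \<open>riesz 1\<close> is the unit
  step.\<close>

definition riesz :: "real \<Rightarrow> real \<Rightarrow> real" where
  "riesz a t = (if t > 0 then t powr (a - 1) / Gamma a else 0)"

lemma riesz_nonpos [simp]: "t \<le> 0 \<Longrightarrow> riesz a t = 0"
  by (simp add: riesz_def)

lemma riesz_nonneg: "a > 0 \<Longrightarrow> riesz a t \<ge> 0"
  using Gamma_real_pos[of a] by (simp add: riesz_def)

lemma borel_measurable_riesz [measurable]: "riesz a \<in> borel_measurable borel"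
  unfolding riesz_def by measurable

lemma riesz_one: "t > 0 \<Longrightarrow> riesz 1 t = 1"
  by (simp add: riesz_def)

text \<open>Semigroup law of fractional integration: rescaling \<open>w\<close> to the unit interval
  leaves a Beta integral.\<close>

lemma nn_integral_riesz_conv:
  assumes a: "a > 0" and b: "b > 0"
  shows "(\<integral>\<^sup>+w. ennreal (riesz a w * riesz b (x - w)) \<partial>lborel) = ennreal (riesz (a + b) x)"
proof (cases "x > 0")
  case False
  then have "riesz a w * riesz b (x - w) = 0" for w by (cases "w > 0") auto
  then show ?thesis using False by (simp only: ennreal_0 nn_integral_const) simp
next
  case x: True
  note Ga = Gamma_real_pos[OF a] and Gb = Gamma_real_pos[OF b]
  define C where "C = x powr (a + b - 1) / (Gamma a * Gamma b)"
  have C: "C \<ge> 0" using Ga Gb by (simp add: C_def)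
  have "(\<integral>\<^sup>+w. ennreal (riesz a w * riesz b (x - w)) \<partial>lborel)
      = ennreal \<bar>x\<bar> * (\<integral>\<^sup>+w. ennreal (riesz a (0 + x * w) * riesz b (x - (0 + x * w))) \<partial>lborel)"
    by (rule nn_integral_real_affine) (use x in auto)
  also have "\<dots> = (\<integral>\<^sup>+w. ennreal \<bar>x\<bar> * ennreal (riesz a (0 + x * w) * riesz b (x - (0 + x * w))) \<partial>lborel)"
    by (rule nn_integral_cmult[symmetric]) auto
  also have "\<dots> = (\<integral>\<^sup>+w. ennreal C * ennreal (indicator {0..1} w * (w powr (a - 1) * (1 - w) powr (b - 1))) \<partial>lborel)"
  proof (rule nn_integral_cong_AE, rule eventually_mono[OF AE_conjI[OF AE_lborel_singleton[of 0] AE_lborel_singleton[of 1]]])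
    fix w :: real assume w: "w \<noteq> 0 \<and> w \<noteq> 1"
    have "\<bar>x\<bar> * (riesz a (0 + x * w) * riesz b (x - (0 + x * w)))
        = C * (indicator {0..1} w * (w powr (a - 1) * (1 - w) powr (b - 1)))"
    proof (cases "0 < w \<and> w < 1")
      case True
      have e: "x - x * w = x * (1 - w)" by (simp add: algebra_simps)
      have "x * (x powr (a - 1) * x powr (b - 1)) = x powr (1 + (a - 1) + (b - 1))"
        using x by (simp only: powr_add powr_one mult.assoc)
      then have m: "x * (x powr (a - 1) * (w powr (a - 1) * (x powr (b - 1) * (1 - w) powr (b - 1))))
          = x powr (a + b - 1) * (w powr (a - 1) * (1 - w) powr (b - 1))"
        by (simp add: algebra_simps)
      have p: "0 < x * w" "0 < x * (1 - w)" using True x by auto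
      show ?thesis using True x m p unfolding C_def add_0 e
        by (simp add: riesz_def powr_mult mult.assoc)
    next
      case False
      then have "w < 0 \<or> w > 1" using w by auto
      then show ?thesis
      proof
        assume "w < 0"
        then have "x * w \<le> 0" using x by (simp add: mult_le_0_iff)
        then show ?thesis using \<open>w < 0\<close> by simp
      next
        assume "w > 1"
        then have "x - x * w \<le> 0" using x by simp
        then show ?thesis using \<open>w > 1\<close> by simp
      qed
    qed
    then show "ennreal \<bar>x\<bar> * ennreal (riesz a (0 + x * w) * riesz b (x - (0 + x * w)))
        = ennreal C * ennreal (indicator {0..1} w * (w powr (a - 1) * (1 - w) powr (b - 1)))"
      using C by (simp add: ennreal_mult'[symmetric])
  qed
  also have "\<dots> = ennreal C * (\<integral>\<^sup>+w. ennreal (indicator {0..1} w * (w powr (a - 1) * (1 - w) powr (b - 1))) \<partial>lborel)"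
    by (rule nn_integral_cmult) auto
  also have "(\<integral>\<^sup>+w. ennreal (indicator {0..1} w * (w powr (a - 1) * (1 - w) powr (b - 1))) \<partial>lborel) = ennreal (Beta a b)"
    by (rule nn_integral_has_integral_lebesgue[OF _ has_integral_Beta_real[OF a b]]) auto
  also have "ennreal C * ennreal (Beta a b) = ennreal (riesz (a + b) x)"
    using C x Ga Gb by (simp add: ennreal_mult'[symmetric] C_def riesz_def Beta_def)
  finally show ?thesis .
qed

text \<open>Convolution kernels act on both sides: with \<open>k \<sigma> = f (x + \<sigma>)\<close> this composes right-sided
  integrals, with \<open>k \<sigma> = f (x - \<sigma>)\<close> left-sided ones.\<close>

lemma integral_conv_kernel:
  fixes A B C k :: "real \<Rightarrow> real"
  assumes [measurable]: "A \<in> borel_measurable borel" "B \<in> borel_measurable borel" "k \<in> borel_measurable borel"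
    and A: "\<And>t. A t \<ge> 0" and B: "\<And>t. B t \<ge> 0"
    and conv: "\<And>x. (\<integral>\<^sup>+w. ennreal (A w * B (x - w)) \<partial>lborel) = ennreal (C x)" and C: "\<And>x. C x \<ge> 0"
    and int: "integrable lborel (\<lambda>x. C x * k x)"
  shows "integrable lborel (\<lambda>w. A w * (LINT t|lborel. B t * k (w + t)))"
    and "(LINT w|lborel. A w * (LINT t|lborel. B t * k (w + t))) = (LINT x|lborel. C x * k x)"
proof -
  \<comment> \<open>Integrating over \<open>w\<close> first gives \<open>C x * k x\<close>,
    integrating over \<open>x\<close> first gives the nested integral. As \<open>A\<close> and
    \<open>B\<close> are nonnegative, \<open>int\<close> supplies absolute integrability.\<close>
  define f where "f = (\<lambda>(x, w). A w * B (x - w) * k x)"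
  have [measurable]: "f \<in> borel_measurable (lborel \<Otimes>\<^sub>M lborel)" unfolding f_def by measurable
  have c: "has_bochner_integral lborel (\<lambda>w. A w * B (x - w)) (C x)" for x
    by (rule has_bochner_integral_nn_integral) (use A B C conv in auto)
  have fint: "integrable (lborel \<Otimes>\<^sub>M lborel) f"
  proof (rule lborel_pair.Fubini_integrable)
    have "(LINT w|lborel. norm (f (x, w))) = \<bar>C x * k x\<bar>" for x
    proof -
      have "(LINT w|lborel. norm (f (x, w))) = (LINT w|lborel. A w * B (x - w) * \<bar>k x\<bar>)"
        using A B by (intro Bochner_Integration.integral_cong) (auto simp: f_def abs_mult)
      also have "\<dots> = C x * \<bar>k x\<bar>" using has_bochner_integral_integral_eq[OF c] by simp
      finally show ?thesis using C by (simp add: abs_mult)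
    qed
    then show "integrable lborel (\<lambda>x. LINT w|lborel. norm (f (x, w)))" using int by simp
    show "AE x in lborel. integrable lborel (\<lambda>w. f (x, w))"
      by (simp add: f_def integrable.intros[OF c])
  qed measurable
  have inner: "(LINT x|lborel. f (x, w)) = A w * (LINT t|lborel. B t * k (w + t))" for w
  proof -
    have "(LINT x|lborel. f (x, w)) = A w * (LINT x|lborel. B (x - w) * k x)"
      by (simp add: f_def mult.assoc)
    also have "(LINT x|lborel. B (x - w) * k x) = \<bar>1\<bar> *\<^sub>R (LINT t|lborel. B ((w + 1 * t) - w) * k (w + 1 * t))"
      by (rule lborel_integral_real_affine) simp
    finally show ?thesis by simp
  qed
  have sw: "integrable (lborel \<Otimes>\<^sub>M lborel) (\<lambda>(w, x). f (x, w))"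
    using lborel_pair.integrable_product_swap[OF fint] .
  from lborel_pair.integrable_fst'[OF sw] inner
  show "integrable lborel (\<lambda>w. A w * (LINT t|lborel. B t * k (w + t)))" by simp
  have "(LINT w|lborel. (LINT x|lborel. f (x, w))) = (LINT x|lborel. (LINT w|lborel. f (x, w)))"
    using lborel_pair.Fubini_integral[of "\<lambda>x w. f (x, w)"] fint by simp
  also have "\<dots> = (LINT x|lborel. C x * k x)"
    using has_bochner_integral_integral_eq[OF c] by (simp add: f_def)
  finally show "(LINT w|lborel. A w * (LINT t|lborel. B t * k (w + t))) = (LINT x|lborel. C x * k x)"
    unfolding inner .
qed


section \<open>Left-sided fractional integrals and derivatives\<close>

definition left_bounded :: "(real \<Rightarrow> real) \<Rightarrow> bool" where
  "left_bounded g \<longleftrightarrow> (\<forall>x. \<exists>B. \<forall>y\<le>x. \<bar>g y\<bar> \<le> B)"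

definition causal :: "(real \<Rightarrow> real) \<Rightarrow> bool" where
  "causal g \<longleftrightarrow> g \<in> borel_measurable borel \<and> (\<forall>y\<le>0. g y = 0) \<and> left_bounded g"

definition RLI :: "real \<Rightarrow> (real \<Rightarrow> real) \<Rightarrow> real \<Rightarrow> real" where
  "RLI a g x = (LINT w|lborel. riesz a w * g (x - w))"

lemma causal_measurable: "causal g \<Longrightarrow> g \<in> borel_measurable borel"
  by (simp add: causal_def)

lemma causal_zero: "causal g \<Longrightarrow> y \<le> 0 \<Longrightarrow> g y = 0"
  by (simp add: causal_def)

lemma integrable_riesz: "a > 0 \<Longrightarrow> integrable lborel (\<lambda>w. riesz a w * riesz 1 (x - w))"
  by (rule integrableI_nonneg) (auto simp: nn_integral_riesz_conv riesz_nonneg)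

lemma integral_riesz: "a > 0 \<Longrightarrow> (LINT w|lborel. riesz a w * riesz 1 (x - w)) = riesz (a + 1) x"
  by (subst integral_eq_nn_integral) (auto simp: nn_integral_riesz_conv riesz_nonneg)

text \<open>\<open>riesz 1 (x - w)\<close> is the indicator of \<open>w < x\<close>, so by the
  semigroup law this bound integrates to \<open>B * riesz (a + 1) x\<close>, which is also the rate
  at which \<open>RLI a g\<close> vanishes at 0.\<close>

lemma riesz_mult_le:
  assumes g: "causal g" and b: "\<And>y. y \<le> x \<Longrightarrow> \<bar>g y\<bar> \<le> B" and a: "a > 0"
  shows "\<bar>riesz a w * g (x - w)\<bar> \<le> B * (riesz a w * riesz 1 (x - w))"
proof (cases "0 < w \<and> w < x")
  case True
  then have "\<bar>g (x - w)\<bar> * riesz a w \<le> B * riesz a w"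
    using b[of "x - w"] riesz_nonneg[OF a, of w] by (intro mult_right_mono) auto
  then show ?thesis using True riesz_nonneg[OF a, of w] riesz_one[of "x - w"]
    by (simp add: abs_mult mult.commute)
next
  case False then show ?thesis using causal_zero[OF g, of "x - w"] by (cases "w > 0") auto
qed

lemma integrable_RLI:
  assumes g: "causal g" and a: "a > 0"
  shows "integrable lborel (\<lambda>w. riesz a w * g (x - w))"
proof -
  obtain B where b: "\<And>y. y \<le> x \<Longrightarrow> \<bar>g y\<bar> \<le> B" using g unfolding causal_def left_bounded_def by metis
  note [measurable] = causal_measurable[OF g]
  show ?thesis
  proof (rule Bochner_Integration.integrable_bound[where f="\<lambda>w. B * (riesz a w * riesz 1 (x - w))"])
    show "AE w in lborel. norm (riesz a w * g (x - w)) \<le> norm (B * (riesz a w * riesz 1 (x - w)))"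
      by (intro AE_I2) (use riesz_mult_le[OF g b a] in \<open>force intro: order_trans[OF _ abs_ge_self]\<close>)
  qed (use integrable_riesz[OF a] in auto)
qed

lemma abs_RLI_le:
  assumes g: "causal g" and a: "a > 0" and b: "\<And>y. y \<le> x \<Longrightarrow> \<bar>g y\<bar> \<le> B"
  shows "\<bar>RLI a g x\<bar> \<le> B * riesz (a + 1) x"
proof -
  have "norm (RLI a g x) \<le> (LINT w|lborel. B * (riesz a w * riesz 1 (x - w)))"
    unfolding RLI_def
    by (rule Bochner_Integration.integral_norm_bound_integral)
      (use integrable_RLI[OF g a] integrable_riesz[OF a] riesz_mult_le[OF g b a] in auto)
  then show ?thesis by (simp add: integral_riesz[OF a])
qed

lemma riesz_mono: "a \<ge> 1 \<Longrightarrow> x \<le> y \<Longrightarrow> riesz a x \<le> riesz a y"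
  using Gamma_real_pos[of a] by (auto simp: riesz_def intro!: divide_right_mono powr_mono2)

lemma causal_RLI:
  assumes g: "causal g" and a: "a > 0"
  shows "causal (RLI a g)"
  unfolding causal_def
proof (intro conjI allI impI)
  note [measurable] = causal_measurable[OF g]
  show "RLI a g \<in> borel_measurable borel" unfolding RLI_def by measurable
  show "RLI a g y = 0" if "y \<le> 0" for y
  proof -
    have "riesz a w * g (y - w) = 0" for w using that causal_zero[OF g, of "y - w"] by (cases "w > 0") auto
    then show ?thesis unfolding RLI_def by (simp only: integral_zero)
  qed
  show "left_bounded (RLI a g)" unfolding left_bounded_def
  proof
    fix x
    obtain B where b: "\<And>y. y \<le> x \<Longrightarrow> \<bar>g y\<bar> \<le> B" using g unfolding causal_def left_bounded_def by metis
    then have B: "B \<ge> 0" using abs_ge_zero order_trans by blast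
    have "\<bar>RLI a g y\<bar> \<le> B * riesz (a + 1) x" if "y \<le> x" for y
    proof -
      have "\<bar>RLI a g y\<bar> \<le> B * riesz (a + 1) y" by (rule abs_RLI_le[OF g a]) (use b that in auto)
      also have "\<dots> \<le> B * riesz (a + 1) x" using B riesz_mono[of "a + 1" y x] a that by (intro mult_left_mono) auto
      finally show ?thesis .
    qed
    then show "\<exists>B. \<forall>y\<le>x. \<bar>RLI a g y\<bar> \<le> B" by blast
  qed
qed

lemma RLI_RLI:
  assumes g: "causal g" and a: "a > 0" and b: "b > 0"
  shows "RLI a (RLI b g) x = RLI (a + b) g x"
proof -
  note [measurable] = causal_measurable[OF g]
  have "(LINT w|lborel. riesz a w * (LINT t|lborel. riesz b t * g (x - (w + t)))) = (LINT w|lborel. riesz (a + b) w * g (x - w))"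
    by (rule integral_conv_kernel(2))
      (use a b integrable_RLI[OF g, of "a + b"] in \<open>auto simp: riesz_nonneg nn_integral_riesz_conv\<close>)
  then show ?thesis by (simp add: RLI_def diff_diff_add)
qed

lemma RLI_one:
  assumes g: "causal g" shows "RLI 1 g x = (LINT y|lborel. indicator {..<x} y * g y)"
    and "integrable lborel (\<lambda>y. indicator {..<x} y * g y)"
proof -
  have e: "riesz 1 (x - y) * g y = indicator {..<x} y * g y" for y by (simp add: riesz_def indicator_def)
  have "RLI 1 g x = \<bar>-1\<bar> *\<^sub>R (LINT y|lborel. riesz 1 (x + -1 * y) * g (x - (x + -1 * y)))"
    unfolding RLI_def by (rule lborel_integral_real_affine) simp
  then show "RLI 1 g x = (LINT y|lborel. indicator {..<x} y * g y)" using e by simp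
  have "integrable lborel (\<lambda>y. riesz 1 (x + -1 * y) * g (x - (x + -1 * y)))"
    by (rule lborel_integrable_real_affine[OF integrable_RLI[OF g]]) auto
  then show "integrable lborel (\<lambda>y. indicator {..<x} y * g y)" using e by simp
qed

text \<open>Scaling \<open>w = v * z\<close> pins the possible jump of \<open>g\<close> at 0 to the
  null set \<open>z = 1\<close> for all \<open>v\<close> at once; then dominated convergence
  applies.\<close>

lemma isCont_RLI:
  assumes g: "causal g" and cont: "\<And>x. x > 0 \<Longrightarrow> isCont g x" and a: "a > 0" and x: "x > 0"
  shows "isCont (RLI a g) x"
proof -
  note [measurable] = causal_measurable[OF g]
  have sc: "RLI a g v = v powr a * (LINT z|lborel. riesz a z * g (v * (1 - z)))" if v: "v > 0" for v
  proof -
    have "RLI a g v = \<bar>v\<bar> *\<^sub>R (LINT z|lborel. riesz a (0 + v * z) * g (v - (0 + v * z)))"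
      unfolding RLI_def by (rule lborel_integral_real_affine) (use v in simp)
    also have "(LINT z|lborel. riesz a (0 + v * z) * g (v - (0 + v * z)))
        = (LINT z|lborel. v powr (a - 1) * (riesz a z * g (v * (1 - z))))"
    proof (rule Bochner_Integration.integral_cong[OF refl])
      fix z :: real
      show "riesz a (0 + v * z) * g (v - (0 + v * z)) = v powr (a - 1) * (riesz a z * g (v * (1 - z)))"
      proof (cases "z > 0")
        case True
        have "v - v * z = v * (1 - z)" by (simp add: algebra_simps)
        then show ?thesis using v True by (simp add: riesz_def powr_mult)
      next
        case False
        then have "v * z \<le> 0" using v by (simp add: mult_le_0_iff)
        then show ?thesis using False by simp
      qed
    qed
    finally show ?thesis using v by (simp add: powr_diff)
  qed
  define I where "I v = (LINT z|lborel. riesz a z * g (v * (1 - z)))" for v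
  obtain B where b: "\<And>y. y \<le> 2 * x \<Longrightarrow> \<bar>g y\<bar> \<le> B" using g unfolding causal_def left_bounded_def by metis
  have B: "B \<ge> 0" using b[of x] x abs_ge_zero[of "g x"] by linarith
  have "(I \<longlongrightarrow> I x) (at x within {0<..<2*x})"
    unfolding tendsto_at_iff_sequentially comp_def
  proof (intro allI impI)
    fix X assume X: "\<forall>i::nat. X i \<in> {0<..<2*x} - {x}" "X \<longlonglongrightarrow> x"
    show "(\<lambda>i. I (X i)) \<longlonglongrightarrow> I x" unfolding I_def
    proof (rule integral_dominated_convergence[where w="\<lambda>z. B * (riesz a z * riesz 1 (1 - z))"])
      show "AE z in lborel. (\<lambda>i. riesz a z * g (X i * (1 - z))) \<longlonglongrightarrow> riesz a z * g (x * (1 - z))"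
      proof (rule eventually_mono[OF AE_lborel_singleton[of 1]])
        fix z :: real assume z: "z \<noteq> 1"
        show "(\<lambda>i. riesz a z * g (X i * (1 - z))) \<longlonglongrightarrow> riesz a z * g (x * (1 - z))"
        proof (cases "z < 1")
          case True
          then have "isCont g (x * (1 - z))" using cont x by simp
          then show ?thesis by (intro tendsto_mult tendsto_const isCont_tendsto_compose[of _ g] X(2))
        next
          case False
          then have "y * (1 - z) \<le> 0" if "y > 0" for y using that by (simp add: mult_le_0_iff)
          then have "g (X i * (1 - z)) = 0" "g (x * (1 - z)) = 0" for i
            using causal_zero[OF g] X(1) x by auto
          then show ?thesis by simp
        qed
      qed
      show "AE z in lborel. norm (riesz a z * g (X i * (1 - z))) \<le> B * (riesz a z * riesz 1 (1 - z))" for i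
      proof (rule eventually_mono[OF AE_lborel_singleton[of 1]])
        fix z :: real assume z: "z \<noteq> 1"
        have Xi: "0 < X i" "X i < 2 * x" using X(1) by auto
        show "norm (riesz a z * g (X i * (1 - z))) \<le> B * (riesz a z * riesz 1 (1 - z))"
        proof (cases "0 < z \<and> z < 1")
          case True
          then have "X i * (1 - z) \<le> X i * 1" using Xi by (intro mult_left_mono) auto
          then have "X i * (1 - z) \<le> 2 * x" using Xi by linarith
          then have "\<bar>g (X i * (1 - z))\<bar> \<le> B" by (rule b)
          then have "\<bar>g (X i * (1 - z))\<bar> * riesz a z \<le> B * riesz a z"
            using riesz_nonneg[OF a] by (rule mult_right_mono)
          then show ?thesis using True riesz_nonneg[OF a, of z] riesz_one[of "1 - z"]
            by (simp add: abs_mult mult.commute)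
        next
          case False
          then have "X i * (1 - z) \<le> 0" if "z > 0" using that Xi by (simp add: mult_le_0_iff)
          then show ?thesis using causal_zero[OF g] False by (cases "z > 0") auto
        qed
      qed
    qed (use integrable_riesz[OF a] in auto)
  qed
  then have "(I \<longlongrightarrow> I x) (at x)" using at_within_open[of x "{0<..<2*x}"] x by simp
  then have "((\<lambda>v. v powr a * I v) \<longlongrightarrow> x powr a * I x) (at x)"
    using x by (intro tendsto_intros) auto
  moreover have "eventually (\<lambda>v. v powr a * I v = RLI a g v) (at x)"
    using order_tendstoD(1)[OF tendsto_ident_at x] by eventually_elim (simp add: sc I_def)
  ultimately have "(RLI a g \<longlongrightarrow> x powr a * I x) (at x)" by (rule Lim_transform_eventually)
  then show ?thesis using sc[OF x] by (simp add: isCont_def I_def)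
qed

lemma RLI_one_deriv:
  assumes g: "causal g" and cont: "\<And>x. x > 0 \<Longrightarrow> isCont g x" and x: "x > 0"
  shows "(RLI 1 g has_real_derivative g x) (at x)"
proof -
  \<comment> \<open>\<open>g\<close> may jump at 0, so the fundamental theorem of calculus is
    started inside \<open>(0, x)\<close>.\<close>
  define a where "a = x / 2"
  have a: "0 < a" "a < x" using x by (auto simp: a_def)
  note [measurable] = causal_measurable[OF g]
  have cg: "continuous_on {a..b} g" for b
    using a cont by (intro continuous_at_imp_continuous_on) auto
  have e: "RLI 1 g v = RLI 1 g a + integral {a..v} g" if v: "v \<ge> a" for v
  proof -
    have i: "set_integrable lborel {a..v} g" by (rule borel_integrable_atLeastAtMost'[OF cg])
    have "RLI 1 g v = (LINT y|lborel. indicator {..<a} y * g y + indicator {a..v} y * g y)"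
      unfolding RLI_one[OF g]
      by (intro integral_cong_AE eventually_mono[OF AE_lborel_singleton[of v]])
        (use v in \<open>auto simp: indicator_def\<close>)
    also have "\<dots> = (LINT y|lborel. indicator {..<a} y * g y) + (LINT y|lborel. indicator {a..v} y * g y)"
      using i RLI_one(2)[OF g] by (intro Bochner_Integration.integral_add) (auto simp: set_integrable_def)
    also have "(LINT y|lborel. indicator {a..v} y * g y) = integral {a..v} g"
      using set_borel_integral_eq_integral(2)[OF i] by (simp add: set_lebesgue_integral_def)
    finally show ?thesis by (simp add: RLI_one[OF g])
  qed
  have "((\<lambda>v. integral {a..v} g) has_real_derivative g x) (at x within {a..2*x})"
    by (rule integral_has_real_derivative[OF cg]) (use a x in auto)
  then have "((\<lambda>v. integral {a..v} g) has_real_derivative g x) (at x)"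
    using a x by (simp add: at_within_Icc_at)
  then have "((\<lambda>v. RLI 1 g a + integral {a..v} g) has_real_derivative 0 + g x) (at x)"
    by (intro DERIV_add DERIV_const)
  then have "((\<lambda>v. RLI 1 g a + integral {a..v} g) has_real_derivative g x) (at x)" by simp
  moreover have "x \<in> {a<..}" using a by simp
  moreover have "RLI 1 g a + integral {a..v} g = RLI 1 g v" if "v \<in> {a<..}" for v
    using e[of v] that by simp
  ultimately show ?thesis
    by (rule has_field_derivative_transform_within_open[OF _ open_greaterThan])
qed

lemma left_kernel_RLI:
  assumes g: "causal g" and s: "s > 0" and f: "\<And>y. y > 0 \<Longrightarrow> f y = g y"
  shows "left_kernel_integrable s f"
    and "x > 0 \<Longrightarrow> left_kernel_integral s f x = Gamma s * RLI s g x"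
proof -
  note [measurable] = causal_measurable[OF g]
  have G: "Gamma s \<noteq> 0" using Gamma_real_pos[OF s] by simp
  \<comment> \<open>The value \<open>f 0\<close> is arbitrary and enters through the null set
    \<open>{0}\<close> only. At \<open>y = x\<close> both kernels are 0, as
    \<open>0 powr _ = 0\<close>.\<close>
  have e: "indicator {0..x} y * ((x - y) powr (s - 1) * f y)
      = Gamma s * (riesz s (x - y) * g y) + x powr (s - 1) * f 0 * indicator {0} y" if x: "x > 0" for x y
  proof (cases "0 < y \<and> y < x")
    case True then show ?thesis using f[of y] G by (simp add: riesz_def)
  next
    case False
    then show ?thesis using x causal_zero[OF g, of y] by (auto simp: indicator_def)
  qed
  have i: "integrable lborel (\<lambda>y. riesz s (x - y) * g y)"
    and j: "(LINT y|lborel. riesz s (x - y) * g y) = RLI s g x" for x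
  proof -
    have "integrable lborel (\<lambda>y. riesz s (x + -1 * y) * g (x - (x + -1 * y)))"
      by (rule lborel_integrable_real_affine[OF integrable_RLI[OF g s]]) auto
    then show "integrable lborel (\<lambda>y. riesz s (x - y) * g y)" by simp
    have "RLI s g x = \<bar>-1\<bar> *\<^sub>R (LINT y|lborel. riesz s (x + -1 * y) * g (x - (x + -1 * y)))"
      unfolding RLI_def by (rule lborel_integral_real_affine) simp
    then show "(LINT y|lborel. riesz s (x - y) * g y) = RLI s g x" by simp
  qed
  have k: "integrable lborel (\<lambda>y. x powr (s - 1) * f 0 * indicator {0::real} y)" for x by simp
  show "left_kernel_integrable s f"
    unfolding left_kernel_integrable_def set_integrable_def real_scaleR_def
    using e i k by (simp del: integrable_indicator_iff)
  assume x: "x > 0"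
  have "left_kernel_integral s f x = (LINT y|lborel. Gamma s * (riesz s (x - y) * g y) + x powr (s - 1) * f 0 * indicator {0} y)"
    unfolding left_kernel_integral_def set_lebesgue_integral_def real_scaleR_def using e[OF x] by simp
  also have "\<dots> = (LINT y|lborel. Gamma s * (riesz s (x - y) * g y)) + (LINT y|lborel. x powr (s - 1) * f 0 * indicator {0::real} y)"
    by (subst Bochner_Integration.integral_add) (use i in auto)
  also have "\<dots> = Gamma s * RLI s g x" using j by simp
  finally show "left_kernel_integral s f x = Gamma s * RLI s g x" .
qed

text \<open>Order 0 is the identity, which no kernel function represents.\<close>

definition RLI0 :: "real \<Rightarrow> (real \<Rightarrow> real) \<Rightarrow> real \<Rightarrow> real" where
  "RLI0 a g = (if a = 0 then g else RLI a g)"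

lemma RLI0_deriv:
  assumes g: "causal g" and cont: "\<And>x. x > 0 \<Longrightarrow> isCont g x" and a: "a \<ge> 0" and x: "x > 0"
  shows "(RLI0 (a + 1) g has_real_derivative RLI0 a g x) (at x)"
proof (cases "a = 0")
  case True then show ?thesis using RLI_one_deriv[OF g cont x] by (simp add: RLI0_def)
next
  case False
  then have a0: "a > 0" using a by simp
  have "RLI (a + 1) g = RLI 1 (RLI a g)"
    using RLI_RLI[OF g, of 1 a] a0 by (auto simp: add.commute)
  then show ?thesis
    using RLI_one_deriv[OF causal_RLI[OF g a0] isCont_RLI[OF g cont a0] x] False a0 by (simp add: RLI0_def)
qed

text \<open>For \<open>r > 0\<close> the kernel integral of \<open>RLI b g\<close> has order
  \<open>N - r + b\<close>. Each of the \<open>N\<close> derivatives lowers the order by one, down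
  to \<open>b - r \<ge> 0\<close>, so no derivative ever falls on \<open>g\<close>.\<close>

lemma RL_left_RLI:
  assumes g: "causal g" and cont: "\<And>x. x > 0 \<Longrightarrow> isCont g x" and b: "b > 0" and rb: "r \<le> b"
    and f: "\<And>y. y > 0 \<Longrightarrow> f y = RLI b g y"
  shows "\<exists>h. RL_left r f = Some h \<and> (\<forall>x>0. h x = RLI0 (b - r) g x)"
proof -
  note cg = causal_RLI[OF g b]
  consider "r < 0" | "r = 0" | "r > 0" by linarith
  then show ?thesis
  proof cases
    case 1
    then have r: "- r > 0" by simp
    have "Gamma (- r) \<noteq> 0" using Gamma_real_pos[OF r] by simp
    then show ?thesis using 1 left_kernel_RLI[OF cg r f] RLI_RLI[OF g r b] b
      by (simp add: RL_left_def RLI0_def add.commute)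
  next
    case 2 then show ?thesis using f b by (simp add: RL_left_def RLI0_def)
  next
    case 3
    define N where "N = nat \<lfloor>r\<rfloor> + 1"
    have N: "real N > r" using 3 by (simp add: N_def) linarith
    then have q: "real N - r > 0" by simp
    have G: "Gamma (real N - r) \<noteq> 0" using Gamma_real_pos[OF q] by simp
    define D where "D k x = Gamma (real N - r) * RLI0 (real N - r + b - real k) g x" for k x
    have D0: "left_kernel_integral (real N - r) f x = D 0 x" if "x > 0" for x
      using left_kernel_RLI(2)[OF cg q f that] RLI_RLI[OF g q b] q b by (simp add: D_def RLI0_def)
    have DD: "(D k has_real_derivative D (Suc k) x) (at x)" if "k < N" "x > 0" for k x
    proof -
      have "real N - r + b - real (Suc k) \<ge> 0" using that rb by linarith
      from RLI0_deriv[OF g cont this \<open>x > 0\<close>] show ?thesis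
        unfolding D_def by (intro DERIV_cmult) (simp add: algebra_simps)
    qed
    note it = iterated_deriv_eq[of "left_kernel_integral (real N - r) f" D N, OF D0 DD]
    have "(deriv ^^ N) (left_kernel_integral (real N - r) f) x = Gamma (real N - r) * RLI0 (b - r) g x" if "x > 0" for x
      using it(2)[of N x] that by (simp add: D_def)
    then show ?thesis
      using 3 it(1) left_kernel_RLI(1)[OF cg q f] G
      unfolding RL_left_def N_def[symmetric] Let_def by simp
  qed
qed

section \<open>Inversion of right-sided operators\<close>

text \<open>Sectorial functions are controlled on the open half-line only; the cut-off at 0 yields
  functions measurable on the whole line.\<close>

definition pos_deriv :: "nat \<Rightarrow> (real \<Rightarrow> real) \<Rightarrow> real \<Rightarrow> real" where
  "pos_deriv n K y = (if y > 0 then (deriv ^^ n) K y else 0)"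

lemma integrable_riesz_exp:
  assumes a: "a > 0" and q: "q > 0" shows "integrable lborel (\<lambda>t. riesz a t * exp (- q * t))"
proof -
  have "riesz a t * exp (- q * t) = q powr (- a) * gamma_density a q t" for t
    using a q by (simp add: riesz_def gamma_density_def powr_minus)
  then show ?thesis using integrable_gamma_density[OF a q] by simp
qed

context
  fixes \<kappa> lam B :: real and K :: "real \<Rightarrow> real"
  assumes K: "sectorial \<kappa> lam B K" and kap: "\<kappa> > 1" and lam: "lam \<ge> 0"
begin

lemma pos_deriv_has_deriv:
  assumes x: "x > 0" shows "(pos_deriv n K has_real_derivative pos_deriv (Suc n) K x) (at x)"
proof -
  have "((deriv ^^ n) K has_real_derivative pos_deriv (Suc n) K x) (at x)"
    using sectorial_derivs(1)[OF K kap x, of n] x by (simp only: pos_deriv_def if_True)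
  then show ?thesis
    by (rule has_field_derivative_transform_within_open[OF _ open_greaterThan[of 0]])
      (use x in \<open>simp_all add: pos_deriv_def\<close>)
qed

lemma isCont_pos_deriv: "x > 0 \<Longrightarrow> isCont (pos_deriv n K) x"
  by (rule DERIV_isCont[OF pos_deriv_has_deriv])

lemma borel_measurable_pos_deriv: "pos_deriv n K \<in> borel_measurable borel"
proof -
  have "continuous_on {0<..} (pos_deriv n K)"
    by (intro continuous_at_imp_continuous_on ballI isCont_pos_deriv) auto
  then have "(\<lambda>x. if x \<in> {0<..} then pos_deriv n K x else 0) \<in> borel_measurable borel"
    by (intro borel_measurable_continuous_on_if) auto
  moreover have "(\<lambda>x. if x \<in> {0<..} then pos_deriv n K x else 0) = pos_deriv n K"
    by (auto simp: pos_deriv_def)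
  ultimately show ?thesis by simp
qed

lemma pos_deriv_bound:
  assumes "x > 0" shows "\<exists>C\<ge>0. \<forall>y\<ge>x. \<bar>pos_deriv n K y\<bar> \<le> C * exp (- lam / 2 * y)"
proof -
  obtain C where C: "\<And>y. y > 0 \<Longrightarrow> \<bar>(deriv ^^ n) K y\<bar> \<le> C * exp (- lam / 2 * y) / y ^ n"
    using sectorial_derivs(3)[OF K kap lam, of n] by blast
  have "0 \<le> C * exp (- lam / 2 * 1) / 1 ^ n" by (rule order_trans[OF abs_ge_zero C]) simp
  then have C0: "C \<ge> 0" by (simp add: zero_le_mult_iff)
  have "\<bar>pos_deriv n K y\<bar> \<le> C / x ^ n * exp (- lam / 2 * y)" if y: "y \<ge> x" for y
  proof -
    have "C * exp (- lam / 2 * y) / y ^ n \<le> C * exp (- lam / 2 * y) / x ^ n"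
      using C0 assms y by (intro divide_left_mono power_mono mult_nonneg_nonneg) auto
    then show ?thesis using C[of y] assms y by (simp add: pos_deriv_def)
  qed
  then show ?thesis using C0 assms by (intro exI[of _ "C / x ^ n"]) auto
qed

context
  fixes A :: "real \<Rightarrow> real" and c :: real
  assumes A[measurable]: "A \<in> borel_measurable borel" and A0: "\<And>t. t \<le> 0 \<Longrightarrow> A t = 0" and c: "c > 0"
    and Aint: "integrable lborel (\<lambda>t. A t * exp (- lam / 2 * c * t))"
begin

lemma integrable_shift:
  assumes x: "x > 0"
  shows "integrable lborel (\<lambda>t. A t * pos_deriv n K (x + c * t))"
proof -
  note [measurable] = borel_measurable_pos_deriv
  obtain C where C: "C \<ge> 0" "\<And>y. y \<ge> x \<Longrightarrow> \<bar>pos_deriv n K y\<bar> \<le> C * exp (- lam / 2 * y)"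
    using pos_deriv_bound[OF x] by metis
  show ?thesis
  proof (rule Bochner_Integration.integrable_bound)
    show "integrable lborel (\<lambda>t. C * exp (- lam / 2 * x) * (A t * exp (- lam / 2 * c * t)))"
      using Aint by simp
    show "AE t in lborel. norm (A t * pos_deriv n K (x + c * t)) \<le> norm (C * exp (- lam / 2 * x) * (A t * exp (- lam / 2 * c * t)))"
    proof (intro AE_I2)
      fix t :: real
      show "norm (A t * pos_deriv n K (x + c * t)) \<le> norm (C * exp (- lam / 2 * x) * (A t * exp (- lam / 2 * c * t)))"
      proof (cases "t > 0")
        case True
        then have "\<bar>pos_deriv n K (x + c * t)\<bar> \<le> C * exp (- lam / 2 * (x + c * t))" using C(2) c by simp
        also have "\<dots> = C * exp (- lam / 2 * x) * exp (- lam / 2 * c * t)"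
          by (simp add: exp_add[symmetric] distrib_left mult.assoc)
        finally have "\<bar>A t\<bar> * \<bar>pos_deriv n K (x + c * t)\<bar> \<le> \<bar>A t\<bar> * (C * exp (- lam / 2 * x) * exp (- lam / 2 * c * t))"
          by (rule mult_left_mono) simp
        then show ?thesis using C(1) by (simp add: abs_mult mult_ac)
      qed (simp add: A0)
    qed
  qed measurable
qed

text \<open>Differentiation under the integral. Starting at \<open>u / 2\<close> keeps the arguments
  away from the singularity at 0, and the mean value inequality on \<open>{u/2 + c * t..}\<close>
  dominates the quotients by a multiple of
  \<open>\<bar>A t * exp (- lam / 2 * c * t)\<bar>\<close>.\<close>

lemma deriv_shift:
  assumes u: "u > 0"
  shows "((\<lambda>u. LINT t|lborel. A t * pos_deriv n K (u + c * t)) has_real_derivative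
          (LINT t|lborel. A t * pos_deriv (Suc n) K (u + c * t))) (at u)"
proof -
  note [measurable] = borel_measurable_pos_deriv
  define I where "I u = (LINT t|lborel. A t * pos_deriv n K (u + c * t))" for u
  obtain C where C: "C \<ge> 0" "\<And>y. y \<ge> u / 2 \<Longrightarrow> \<bar>pos_deriv (Suc n) K y\<bar> \<le> C * exp (- lam / 2 * y)"
    using pos_deriv_bound[of "u/2" "Suc n"] u by auto
  have "(I has_real_derivative (LINT t|lborel. A t * pos_deriv (Suc n) K (u + c * t))) (at u within {u/2<..})"
    unfolding has_field_derivative_iff tendsto_at_iff_sequentially
  proof (intro allI impI)
    fix X assume X: "\<forall>i::nat. X i \<in> {u/2<..} - {u}" "X \<longlonglongrightarrow> u"
    define q where "q i t = (pos_deriv n K (X i + c * t) - pos_deriv n K (u + c * t)) / (X i - u)" for i t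
    have Xp: "X i > 0" for i using X(1) u by (auto simp: less_trans[of 0 "u/2"])
    have "(\<lambda>i. LINT t|lborel. A t * q i t) \<longlonglongrightarrow> (LINT t|lborel. A t * pos_deriv (Suc n) K (u + c * t))"
    proof (rule integral_dominated_convergence[where w="\<lambda>t. C * \<bar>A t * exp (- lam / 2 * c * t)\<bar>"])
      show "AE t in lborel. (\<lambda>i. A t * q i t) \<longlonglongrightarrow> A t * pos_deriv (Suc n) K (u + c * t)"
      proof (intro AE_I2)
        fix t :: real
        show "(\<lambda>i. A t * q i t) \<longlonglongrightarrow> A t * pos_deriv (Suc n) K (u + c * t)"
        proof (cases "t > 0")
          case True
          then have "u + c * t > 0" using u c by (simp add: add_pos_pos)
          from pos_deriv_has_deriv[OF this, of n]
          have "((\<lambda>v. pos_deriv n K (v + c * t)) has_real_derivative pos_deriv (Suc n) K (u + c * t)) (at u)"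
            by (simp add: DERIV_shift)
          then have "((\<lambda>y. (pos_deriv n K (y + c * t) - pos_deriv n K (u + c * t)) / (y - u)) \<longlongrightarrow> pos_deriv (Suc n) K (u + c * t)) (at u within UNIV)"
            by (simp add: has_field_derivative_iff)
          then have "(\<lambda>i. q i t) \<longlonglongrightarrow> pos_deriv (Suc n) K (u + c * t)"
            using X unfolding tendsto_at_iff_sequentially q_def comp_def by blast
          then show ?thesis by (rule tendsto_mult_left)
        qed (simp add: A0)
      qed
      show "AE t in lborel. norm (A t * q i t) \<le> C * \<bar>A t * exp (- lam / 2 * c * t)\<bar>" for i
      proof (intro AE_I2)
        fix t :: real
        show "norm (A t * q i t) \<le> C * \<bar>A t * exp (- lam / 2 * c * t)\<bar>"
        proof (cases "t > 0")
          case True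
          have "norm (pos_deriv n K (X i + c * t) - pos_deriv n K (u + c * t))
              \<le> C * exp (- lam / 2 * c * t) * norm (X i + c * t - (u + c * t))"
          proof (rule field_differentiable_bound[of "{u/2 + c * t..}" _ "pos_deriv (Suc n) K"])
            fix z assume z: "z \<in> {u/2 + c * t..}"
            have ct: "c * t > 0" using c True by simp
            then have zp: "z > 0" "z \<ge> u/2" using z u by auto
            show "(pos_deriv n K has_field_derivative pos_deriv (Suc n) K z) (at z within {u/2 + c * t..})"
              using pos_deriv_has_deriv[OF zp(1)] has_field_derivative_at_within by blast
            have "z \<ge> c * t" using z u by simp
            then have "exp (- lam / 2 * z) \<le> exp (- lam / 2 * c * t)"
              using lam mult_left_mono[of "c * t" z "lam"] by simp
            then have "C * exp (- lam / 2 * z) \<le> C * exp (- lam / 2 * c * t)" using C(1) by (rule mult_left_mono)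
            then show "norm (pos_deriv (Suc n) K z) \<le> C * exp (- lam / 2 * c * t)" using C(2)[OF zp(2)] by simp
          qed (use X(1) u in \<open>auto simp: less_imp_le\<close>)
          then have "\<bar>q i t\<bar> \<le> C * exp (- lam / 2 * c * t)"
            using X(1) by (simp add: q_def abs_divide divide_le_eq)
          then have "\<bar>A t\<bar> * \<bar>q i t\<bar> \<le> \<bar>A t\<bar> * (C * exp (- lam / 2 * c * t))" by (rule mult_left_mono) simp
          then show ?thesis by (simp add: abs_mult mult_ac)
        qed (simp add: A0)
      qed
      show "(\<lambda>t. A t * q i t) \<in> borel_measurable lborel" for i unfolding q_def by measurable
      show "integrable lborel (\<lambda>t. C * \<bar>A t * exp (- lam / 2 * c * t)\<bar>)"
        using integrable_abs[OF Aint] by simp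
    qed measurable
    moreover have "(LINT t|lborel. A t * q i t) = (I (X i) - I u) / (X i - u)" for i
    proof -
      have "A t * q i t = (A t * pos_deriv n K (X i + c * t) - A t * pos_deriv n K (u + c * t)) / (X i - u)" for t
        by (simp add: q_def right_diff_distrib)
      then show ?thesis unfolding I_def
        using integrable_shift[OF Xp[of i], of n] integrable_shift[OF u, of n] by simp
    qed
    ultimately show "((\<lambda>y. (I y - I u) / (y - u)) \<circ> X) \<longlonglongrightarrow> (LINT t|lborel. A t * pos_deriv (Suc n) K (u + c * t))"
      by (simp add: comp_def)
  qed
  moreover have "at u within {u/2<..} = at u" using u by (intro at_within_open) auto
  ultimately show ?thesis by (simp add: I_def[abs_def])
qed

end

text \<open>Fundamental theorem of calculus on \<open>(0, \<infinity>)\<close>; the boundary term at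
  infinity vanishes by the exponential decay, hence \<open>lam > 0\<close>.\<close>

lemma weyl_one:
  assumes lp: "lam > 0" and x: "x > 0"
  shows "(LINT t|lborel. riesz 1 t * pos_deriv (Suc n) K (x + t)) = - pos_deriv n K x"
proof -
  have i: "integrable lborel (\<lambda>t. riesz 1 t * pos_deriv (Suc n) K (x + 1 * t))"
    by (rule integrable_shift) (use lp x integrable_riesz_exp[of 1 "lam/2"] in auto)
  have e: "riesz 1 t * pos_deriv (Suc n) K (x + t) = indicator (einterval 0 \<infinity>) t *\<^sub>R pos_deriv (Suc n) K (x + t)" for t
    by (auto simp: riesz_def indicator_def einterval_def)
  have "(LBINT t=0..\<infinity>. pos_deriv (Suc n) K (x + t)) = 0 - pos_deriv n K x"
  proof (rule interval_integral_FTC_integrable)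
    show "((\<lambda>t. pos_deriv n K (x + t)) has_vector_derivative pos_deriv (Suc n) K (x + t)) (at t)" if "0 < ereal t" for t
      using pos_deriv_has_deriv[of "x + t" n] that x DERIV_shift[of "pos_deriv n K" _ t x]
      by (simp add: has_real_derivative_iff_has_vector_derivative[symmetric] add.commute)
    show "isCont (\<lambda>t. pos_deriv (Suc n) K (x + t)) t" if "0 < ereal t" for t
      by (rule isCont_o2[OF _ isCont_pos_deriv]) (use that x in auto)
    show "set_integrable lborel (einterval 0 \<infinity>) (\<lambda>t. pos_deriv (Suc n) K (x + t))"
      using i e by (simp add: set_integrable_def)
    have "isCont (\<lambda>t. pos_deriv n K (x + t)) 0"
      by (rule isCont_o2[OF _ isCont_pos_deriv]) (use x in auto)
    then have "((\<lambda>t. pos_deriv n K (x + t)) \<longlongrightarrow> pos_deriv n K x) (at_right 0)"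
      by (simp add: isCont_def filterlim_at_split)
    then show "(((\<lambda>t. pos_deriv n K (x + t)) \<circ> real_of_ereal) \<longlongrightarrow> pos_deriv n K x) (at_right 0)"
      by (simp add: ereal_tendsto_simps zero_ereal_def)
    obtain C where C: "\<And>y. y \<ge> x \<Longrightarrow> \<bar>pos_deriv n K y\<bar> \<le> C * exp (- lam / 2 * y)"
      using pos_deriv_bound[OF x] by metis
    have "((\<lambda>t. pos_deriv n K (x + t)) \<longlongrightarrow> 0) at_top"
    proof (rule Lim_null_comparison)
      show "eventually (\<lambda>t. norm (pos_deriv n K (x + t)) \<le> C * exp (- lam / 2 * (x + t))) at_top"
        using eventually_ge_at_top[of 0] by eventually_elim (use C in auto)
      have "filterlim (\<lambda>t. - lam / 2 * (x + t)) at_bot at_top" using lp by real_asymp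
      then show "((\<lambda>t. C * exp (- lam / 2 * (x + t))) \<longlongrightarrow> 0) at_top"
        by (intro tendsto_mult_right_zero filterlim_compose[OF exp_at_bot])
    qed
    then show "(((\<lambda>t. pos_deriv n K (x + t)) \<circ> real_of_ereal) \<longlongrightarrow> 0) (at_left \<infinity>)"
      by (simp add: ereal_tendsto_simps)
  qed simp
  moreover have "(LBINT t=0..\<infinity>. pos_deriv (Suc n) K (x + t)) = (LINT t|lborel. riesz 1 t * pos_deriv (Suc n) K (x + t))"
    by (simp add: interval_lebesgue_integral_def set_lebesgue_integral_def e)
  ultimately show ?thesis by simp
qed

lemma integrable_weyl:
  assumes lp: "lam > 0" and x: "x > 0" and a: "a > 0"
  shows "integrable lborel (\<lambda>t. riesz a t * pos_deriv n K (x + t))"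
proof -
  have "integrable lborel (\<lambda>t. riesz a t * pos_deriv n K (x + 1 * t))"
    by (rule integrable_shift) (use lp x a integrable_riesz_exp[of a "lam/2"] in auto)
  then show ?thesis by simp
qed

lemma weyl_weyl:
  assumes lp: "lam > 0" and x: "x > 0" and a: "a > 0" and b: "b > 0"
  shows "integrable lborel (\<lambda>w. riesz a w * (LINT t|lborel. riesz b t * pos_deriv n K (x + w + t)))"
    and "(LINT w|lborel. riesz a w * (LINT t|lborel. riesz b t * pos_deriv n K (x + w + t)))
      = (LINT t|lborel. riesz (a + b) t * pos_deriv n K (x + t))"
proof -
  note [measurable] = borel_measurable_pos_deriv
  note c = integral_conv_kernel[of "riesz a" "riesz b" "\<lambda>t. pos_deriv n K (x + t)" "riesz (a + b)"]
  show "integrable lborel (\<lambda>w. riesz a w * (LINT t|lborel. riesz b t * pos_deriv n K (x + w + t)))"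
    using c(1) a b integrable_weyl[OF lp x, of "a + b" n]
    by (simp add: riesz_nonneg nn_integral_riesz_conv add.assoc)
  show "(LINT w|lborel. riesz a w * (LINT t|lborel. riesz b t * pos_deriv n K (x + w + t)))
      = (LINT t|lborel. riesz (a + b) t * pos_deriv n K (x + t))"
    using c(2) a b integrable_weyl[OF lp x, of "a + b" n]
    by (simp add: riesz_nonneg nn_integral_riesz_conv add.assoc)
qed

text \<open>\<open>weyl_one\<close> iterated through the semigroup law. The sign is the one that the
  prefactor of the Caputo derivative cancels.\<close>

lemma weyl_nat:
  assumes lp: "lam > 0" and x: "x > 0"
  shows "(LINT t|lborel. riesz (real (Suc n)) t * pos_deriv (Suc n) K (x + t)) = (-1) ^ Suc n * K x"
proof (induction n)
  case 0 then show ?case using weyl_one[OF lp x, of 0] x by (simp add: pos_deriv_def)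
next
  case (Suc n)
  have "(LINT t|lborel. riesz (real (Suc (Suc n))) t * pos_deriv (Suc (Suc n)) K (x + t))
      = (LINT w|lborel. riesz (real (Suc n)) w * (LINT t|lborel. riesz 1 t * pos_deriv (Suc (Suc n)) K (x + w + t)))"
    using weyl_weyl(2)[OF lp x, of "real (Suc n)" 1 "Suc (Suc n)"] by (simp add: add.commute)
  also have "\<dots> = (LINT w|lborel. - (riesz (real (Suc n)) w * pos_deriv (Suc n) K (x + w)))"
  proof (rule Bochner_Integration.integral_cong[OF refl])
    fix w :: real
    show "riesz (real (Suc n)) w * (LINT t|lborel. riesz 1 t * pos_deriv (Suc (Suc n)) K (x + w + t))
        = - (riesz (real (Suc n)) w * pos_deriv (Suc n) K (x + w))"
      using weyl_one[OF lp, of "x + w" "Suc n"] x by (cases "w > 0") auto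
  qed
  also have "\<dots> = (-1) ^ Suc (Suc n) * K x" using Suc by simp
  finally show ?case .
qed

text \<open>The \<open>N\<close> derivatives are taken under the integral; the kernels of orders
  \<open>N - r\<close> and \<open>r\<close> then combine to the integer order \<open>N\<close>,
  where \<open>weyl_nat\<close> applies. Integer \<open>r\<close> is covered too, because
  \<open>N - r > 0\<close> always.\<close>

lemma caputo_right_riesz:
  assumes lp: "lam > 0" and r: "r > 0"
    and f: "\<And>u. u > 0 \<Longrightarrow> f u = C * (LINT t|lborel. riesz r t * pos_deriv 0 K (u + t))"
  shows "\<exists>g. caputo_right r f = Some g \<and> (\<forall>u>0. g u = C * K u)"
proof -
  define N where "N = nat \<lfloor>r\<rfloor> + 1"
  have "real N > r" using r by (simp add: N_def) linarith
  then have q: "real N - r > 0" by simp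
  then have G: "Gamma (real N - r) \<noteq> 0" using Gamma_real_pos by (metis less_irrefl)
  define I where "I n u = (LINT t|lborel. riesz r t * pos_deriv n K (u + t))" for n u
  have DI: "(I n has_real_derivative I (Suc n) u) (at u)" if "u > 0" for n u
    using deriv_shift[of "riesz r" 1 u n] integrable_riesz_exp[of r "lam/2"] r lp that
    unfolding I_def by simp
  define D where "D n u = C * I n u" for n u
  have f0: "f u = D 0 u" if "u > 0" for u using f[OF that] by (simp add: D_def I_def)
  have DD: "(D n has_real_derivative D (Suc n) u) (at u)" if "u > 0" for n u
    unfolding D_def using DI[OF that] by (intro DERIV_cmult)
  note it = iterated_deriv_eq[of f D N, OF f0 DD]
  have e: "indicator {x..} y *\<^sub>R ((y - x) powr (real N - r - 1) * (deriv ^^ N) f y)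
      = Gamma (real N - r) * C * (riesz (real N - r) (y - x) * I N y)" if x: "x > 0" for x y
  proof (cases "y > x")
    case True then show ?thesis using it(2)[of N y] x G by (simp add: riesz_def D_def)
  next
    case False then show ?thesis by (cases "y = x") (auto simp: riesz_def)
  qed
  have i: "integrable lborel (\<lambda>w. riesz (real N - r) w * I N (x + w))"
    and j: "(LINT w|lborel. riesz (real N - r) w * I N (x + w)) = (-1) ^ N * K x" if x: "x > 0" for x
  proof -
    show "integrable lborel (\<lambda>w. riesz (real N - r) w * I N (x + w))"
      unfolding I_def by (rule weyl_weyl(1)[OF lp x q r])
    have "(LINT w|lborel. riesz (real N - r) w * I N (x + w)) = (LINT t|lborel. riesz (real N) t * pos_deriv N K (x + t))"
      unfolding I_def weyl_weyl(2)[OF lp x q r] by simp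
    also have "\<dots> = (-1) ^ N * K x" using weyl_nat[OF lp x, of "N - 1"] by (simp add: N_def)
    finally show "(LINT w|lborel. riesz (real N - r) w * I N (x + w)) = (-1) ^ N * K x" .
  qed
  have i': "integrable lborel (\<lambda>y. riesz (real N - r) (y - x) * I N y)"
    and j': "(LINT y|lborel. riesz (real N - r) (y - x) * I N y) = (-1) ^ N * K x" if x: "x > 0" for x
  proof -
    have "integrable lborel (\<lambda>y. riesz (real N - r) (- x + 1 * y) * I N (x + (- x + 1 * y)))"
      by (rule lborel_integrable_real_affine[OF i[OF x]]) simp
    then show "integrable lborel (\<lambda>y. riesz (real N - r) (y - x) * I N y)" by simp
    have "(LINT w|lborel. riesz (real N - r) w * I N (x + w))
        = \<bar>1\<bar> *\<^sub>R (LINT y|lborel. riesz (real N - r) (- x + 1 * y) * I N (x + (- x + 1 * y)))"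
      by (rule lborel_integral_real_affine) simp
    then show "(LINT y|lborel. riesz (real N - r) (y - x) * I N y) = (-1) ^ N * K x" using j[OF x] by simp
  qed
  have s: "set_integrable lborel {x..} (\<lambda>y. (y - x) powr (real N - r - 1) * (deriv ^^ N) f y)" if x: "x > 0" for x
    unfolding set_integrable_def e[OF x] using i'[OF x] by simp
  have "(LINT y:{x..}|lborel. (y - x) powr (real N - r - 1) * (deriv ^^ N) f y) = Gamma (real N - r) * C * ((-1) ^ N * K x)"
    if x: "x > 0" for x
    unfolding set_lebesgue_integral_def e[OF x] using j'[OF x] by simp
  moreover have "(- 1) ^ N * ((- 1) ^ N * y) = (y::real)" for y
    by (simp add: mult.assoc[symmetric] power_add[symmetric] mult_2[symmetric])
  ultimately show ?thesis
    unfolding caputo_right_def N_def[symmetric] Let_def using it(1) s G by (simp add: mult.left_commute)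
qed

end

text \<open>After rescaling \<open>t\<close> by \<open>c\<close>, the gamma average is a right-sided
  integral of the tilted function \<open>K\<close>. The tilt by \<open>lam / c\<close> supplies the
  decay, so bounded \<open>h\<close> suffices. \<open>C\<close> collects the constants produced by
  operators applied earlier.\<close>

lemma gamma_arrival_op_avg:
  assumes h: "sectorial \<kappa> 0 B h" and kap: "\<kappa> > 1" and [measurable]: "h \<in> borel_measurable borel"
    and r: "r > 0" and lam: "lam > 0" and c: "c > 0"
    and f: "\<And>u. u > 0 \<Longrightarrow> f u = C * avg c (gamma_law r lam) h u"
  shows "\<exists>g. gamma_arrival_op c r lam f = Some g \<and> (\<forall>u>0. g u = C * lam powr r * h u)"
proof -
  define K where "K y = exp (- (lam / c) * y) * h y" for y
  have K: "sectorial \<kappa> (lam / c) B K" unfolding K_def by (rule sectorial_exp_mult[OF h])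
  have lc: "lam / c > 0" using lam c by simp
  have e: "exp (- (lam / c) * u) * f u = C * lam powr r * c powr (- r) * (LINT t|lborel. riesz r t * pos_deriv 0 K (u + t))"
    if u: "u > 0" for u
  proof -
    have "(LINT t|lborel. riesz r t * pos_deriv 0 K (u + t))
        = \<bar>c\<bar> *\<^sub>R (LINT t|lborel. riesz r (0 + c * t) * pos_deriv 0 K (u + (0 + c * t)))"
      by (rule lborel_integral_real_affine) (use c in simp)
    also have "(LINT t|lborel. riesz r (0 + c * t) * pos_deriv 0 K (u + (0 + c * t)))
        = (LINT t|lborel. c powr (r - 1) * lam powr (- r) * exp (- (lam / c) * u) * (gamma_density r lam t * h (u + c * t)))"
    proof (rule Bochner_Integration.integral_cong[OF refl])
      fix t :: real
      show "riesz r (0 + c * t) * pos_deriv 0 K (u + (0 + c * t))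
          = c powr (r - 1) * lam powr (- r) * exp (- (lam / c) * u) * (gamma_density r lam t * h (u + c * t))"
      proof (cases "t > 0")
        case True
        then have p: "c * t > 0" "u + c * t > 0" using c u by (auto simp: add_pos_pos)
        have ex: "exp (- (lam / c) * (u + c * t)) = exp (- (lam / c) * u) * exp (- lam * t)"
          using c by (simp add: exp_add[symmetric] field_simps)
        have "pos_deriv 0 K (u + c * t) = exp (- (lam / c) * u) * exp (- lam * t) * h (u + c * t)"
          using p(2) by (simp only: pos_deriv_def K_def if_True funpow_0 id_apply ex)
        then show ?thesis using True p(1) c lam
          by (simp add: riesz_def gamma_density_def powr_mult powr_minus)
      next
        case False
        then have "c * t \<le> 0" using c by (simp add: mult_le_0_iff)
        then show ?thesis using False by (simp add: gamma_density_def)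
      qed
    qed
    also have "\<dots> = c powr (r - 1) * lam powr (- r) * exp (- (lam / c) * u) * avg c (gamma_law r lam) h u"
      by (simp add: avg_def integral_gamma_law[OF r lam])
    finally have l: "(LINT t|lborel. riesz r t * pos_deriv 0 K (u + t))
        = c powr r * lam powr (- r) * exp (- (lam / c) * u) * avg c (gamma_law r lam) h u"
      using c by (simp add: powr_diff)
    have "lam powr r * c powr (- r) * (c powr r * lam powr (- r)) = 1"
      using c lam by (simp add: powr_minus field_simps)
    then have "C * (lam powr r * c powr (- r) * (c powr r * lam powr (- r))) * exp (- (lam / c) * u) * avg c (gamma_law r lam) h u
        = C * exp (- (lam / c) * u) * avg c (gamma_law r lam) h u" by simp
    then show ?thesis unfolding l f[OF u] by (simp only: mult_ac)
  qed
  obtain g where g: "caputo_right r (\<lambda>y. exp (- (lam / c) * y) * f y) = Some g"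
    "\<And>u. u > 0 \<Longrightarrow> g u = C * lam powr r * c powr (- r) * K u"
    using caputo_right_riesz[OF K kap _ lc r e] lc by auto
  have "c powr r * (exp (lam / c * u) * g u) = C * lam powr r * h u" if "u > 0" for u
  proof -
    have "(c powr r * c powr (- r)) * (exp (lam / c * u) * exp (- (lam / c) * u)) = 1"
      using c by (simp add: powr_minus exp_add[symmetric])
    moreover have "c powr r * (exp (lam / c * u) * g u)
        = C * lam powr r * h u * ((c powr r * c powr (- r)) * (exp (lam / c * u) * exp (- (lam / c) * u)))"
      unfolding g(2)[OF that] K_def by (simp only: mult_ac)
    ultimately show ?thesis by simp
  qed
  then show ?thesis using g(1) by (simp add: gamma_arrival_op_def right_frac_op_def)
qed

text \<open>Serves both the equation and the initial values: at \<open>r = s\<close> the integral is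
  inverted, while at \<open>r < s\<close> an integral of order \<open>s - r\<close> remains, which
  is \<open>O(u powr (s - r))\<close> at 0.\<close>

lemma left_frac_op_avg:
  assumes cont: "\<And>x. x > 0 \<Longrightarrow> isCont h x" and [measurable]: "h \<in> borel_measurable borel"
    and neg: "\<And>x. x < 0 \<Longrightarrow> h x = 0" and bd: "\<And>x. \<bar>h x\<bar> \<le> B"
    and s: "s > 0" and \<alpha>: "\<alpha> > 0" and r: "r \<le> s"
    and f: "\<And>u. u > 0 \<Longrightarrow> f u = C * avg (- 1) (gamma_law s \<alpha>) h u"
  shows "\<exists>g. left_frac_op \<alpha> r f = Some g \<and> (r = s \<longrightarrow> (\<forall>u>0. g u = C * \<alpha> powr s * h u))
           \<and> (r < s \<longrightarrow> (g \<longlongrightarrow> 0) (at_right 0))"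
proof -
  define G where "G y = (if y > 0 then C * \<alpha> powr s * exp (\<alpha> * y) * h y else 0)" for y
  have "left_bounded G" unfolding left_bounded_def
  proof
    fix x
    have "\<bar>G y\<bar> \<le> \<bar>C\<bar> * \<alpha> powr s * exp (\<alpha> * \<bar>x\<bar>) * B" if "y \<le> x" for y
    proof (cases "y > 0")
      case True
      have B: "B \<ge> 0" using bd[of 0] by simp
      have "\<bar>G y\<bar> = \<bar>C\<bar> * \<alpha> powr s * exp (\<alpha> * y) * \<bar>h y\<bar>" using True by (simp add: G_def abs_mult)
      also have "\<dots> \<le> \<bar>C\<bar> * \<alpha> powr s * exp (\<alpha> * \<bar>x\<bar>) * B"
        using that \<alpha> bd[of y] B by (intro mult_mono mult_nonneg_nonneg) auto
      finally show ?thesis .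
    next
      case False then show ?thesis using bd[of 0] by (simp add: G_def)
    qed
    then show "\<exists>B. \<forall>y\<le>x. \<bar>G y\<bar> \<le> B" by blast
  qed
  moreover have [measurable]: "G \<in> borel_measurable borel" unfolding G_def by measurable
  ultimately have G: "causal G" by (simp add: causal_def G_def)
  have Gc: "isCont G x" if x: "x > 0" for x
  proof -
    have "isCont (\<lambda>y. C * \<alpha> powr s * exp (\<alpha> * y) * h y) x" by (intro continuous_intros cont x)
    moreover have "\<forall>\<^sub>F y in nhds x. G y = C * \<alpha> powr s * exp (\<alpha> * y) * h y"
      using order_tendstoD(1)[OF tendsto_ident_at x] eventually_nhds_in_open[OF open_greaterThan[of 0], of x] x
      by (auto elim!: eventually_mono simp: G_def)
    ultimately show ?thesis by (simp add: isCont_cong)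
  qed
  have e: "exp (\<alpha> * y) * f y = RLI s G y" if y: "y > 0" for y
  proof -
    have "RLI s G y = (LINT w|lborel. exp (\<alpha> * y) * C * (gamma_density s \<alpha> w * h (y - w)))"
      unfolding RLI_def
    proof (rule integral_cong_AE)
      show "AE w in lborel. riesz s w * G (y - w) = exp (\<alpha> * y) * C * (gamma_density s \<alpha> w * h (y - w))"
      proof (rule eventually_mono[OF AE_lborel_singleton[of y]])
        fix w :: real assume w: "w \<noteq> y"
        have ex: "exp (\<alpha> * (y - w)) = exp (\<alpha> * y) * exp (- \<alpha> * w)"
          by (simp add: exp_add[symmetric] right_diff_distrib)
        show "riesz s w * G (y - w) = exp (\<alpha> * y) * C * (gamma_density s \<alpha> w * h (y - w))"
          using w neg[of "y - w"] by (auto simp: riesz_def gamma_density_def G_def ex)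
      qed
    qed measurable
    then show ?thesis using f[OF y] by (simp add: avg_def integral_gamma_law[OF s \<alpha>])
  qed
  obtain k where k: "RL_left r (\<lambda>y. exp (\<alpha> * y) * f y) = Some k" "\<And>x. x > 0 \<Longrightarrow> k x = RLI0 (s - r) G x"
    using RL_left_RLI[OF G Gc s r e] by blast
  have 1: "exp (- \<alpha> * u) * k u = C * \<alpha> powr s * h u" if "r = s" "u > 0" for u
  proof -
    have "exp (- \<alpha> * u) * exp (\<alpha> * u) = 1" by (simp add: exp_add[symmetric])
    then show ?thesis using k(2)[OF that(2)] that by (simp add: RLI0_def G_def mult_ac)
  qed
  have 2: "((\<lambda>u. exp (- \<alpha> * u) * k u) \<longlongrightarrow> 0) (at_right 0)" if rs: "r < s"
  proof -
    obtain b where b: "\<And>y. y \<le> 1 \<Longrightarrow> \<bar>G y\<bar> \<le> b" using G unfolding causal_def left_bounded_def by metis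
    define q where "q = s - r"
    have q: "q > 0" using rs by (simp add: q_def)
    have "norm (exp (- \<alpha> * u) * k u) \<le> b * (u powr q / Gamma (q + 1))" if u: "0 < u" "u < 1" for u
    proof -
      have "\<bar>RLI q G u\<bar> \<le> b * riesz (q + 1) u" by (rule abs_RLI_le[OF G q]) (use b u in auto)
      moreover have "exp (- \<alpha> * u) \<le> 1" using \<alpha> u by simp
      then have "exp (- \<alpha> * u) * \<bar>k u\<bar> \<le> \<bar>k u\<bar>" by (rule mult_left_le_one_le[rotated 2]) auto
      ultimately show ?thesis using k(2)[OF u(1)] rs u by (simp add: abs_mult RLI0_def q_def riesz_def)
    qed
    then have ev: "eventually (\<lambda>u. norm (exp (- \<alpha> * u) * k u) \<le> b * (u powr q / Gamma (q + 1))) (at_right 0)"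
      using eventually_at_right_less[of 0] order_tendstoD(2)[OF tendsto_ident_at zero_less_one, of "{0<..}"]
      by (auto elim!: eventually_elim2)
    have "eventually (\<lambda>u. 0 \<le> u) (at_right (0::real))"
      using eventually_at_right_less[of "0::real"] by eventually_elim simp
    then have "((\<lambda>u. u powr q) \<longlongrightarrow> 0) (at_right 0)"
      by (rule tendsto_zero_powrI[OF tendsto_ident_at tendsto_const _ q])
    from tendsto_mult_left[OF this, of "b / Gamma (q + 1)"]
    have "((\<lambda>u. b * (u powr q / Gamma (q + 1))) \<longlongrightarrow> 0) (at_right 0)" by simp
    with ev show ?thesis by (rule Lim_null_comparison)
  qed
  show ?thesis using k(1) 1 2 by (simp add: left_frac_op_def)
qed

text \<open>The tail of a density, but 0 instead of the total mass on \<open>x \<le> 0\<close>: only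
  so can \<open>lam * surv d\<close> be a convolution of functions carried by the positive
  half-line.\<close>

definition surv :: "(real \<Rightarrow> real) \<Rightarrow> real \<Rightarrow> real" where
  "surv d x = (if x > 0 then (LINT t|lborel. indicator {x<..} t * d t) else 0)"

lemma borel_measurable_surv:
  assumes [measurable]: "d \<in> borel_measurable borel" shows "surv d \<in> borel_measurable borel"
proof -
  have "surv d = (\<lambda>x. if x > 0 then (LINT t|lborel. (if x < t then 1 else 0) * d t) else 0)"
  proof
    fix x
    have "indicator {x<..} t * d t = (if x < t then 1 else 0) * d t" for t by (simp add: indicator_def)
    then show "surv d x = (if x > 0 then (LINT t|lborel. (if x < t then 1 else 0) * d t) else 0)"
      by (simp only: surv_def)
  qed
  then show ?thesis by simp
qed

lemma integrable_mult_exp: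
  fixes d :: "real \<Rightarrow> real"
  assumes int: "integrable lborel d" and [measurable]: "d \<in> borel_measurable borel"
    and d0: "\<And>t. t \<le> 0 \<Longrightarrow> d t = 0" and e: "e > 0" and c: "c > 0"
  shows "integrable lborel (\<lambda>t. d t * exp (- e / 2 * c * t))"
proof (rule Bochner_Integration.integrable_bound[OF int])
  show "AE t in lborel. norm (d t * exp (- e / 2 * c * t)) \<le> norm (d t)"
  proof (intro AE_I2)
    fix t :: real
    show "norm (d t * exp (- e / 2 * c * t)) \<le> norm (d t)"
      using d0[of t] e c by (cases "t > 0") (auto simp: abs_mult mult_le_cancel_left2)
  qed
qed measurable

text \<open>Integration by parts against a density on the half-line, carried out with Fubini's theorem.\<close>

lemma integral_surv_deriv:
  assumes K: "sectorial \<kappa> e B K" and kap: "\<kappa> > 1" and ep: "e > 0" and c: "c > 0" and x: "x > 0"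
    and d[measurable]: "d \<in> borel_measurable borel" and d0: "\<And>t. t \<le> 0 \<Longrightarrow> d t = 0" and dn: "\<And>t. d t \<ge> 0"
    and prob: "(LINT t|lborel. d t) = 1" and int: "integrable lborel d"
  shows "integrable lborel (\<lambda>s. surv d s * pos_deriv 1 K (x + c * s))"
    and "c * (LINT s|lborel. surv d s * pos_deriv 1 K (x + c * s)) = (LINT t|lborel. d t * pos_deriv 0 K (x + c * t)) - K x"
proof -
  note e0 = less_imp_le[OF ep]
  note [measurable] = borel_measurable_pos_deriv[OF K kap e0]
  \<comment> \<open>The integrand lives on \<open>0 < s < t\<close>: integrating over
    \<open>t\<close> first produces the tail of \<open>d\<close>, over \<open>s\<close> first the
    increment of \<open>K\<close>.\<close>
  define F where "F = (\<lambda>(s::real, t). (if 0 < s \<and> s < t then 1 else 0) * d t * pos_deriv 1 K (x + c * s))"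
  have [measurable]: "F \<in> borel_measurable (lborel \<Otimes>\<^sub>M lborel)" unfolding F_def by measurable
  have ii: "integrable lborel (\<lambda>t. indicator {s<..} t * d t)" for s
    by (rule Bochner_Integration.integrable_bound[OF int]) (auto simp: indicator_def)
  have in1: "(LINT t|lborel. F (s, t)) = surv d s * pos_deriv 1 K (x + c * s)" for s
  proof -
    have "F (s, t) = (if s > 0 then indicator {s<..} t * d t * pos_deriv 1 K (x + c * s) else 0)" for t
      by (simp add: F_def indicator_def)
    then show ?thesis by (simp add: surv_def)
  qed
  have sn: "0 \<le> surv d s" "surv d s \<le> riesz 1 s" for s
  proof -
    show "0 \<le> surv d s" unfolding surv_def by (auto intro!: integral_nonneg_AE simp: dn)
    have "(LINT t|lborel. indicator {s<..} t * d t) \<le> (LINT t|lborel. d t)"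
      by (rule integral_mono[OF ii int]) (auto simp: indicator_def dn)
    then show "surv d s \<le> riesz 1 s" by (simp add: surv_def prob riesz_def)
  qed
  note [measurable] = borel_measurable_surv[OF d]
  have r1: "integrable lborel (\<lambda>s. riesz 1 s * pos_deriv 1 K (x + c * s))"
    by (rule integrable_shift[OF K kap e0]) (use c x integrable_riesz_exp[of 1 "e/2*c"] ep in \<open>auto simp: mult.assoc\<close>)
  show i1: "integrable lborel (\<lambda>s. surv d s * pos_deriv 1 K (x + c * s))"
    by (rule Bochner_Integration.integrable_bound[OF r1])
      (use sn in \<open>auto simp: abs_mult riesz_nonneg intro!: mult_right_mono AE_I2\<close>)
  have Fint: "integrable (lborel \<Otimes>\<^sub>M lborel) F"
  proof (rule lborel_pair.Fubini_integrable)
    have "(LINT t|lborel. norm (F (s, t))) = \<bar>surv d s * pos_deriv 1 K (x + c * s)\<bar>" for s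
    proof -
      have "norm (F (s, t)) = (if s > 0 then indicator {s<..} t * d t * \<bar>pos_deriv 1 K (x + c * s)\<bar> else 0)" for t
        by (simp add: F_def indicator_def abs_mult dn)
      then show ?thesis using sn(1)[of s] by (simp add: surv_def abs_mult)
    qed
    then show "integrable lborel (\<lambda>s. LINT t|lborel. norm (F (s, t)))" using i1 by simp
    have "integrable lborel (\<lambda>t. F (s, t))" for s
    proof -
      have "(\<lambda>t. F (s, t)) = (\<lambda>t. indicator {s<..} t * d t * (if s > 0 then pos_deriv 1 K (x + c * s) else 0))"
        by (auto simp: F_def indicator_def)
      then show ?thesis using ii by simp
    qed
    then show "AE s in lborel. integrable lborel (\<lambda>t. F (s, t))" by simp
  qed measurable
  have in2: "c * (LINT s|lborel. F (s, t)) = d t * (pos_deriv 0 K (x + c * t) - K x)" for t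
  proof (cases "t > 0")
    case True
    have "(LBINT s=0..t. c * pos_deriv 1 K (x + c * s)) = pos_deriv 0 K (x + c * t) - pos_deriv 0 K (x + c * 0)"
    proof (rule interval_integral_FTC_finite[where a=0, simplified zero_ereal_def[symmetric]])
      have p: "x + c * s > 0" if "s \<in> {min 0 t..max 0 t}" for s
        using that True c x by (intro add_pos_nonneg) auto
      show "continuous_on {min 0 t..max 0 t} (\<lambda>s. c * pos_deriv 1 K (x + c * s))"
        by (intro continuous_at_imp_continuous_on ballI continuous_mult continuous_const isCont_o2[OF _ isCont_pos_deriv[OF K kap e0]])
          (use p in auto)
      fix s assume s: "min 0 t \<le> s" "s \<le> max 0 t"
      have "((\<lambda>s. pos_deriv 0 K (x + c * s)) has_real_derivative pos_deriv (Suc 0) K (x + c * s) * c) (at s)"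
        by (rule DERIV_chain2[OF pos_deriv_has_deriv[OF K kap e0]]) (use p[of s] s in \<open>auto intro!: derivative_eq_intros\<close>)
      then show "((\<lambda>s. pos_deriv 0 K (x + c * s)) has_vector_derivative c * pos_deriv 1 K (x + c * s)) (at s within {min 0 t..max 0 t})"
        by (simp add: has_real_derivative_iff_has_vector_derivative[symmetric] mult.commute has_field_derivative_at_within)
    qed
    moreover have "(LBINT s=0..t. c * pos_deriv 1 K (x + c * s)) = (LINT s|lborel. (if 0 < s \<and> s < t then 1 else 0) * (c * pos_deriv 1 K (x + c * s)))"
    proof -
      have "indicator (einterval 0 (ereal t)) s *\<^sub>R (c * pos_deriv 1 K (x + c * s)) = (if 0 < s \<and> s < t then 1 else 0) * (c * pos_deriv 1 K (x + c * s))" for s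
        by (auto simp: einterval_def indicator_def)
      moreover have "(0::ereal) \<le> ereal t" using True by simp
      ultimately show ?thesis
        by (simp only: interval_lebesgue_integral_def set_lebesgue_integral_def if_True)
    qed
    moreover have "F (s, t) = d t * ((if 0 < s \<and> s < t then 1 else 0) * pos_deriv 1 K (x + c * s))" for s
      by (simp add: F_def)
    moreover have "(LINT s|lborel. (if 0 < s \<and> s < t then 1 else 0) * (c * pos_deriv 1 K (x + c * s)))
        = c * (LINT s|lborel. (if 0 < s \<and> s < t then 1 else 0) * pos_deriv 1 K (x + c * s))"
      by (subst integral_mult_right_zero[symmetric]) (rule Bochner_Integration.integral_cong, auto)
    ultimately show ?thesis using x by (simp add: pos_deriv_def[of 0])
  next
    case False
    then have "F (s, t) = 0" for s by (simp add: F_def)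
    then show ?thesis using False d0 by simp
  qed
  have i3: "integrable lborel (\<lambda>t. d t * exp (- e / 2 * c * t))"
    by (rule integrable_mult_exp[OF int d d0 ep c])
  have i2: "integrable lborel (\<lambda>t. d t * pos_deriv 0 K (x + c * t))"
    by (rule integrable_shift[OF K kap e0 d d0 c i3 x])
  have "c * (LINT s|lborel. surv d s * pos_deriv 1 K (x + c * s)) = c * (LINT s|lborel. LINT t|lborel. F (s, t))"
    by (simp only: in1)
  also have "\<dots> = c * (LINT t|lborel. LINT s|lborel. F (s, t))"
    using lborel_pair.Fubini_integral[of "\<lambda>s t. F (s, t)"] Fint by simp
  also have "\<dots> = (LINT t|lborel. d t * pos_deriv 0 K (x + c * t) - K x * d t)"
    by (subst integral_mult_right_zero[symmetric]) (simp add: in2 right_diff_distrib mult.commute)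
  also have "\<dots> = (LINT t|lborel. d t * pos_deriv 0 K (x + c * t)) - K x"
    using i2 int prob by simp
  finally show "c * (LINT s|lborel. surv d s * pos_deriv 1 K (x + c * s)) = (LINT t|lborel. d t * pos_deriv 0 K (x + c * t)) - K x" .
qed

section \<open>The Mittag-Leffler density\<close>

text \<open>Log-convexity: \<open>y\<close> is the convex combination of \<open>y - 1\<close> and
  \<open>y + \<mu>\<close> with weights \<open>\<mu> / (1 + \<mu>)\<close> and
  \<open>1 / (1 + \<mu>)\<close>, and \<open>Gamma y / Gamma (y - 1) = y - 1\<close>. This is the
  growth that the ratio test needs.\<close>

lemma Gamma_shift_ge:
  assumes y: "y > (1::real)" and m: "0 < \<mu>"
  shows "Gamma (y + \<mu>) \<ge> Gamma y * (y - 1) powr \<mu>"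
proof -
  have G: "Gamma y > 0" "Gamma (y - 1) > 0" "Gamma (y + \<mu>) > 0" using y m by (auto intro!: Gamma_real_pos)
  have "(ln \<circ> Gamma) ((1 - 1 / (1 + \<mu>)) *\<^sub>R (y - 1) + (1 / (1 + \<mu>)) *\<^sub>R (y + \<mu>))
      \<le> (1 - 1 / (1 + \<mu>)) * (ln \<circ> Gamma) (y - 1) + (1 / (1 + \<mu>)) * (ln \<circ> Gamma) (y + \<mu>)"
    by (rule convex_onD[OF log_convex_Gamma_real]) (use y m in auto)
  moreover have c: "1 - 1 / (1 + \<mu>) = \<mu> / (1 + \<mu>)" using m by (simp add: field_simps)
  moreover have "(1 - 1 / (1 + \<mu>)) *\<^sub>R (y - 1) + (1 / (1 + \<mu>)) *\<^sub>R (y + \<mu>) = y"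
  proof -
    have "\<mu> / (1 + \<mu>) * (y - 1) + 1 / (1 + \<mu>) * (y + \<mu>) = ((1 + \<mu>) * y) / (1 + \<mu>)"
      by (simp add: add_divide_distrib[symmetric] algebra_simps)
    then show ?thesis using m by (simp add: c)
  qed
  ultimately have "ln (Gamma y) \<le> \<mu> / (1 + \<mu>) * ln (Gamma (y - 1)) + 1 / (1 + \<mu>) * ln (Gamma (y + \<mu>))" by simp
  then have "ln (Gamma y) \<le> (\<mu> * ln (Gamma (y - 1)) + ln (Gamma (y + \<mu>))) / (1 + \<mu>)"
    by (simp add: add_divide_distrib)
  then have "ln (Gamma y) * (1 + \<mu>) \<le> \<mu> * ln (Gamma (y - 1)) + ln (Gamma (y + \<mu>))"
    using m by (simp only: pos_le_divide_eq add_pos_pos zero_less_one)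
  moreover have "y - 1 \<notin> \<int>\<^sub>\<le>\<^sub>0" using y by (auto dest!: nonpos_Ints_nonpos)
  then have "Gamma y = (y - 1) * Gamma (y - 1)" using Gamma_plus1[of "y - 1"] by simp
  then have "ln (Gamma y) = ln ((y - 1) * Gamma (y - 1))" by (rule arg_cong)
  then have "ln (Gamma y) = ln (y - 1) + ln (Gamma (y - 1))" using y G(2) by (simp add: ln_mult)
  ultimately have "ln (Gamma y) + \<mu> * ln (y - 1) \<le> ln (Gamma (y + \<mu>))" by (simp add: algebra_simps)
  then have "exp (ln (Gamma y) + \<mu> * ln (y - 1)) \<le> exp (ln (Gamma (y + \<mu>)))" by simp
  then show ?thesis using G y by (simp add: exp_add powr_def)
qed

lemma summable_mittag_leffler:
  assumes m: "\<mu> > 0" and b: "b > (0::real)" and X: "X \<ge> 0"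
  shows "summable (\<lambda>k. X ^ k / Gamma (\<mu> * real k + b))"
proof -
  \<comment> \<open>\<open>y > R\<close> forces \<open>(y - 1) powr \<mu> \<ge> 2 * X + 1\<close>,
    so that consecutive terms shrink at least by the factor 1/2; the last summand 1 makes up for the
    shift in \<open>y - 1\<close>.\<close>
  define R where "R = (2 * X + 1) powr (1 / \<mu>) + 1"
  obtain N :: nat where N: "real N > R / \<mu>" using reals_Archimedean2 by blast
  have R1: "R > 1" using X by (simp add: R_def)
  show ?thesis
  proof (rule summable_ratio_test[of "1/2" N])
    fix k :: nat assume k: "k \<ge> N"
    define y where "y = \<mu> * real k + b"
    have "R < \<mu> * real N" using N m by (simp add: field_simps)
    also have "\<dots> \<le> \<mu> * real k" using m k by simp
    finally have y: "y > R" using b by (simp add: y_def)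
    then have y1: "y > 1" using R1 by simp
    have "(2 * X + 1) = ((2 * X + 1) powr (1 / \<mu>)) powr \<mu>" using m X by (simp add: powr_powr)
    also have "\<dots> \<le> (y - 1) powr \<mu>" using y m by (intro powr_mono2) (auto simp: R_def)
    finally have p: "2 * X + 1 \<le> (y - 1) powr \<mu>" .
    have G: "Gamma y > 0" using y1 by (intro Gamma_real_pos) auto
    have "Gamma y * (2 * X) \<le> Gamma y * (y - 1) powr \<mu>" using p G by (intro mult_left_mono) auto
    also have "\<dots> \<le> Gamma (y + \<mu>)" by (rule Gamma_shift_ge[OF y1 m])
    finally have g: "Gamma y * (2 * X) \<le> Gamma (y + \<mu>)" .
    have Gm: "Gamma (y + \<mu>) > 0" using y1 m by (intro Gamma_real_pos) auto
    have "X * Gamma y \<le> 1 / 2 * Gamma (y + \<mu>)" using g by (simp add: mult_ac)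
    then have "X / Gamma (y + \<mu>) \<le> 1 / 2 / Gamma y" using G Gm by (simp add: field_simps)
    then have "X ^ k * (X / Gamma (y + \<mu>)) \<le> X ^ k * (1 / 2 / Gamma y)" using X by (intro mult_left_mono) auto
    moreover have "\<mu> * real (Suc k) + b = y + \<mu>" by (simp add: y_def algebra_simps)
    ultimately show "norm (X ^ Suc k / Gamma (\<mu> * real (Suc k) + b)) \<le> 1 / 2 * norm (X ^ k / Gamma (\<mu> * real k + b))"
      unfolding y_def[symmetric] using X G Gm by (simp add: mult.commute)
  qed simp
qed

abbreviation mittag_leffler_law :: "real \<Rightarrow> real \<Rightarrow> real measure" where
  "mittag_leffler_law \<mu> lam \<equiv> density lborel (\<lambda>x. ennreal (mittag_leffler_density \<mu> lam x))"

text \<open>\<open>ml_kernel \<mu> lam 0\<close> is the Mittag-Leffler density \<open>d\<close> and \<open>ml_kernel \<mu> lam \<gamma>\<close> its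
  fractional integral of order \<open>\<gamma>\<close>; in these terms \<open>d\<close> is the resolvent of \<open>lam * riesz \<mu>\<close>.\<close>

definition ml_term :: "real \<Rightarrow> real \<Rightarrow> real \<Rightarrow> real \<Rightarrow> nat \<Rightarrow> real" where
  "ml_term \<mu> lam \<gamma> t k = (- 1) ^ k * lam ^ Suc k * riesz (\<mu> * real (Suc k) + \<gamma>) t"

definition ml_kernel :: "real \<Rightarrow> real \<Rightarrow> real \<Rightarrow> real \<Rightarrow> real" where
  "ml_kernel \<mu> lam \<gamma> t = (\<Sum>k. ml_term \<mu> lam \<gamma> t k)"

context
  fixes \<mu> lam :: real
  assumes mu: "\<mu> > 0" and lam: "lam > 0"
begin

lemma ml_index_pos: "\<gamma> \<ge> 0 \<Longrightarrow> \<mu> * real (Suc k) + \<gamma> > 0"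
  using mu by (intro add_pos_nonneg mult_pos_pos) auto

lemma abs_ml_term: "\<gamma> \<ge> 0 \<Longrightarrow> \<bar>ml_term \<mu> lam \<gamma> t k\<bar> = lam ^ Suc k * riesz (\<mu> * real (Suc k) + \<gamma>) t"
  using lam riesz_nonneg[OF ml_index_pos] by (simp add: ml_term_def abs_mult)

lemma summable_abs_ml_term:
  assumes g: "\<gamma> \<ge> 0"
  shows "summable (\<lambda>k. \<bar>ml_term \<mu> lam \<gamma> t k\<bar>)"
proof (cases "t > 0")
  case True
  have "summable (\<lambda>k. lam * t powr (\<mu> + \<gamma> - 1) * ((lam * t powr \<mu>) ^ k / Gamma (\<mu> * real k + (\<mu> + \<gamma>))))"
    by (intro summable_mult summable_mittag_leffler) (use mu lam g in auto)
  moreover have "lam * t powr (\<mu> + \<gamma> - 1) * ((lam * t powr \<mu>) ^ k / Gamma (\<mu> * real k + (\<mu> + \<gamma>))) = \<bar>ml_term \<mu> lam \<gamma> t k\<bar>" for k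
  proof -
    have "t powr (\<mu> * real (Suc k) + \<gamma> - 1) = t powr (\<mu> * real k + (\<mu> + \<gamma> - 1))"
      by (simp add: algebra_simps)
    also have "\<dots> = (t powr \<mu>) ^ k * t powr (\<mu> + \<gamma> - 1)"
      using True by (simp add: powr_add powr_powr[symmetric] powr_realpow)
    finally show ?thesis using True unfolding abs_ml_term[OF g]
      by (simp add: riesz_def power_mult_distrib algebra_simps)
  qed
  ultimately show ?thesis by simp
qed (simp add: ml_term_def)

lemma summable_ml_term: "\<gamma> \<ge> 0 \<Longrightarrow> summable (ml_term \<mu> lam \<gamma> t)"
  using summable_rabs_cancel summable_abs_ml_term by blast

lemma ml_kernel_zero: "t \<le> 0 \<Longrightarrow> ml_kernel \<mu> lam \<gamma> t = 0"
  by (simp add: ml_kernel_def ml_term_def)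

lemma borel_measurable_ml_kernel: "ml_kernel \<mu> lam \<gamma> \<in> borel_measurable borel"
  unfolding ml_kernel_def ml_term_def by measurable

text \<open>Without its first term the series is again a kernel, of order raised by \<mu>. The
  values \<open>\<gamma> = 0\<close> and \<open>\<gamma> = 1 - \<mu>\<close> serve the Caputo
  derivative, \<open>\<gamma> = 1\<close> the sign of the density.\<close>

lemma ml_kernel_resolvent:
  assumes g: "\<gamma> \<ge> 0"
  shows "ml_kernel \<mu> lam \<gamma> t = lam * riesz (\<mu> + \<gamma>) t - lam * ml_kernel \<mu> lam (\<gamma> + \<mu>) t"
proof -
  have "ml_kernel \<mu> lam \<gamma> t = (\<Sum>k. ml_term \<mu> lam \<gamma> t (Suc k)) + ml_term \<mu> lam \<gamma> t 0"
    unfolding ml_kernel_def using suminf_split_head[OF summable_ml_term[OF g]] by simp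
  also have "(\<lambda>k. ml_term \<mu> lam \<gamma> t (Suc k)) = (\<lambda>k. - lam * ml_term \<mu> lam (\<gamma> + \<mu>) t k)"
    by (simp add: ml_term_def algebra_simps)
  also have "(\<Sum>k. - lam * ml_term \<mu> lam (\<gamma> + \<mu>) t k) = - lam * ml_kernel \<mu> lam (\<gamma> + \<mu>) t"
    unfolding ml_kernel_def using summable_ml_term[of "\<gamma> + \<mu>"] g mu by (intro suminf_mult) auto
  finally show ?thesis by (simp add: ml_term_def)
qed

lemma ml_kernel_density: "ml_kernel \<mu> lam 0 t = mittag_leffler_density \<mu> lam t"
proof (cases "t > 0")
  case True
  have s: "summable (\<lambda>k. (- lam * t powr \<mu>) ^ k / Gamma (\<mu> * real k + \<mu>))"
  proof (rule summable_rabs_cancel)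
    have "\<bar>(- lam * t powr \<mu>) ^ k / Gamma (\<mu> * real k + \<mu>)\<bar> = (lam * t powr \<mu>) ^ k / Gamma (\<mu> * real k + \<mu>)" for k
      using Gamma_real_pos[of "\<mu> * real k + \<mu>"] mu lam
      by (simp add: power_abs abs_mult add_nonneg_pos abs_of_pos)
    moreover have "summable (\<lambda>k. (lam * t powr \<mu>) ^ k / Gamma (\<mu> * real k + \<mu>))"
      using summable_mittag_leffler[OF mu mu, of "lam * t powr \<mu>"] lam by simp
    ultimately show "summable (\<lambda>k. \<bar>(- lam * t powr \<mu>) ^ k / Gamma (\<mu> * real k + \<mu>)\<bar>)"
      by (simp only:)
  qed
  have "ml_term \<mu> lam 0 t k = lam * t powr (\<mu> - 1) * ((- lam * t powr \<mu>) ^ k / Gamma (\<mu> * real k + \<mu>))" for k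
  proof -
    have "t powr (\<mu> * real (Suc k) - 1) = t powr (\<mu> * real k + (\<mu> - 1))"
      by (simp add: algebra_simps)
    also have "\<dots> = (t powr \<mu>) ^ k * t powr (\<mu> - 1)"
      using True by (simp add: powr_add powr_powr[symmetric] powr_realpow)
    finally have e: "t powr (\<mu> * real (Suc k) + 0 - 1) = (t powr \<mu>) ^ k * t powr (\<mu> - 1)" by simp
    have "(- lam * t powr \<mu>) ^ k = (-1) ^ k * lam ^ k * (t powr \<mu>) ^ k"
      by (metis mult_minus1 power_mult_distrib)
    moreover have "\<mu> * real (Suc k) + 0 = \<mu> * real k + \<mu>" by (simp add: algebra_simps)
    ultimately show ?thesis using True e unfolding ml_term_def riesz_def by simp
  qed
  then have "ml_term \<mu> lam 0 t = (\<lambda>k. lam * t powr (\<mu> - 1) * ((- lam * t powr \<mu>) ^ k / Gamma (\<mu> * real k + \<mu>)))"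
    by (rule ext)
  then have "ml_kernel \<mu> lam 0 t = lam * t powr (\<mu> - 1) * (\<Sum>k. (- lam * t powr \<mu>) ^ k / Gamma (\<mu> * real k + \<mu>))"
    unfolding ml_kernel_def using suminf_mult[OF s, of "lam * t powr (\<mu> - 1)"] by (simp only:)
  then show ?thesis using True by (simp add: mittag_leffler_density_def mittag_leffler_def)
next
  case False then show ?thesis by (simp add: ml_kernel_zero mittag_leffler_density_def)
qed

lemma borel_measurable_mittag_leffler_density: "mittag_leffler_density \<mu> lam \<in> borel_measurable borel"
  using borel_measurable_ml_kernel[of 0] by (simp add: ml_kernel_density cong: measurable_cong)

lemma AE_mittag_leffler_law_pos:
  "AE y in mittag_leffler_law \<mu> lam. y > 0"
proof -
  note [measurable] = borel_measurable_mittag_leffler_density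
  have "y > 0" if "0 < ennreal (mittag_leffler_density \<mu> lam y)" for y
    using that by (cases "y > 0") (simp_all add: mittag_leffler_density_def)
  then show ?thesis by (subst AE_density) simp_all
qed

text \<open>Integration term by term: the absolute values of the terms are again multiples of Riesz
  kernels, so their integrals are summable.\<close>

lemma ml_kernel_riesz:
  assumes g: "\<gamma> \<ge> 0" and b: "\<beta> > 0"
  shows "integrable lborel (\<lambda>w. riesz \<beta> w * ml_kernel \<mu> lam \<gamma> (x - w))"
    and "(LINT w|lborel. riesz \<beta> w * ml_kernel \<mu> lam \<gamma> (x - w)) = ml_kernel \<mu> lam (\<gamma> + \<beta>) x"
proof -
  define q where "q k w = riesz \<beta> w * ml_term \<mu> lam \<gamma> (x - w) k" for k w
  have hb: "has_bochner_integral lborel (\<lambda>w. riesz \<beta> w * riesz (\<mu> * real (Suc k) + \<gamma>) (x - w)) (riesz (\<beta> + (\<mu> * real (Suc k) + \<gamma>)) x)" for k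
    using ml_index_pos[OF g, of k] b
    by (intro has_bochner_integral_nn_integral) (auto simp: riesz_nonneg nn_integral_riesz_conv simp del: of_nat_Suc)
  have ix: "\<beta> + (\<mu> * real (Suc k) + \<gamma>) = \<mu> * real (Suc k) + (\<gamma> + \<beta>)" for k by simp
  have hq: "has_bochner_integral lborel (q k) (ml_term \<mu> lam (\<gamma> + \<beta>) x k)" for k
    using has_bochner_integral_mult_right[OF hb[of k], of "(-1)^k * lam ^ Suc k"]
    by (simp add: q_def[abs_def] ml_term_def ix mult_ac del: of_nat_Suc)
  have hn: "has_bochner_integral lborel (\<lambda>w. norm (q k w)) \<bar>ml_term \<mu> lam (\<gamma> + \<beta>) x k\<bar>" for k
  proof -
    have "norm (q k w) = lam ^ Suc k * (riesz \<beta> w * riesz (\<mu> * real (Suc k) + \<gamma>) (x - w))" for w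
      using abs_ml_term[OF g, of "x - w" k] riesz_nonneg[OF b, of w] by (simp add: q_def abs_mult)
    then show ?thesis using has_bochner_integral_mult_right[OF hb[of k], of "lam ^ Suc k"] abs_ml_term[of "\<gamma> + \<beta>" x k] g b
      by (simp add: ix del: of_nat_Suc)
  qed
  have sn: "summable (\<lambda>k. norm (q k w))" for w
    using summable_mult[OF summable_abs_ml_term[OF g, of "x - w"], of "riesz \<beta> w"] riesz_nonneg[OF b, of w]
    by (simp add: q_def abs_mult)
  have si: "summable (\<lambda>k. LINT w|lborel. norm (q k w))"
    using summable_abs_ml_term[of "\<gamma> + \<beta>" x] g b has_bochner_integral_integral_eq[OF hn] by simp
  have qs: "(\<Sum>k. q k w) = riesz \<beta> w * ml_kernel \<mu> lam \<gamma> (x - w)" for w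
    unfolding q_def ml_kernel_def by (rule suminf_mult[OF summable_ml_term[OF g]])
  have iq: "integrable lborel (q k)" for k using hq by (rule integrable.intros)
  show "integrable lborel (\<lambda>w. riesz \<beta> w * ml_kernel \<mu> lam \<gamma> (x - w))"
    using integrable_suminf[OF iq _ si] sn by (simp add: qs)
  show "(LINT w|lborel. riesz \<beta> w * ml_kernel \<mu> lam \<gamma> (x - w)) = ml_kernel \<mu> lam (\<gamma> + \<beta>) x"
    using integral_suminf[OF iq _ si] sn has_bochner_integral_integral_eq[OF hq]
    by (simp add: qs ml_kernel_def)
qed

text \<open>Since the positive part of the density \<open>d\<close> has total mass 1, the function
  \<open>y = 1 - (\<integral>\<^sub>0\<^sup>x d)\<close> dominates the mass of the negative part on \<open>(0, x)\<close>; as the fractional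
  integral of \<open>y\<close> of order \<open>\<mu>\<close> stays below \<open>1 / lam\<close>, that mass vanishes.\<close>

lemma mittag_leffler_density_AE_nonneg:
  assumes prob: "prob_space (mittag_leffler_law \<mu> lam)"
  defines "d \<equiv> \<lambda>x. max 0 (mittag_leffler_density \<mu> lam x)"
  shows "integrable lborel d" and "(LINT x|lborel. d x) = 1"
    and "AE x in lborel. ml_kernel \<mu> lam 0 x = d x"
    and "x > 0 \<Longrightarrow> surv d x = 1 - ml_kernel \<mu> lam 1 x"
proof -
  define k where "k = ml_kernel \<mu> lam 0"
  have [measurable]: "k \<in> borel_measurable borel" unfolding k_def by (rule borel_measurable_ml_kernel)
  \<comment> \<open>\<open>ennreal\<close> cuts off negative values, so \<open>prob\<close> only
    says that the positive part \<open>d\<close> has mass 1; the sign of the series \<open>k\<close>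
    is still open.\<close>
  have dk: "d x = max 0 (k x)" for x by (simp add: d_def k_def ml_kernel_density)
  then have [measurable]: "d \<in> borel_measurable borel" by (simp add: dk[abs_def])
  have mlm: "mittag_leffler_density \<mu> lam = k" by (simp add: k_def ml_kernel_density fun_eq_iff)
  have dn: "d x \<ge> 0" for x by (simp add: dk)
  have "(\<integral>\<^sup>+x. ennreal (d x) \<partial>lborel) = (\<integral>\<^sup>+x. ennreal (k x) \<partial>lborel)"
    by (intro nn_integral_cong) (simp add: dk max_def ennreal_neg)
  also have "\<dots> = 1"
    using prob_space.emeasure_space_1[OF prob] unfolding mlm by (simp add: emeasure_density)
  finally have nn: "(\<integral>\<^sup>+x. ennreal (d x) \<partial>lborel) = 1" .
  have hd: "has_bochner_integral lborel d 1"
    by (rule has_bochner_integral_nn_integral) (use nn dn in auto)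
  then show di: "integrable lborel d" and d1: "(LINT x|lborel. d x) = 1"
    by (auto simp: has_bochner_integral_iff)
  have R1: "RLI 1 k x = ml_kernel \<mu> lam 1 x" for x
    unfolding RLI_def k_def using ml_kernel_riesz(2)[of 0 1 x] by simp
  have refl: "integrable lborel (\<lambda>y. indicator {..<x} y * k y)" "(LINT y|lborel. indicator {..<x} y * k y) = ml_kernel \<mu> lam 1 x" for x
  proof -
    have e: "riesz 1 (x - y) * k y = indicator {..<x} y * k y" for y by (simp add: riesz_def indicator_def)
    have i: "integrable lborel (\<lambda>w. riesz 1 w * k (x - w))" unfolding k_def by (rule ml_kernel_riesz(1)) auto
    have "integrable lborel (\<lambda>y. riesz 1 (x + -1 * y) * k (x - (x + -1 * y)))"
      by (rule lborel_integrable_real_affine[OF i]) auto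
    then show "integrable lborel (\<lambda>y. indicator {..<x} y * k y)" using e by simp
    have "RLI 1 k x = \<bar>-1\<bar> *\<^sub>R (LINT y|lborel. riesz 1 (x + -1 * y) * k (x - (x + -1 * y)))"
      unfolding RLI_def by (rule lborel_integral_real_affine) simp
    then show "(LINT y|lborel. indicator {..<x} y * k y) = ml_kernel \<mu> lam 1 x" using e R1 by simp
  qed
  have id: "integrable lborel (\<lambda>y. indicator A y * d y)" if "A \<in> sets borel" for A
    by (rule Bochner_Integration.integrable_bound[OF di]) (use that in \<open>auto simp: indicator_def\<close>)
  define m where "m x = (LINT y|lborel. indicator {..<x} y * (d y - k y))" for x
  have dk0: "d y - k y \<ge> 0" for y by (simp add: dk)
  have im: "integrable lborel (\<lambda>y. indicator {..<x} y * (d y - k y))" for x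
    using Bochner_Integration.integrable_diff[OF id[of "{..<x}"] refl(1)[of x]] by (simp add: right_diff_distrib)
  have mx: "m x = (LINT y|lborel. indicator {..<x} y * d y) - ml_kernel \<mu> lam 1 x" for x
    unfolding m_def right_diff_distrib using id[of "{..<x}"] refl[of x] by simp
  have le1: "(LINT y|lborel. indicator {..<x} y * d y) \<le> 1" for x
    unfolding d1[symmetric] by (rule integral_mono[OF id di]) (auto simp: indicator_def dn)
  have m0: "m x \<ge> 0" for x unfolding m_def using dk0 by (intro integral_nonneg_AE) auto
  have mono: "m x \<le> m x'" if "x \<le> x'" for x x'
    unfolding m_def by (rule integral_mono[OF im im]) (use dk0 that in \<open>auto simp: indicator_def\<close>)
  define y where "y x = riesz 1 x - ml_kernel \<mu> lam 1 x" for x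
  have ym: "y x \<ge> m x" if "x > 0" for x using le1[of x] mx[of x] that by (simp add: y_def riesz_one)
  have Iy: "integrable lborel (\<lambda>w. riesz \<mu> w * y (x - w))" "(LINT w|lborel. riesz \<mu> w * y (x - w)) \<le> 1 / lam" for x
  proof -
    note i1 = integrable_riesz[OF mu, of x] and i2 = ml_kernel_riesz[of 1 \<mu> x]
    show "integrable lborel (\<lambda>w. riesz \<mu> w * y (x - w))"
      unfolding y_def right_diff_distrib using i1 i2 mu by simp
    have "(LINT w|lborel. riesz \<mu> w * y (x - w)) = riesz (\<mu> + 1) x - ml_kernel \<mu> lam (1 + \<mu>) x"
      unfolding y_def right_diff_distrib using i1 i2 mu integral_riesz[OF mu, of x] by simp
    \<comment> \<open>By the resolvent equation at \<open>\<gamma> = 1\<close>, this is the integral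
      of the density up to \<open>x\<close>, and so at most 1.\<close>
    then have "lam * (LINT w|lborel. riesz \<mu> w * y (x - w)) = ml_kernel \<mu> lam 1 x"
      using ml_kernel_resolvent[of 1 x] by (simp add: right_diff_distrib)
    also have "\<dots> \<le> 1" using mx[of x] m0[of x] le1[of x] by linarith
    finally show "(LINT w|lborel. riesz \<mu> w * y (x - w)) \<le> 1 / lam" using lam by (simp add: field_simps)
  qed
  have mz: "m a = 0" if a: "a > 0" for a
  proof (rule ccontr)
    assume "m a \<noteq> 0"
    then have \<eta>: "m a > 0" using m0[of a] by simp
    \<comment> \<open>\<open>m\<close> increases and lies below \<open>y\<close>, so
      \<open>y \<ge> m a\<close> beyond \<open>a\<close>; the fractional integral of such a step
      grows without bound.\<close>
    have bd: "m a * riesz (\<mu> + 1) (x - a) \<le> 1 / lam" for x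
    proof -
      have "m a * riesz (\<mu> + 1) (x - a) = (LINT w|lborel. m a * (riesz \<mu> w * riesz 1 (x - a - w)))"
        using integral_riesz[OF mu, of "x - a"] by simp
      also have "\<dots> \<le> (LINT w|lborel. riesz \<mu> w * y (x - w))"
      proof (rule integral_mono)
        fix w
        have "m a * riesz 1 (x - a - w) \<le> y (x - w)"
        proof (cases "x - w > 0")
          case True
          then show ?thesis using ym[OF True] m0[of "x - w"] mono[of a "x - w"]
            by (cases "x - a - w > 0") (auto simp: riesz_one)
        next
          case False then show ?thesis using a by (simp add: y_def ml_kernel_zero)
        qed
        from mult_left_mono[OF this riesz_nonneg[OF mu, of w]]
        show "m a * (riesz \<mu> w * riesz 1 (x - a - w)) \<le> riesz \<mu> w * y (x - w)" by (simp add: mult_ac)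
      qed (use Iy(1) integrable_riesz[OF mu, of "x - a"] in auto)
      also note Iy(2)
      finally show ?thesis .
    qed
    have G: "Gamma (\<mu> + 1) > 0" using mu by (intro Gamma_real_pos) auto
    \<comment> \<open>Chosen to make the lower bound \<open>2 / lam\<close>, twice the upper
      one.\<close>
    define L where "L = 2 * Gamma (\<mu> + 1) / (lam * m a)"
    have L: "L > 0" using G lam \<eta> by (simp add: L_def)
    have "riesz (\<mu> + 1) ((a + L powr (1 / \<mu>)) - a) = L / Gamma (\<mu> + 1)"
      using L mu by (simp add: riesz_def powr_powr)
    then have "m a * (L / Gamma (\<mu> + 1)) \<le> 1 / lam" using bd[of "a + L powr (1 / \<mu>)"] by simp
    moreover have "m a * (L / Gamma (\<mu> + 1)) = 2 / lam" using G \<eta> lam by (simp add: L_def)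
    ultimately show False using lam by (simp add: field_simps)
  qed
  have "AE y in lborel. \<forall>n::nat. indicator {..<real (Suc n)} y * (d y - k y) = 0"
    unfolding AE_all_countable
  proof
    fix n :: nat
    show "AE y in lborel. indicator {..<real (Suc n)} y * (d y - k y) = 0"
      using mz[of "real (Suc n)"] integral_nonneg_eq_0_iff_AE[OF im[of "real (Suc n)"]] dk0
      by (simp add: m_def del: of_nat_Suc)
  qed
  then have AE: "AE y in lborel. k y = d y"
  proof eventually_elim
    fix y assume h: "\<forall>n::nat. indicator {..<real (Suc n)} y * (d y - k y) = 0"
    obtain n :: nat where "y < real n" using reals_Archimedean2 by blast
    then have "y < real (Suc n)" by simp
    then show "k y = d y" using h[rule_format, of n] by (simp add: indicator_def)
  qed
  then show "AE x in lborel. ml_kernel \<mu> lam 0 x = d x" by (simp add: k_def)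
  assume x: "x > 0"
  have "1 = (LINT t|lborel. indicator {..<x} t * d t + indicator {x<..} t * d t)"
    unfolding d1[symmetric]
    by (intro integral_cong_AE eventually_mono[OF AE_lborel_singleton[of x]]) (auto simp: indicator_def)
  also have "\<dots> = (LINT t|lborel. indicator {..<x} t * d t) + (LINT t|lborel. indicator {x<..} t * d t)"
    by (rule Bochner_Integration.integral_add) (auto intro!: id)
  finally show "surv d x = 1 - ml_kernel \<mu> lam 1 x" using mz[OF x] mx[of x] x by (simp add: surv_def)
qed

end

text \<open>For \<open>\<mu> < 1\<close>, \<open>conv\<close> turns the kernel of order
  \<open>1 - \<mu>\<close> acting on \<open>d\<close> into the tail of \<open>d\<close>, and
  \<open>integral_surv_deriv\<close> turns that into a difference. For \<open>\<mu> = 1\<close> the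
  law is exponential (\<open>conv1\<close>) and the definition takes two derivatives, as
  \<open>\<lfloor>\<mu>\<rfloor> + 1 = 2\<close>; one of them is integrated back. The constant
  \<open>C\<close> disappears with the first derivative.\<close>

lemma caputo_right_surv:
  assumes k: "sectorial \<kappa> e B k" and kap: "\<kappa> > 1" and ep: "e > 0" and B: "B \<ge> 0"
    and [measurable]: "k \<in> borel_measurable borel"
    and c: "c > 0" and mu: "0 < \<mu>" "\<mu> \<le> 1" and lam: "lam > 0"
    and d[measurable]: "d \<in> borel_measurable borel" and d0: "\<And>t. t \<le> 0 \<Longrightarrow> d t = 0" and dn: "\<And>t. d t \<ge> 0"
    and int: "integrable lborel d" and d1: "(LINT t|lborel. d t) = 1"
    and conv: "\<And>x. \<mu> < 1 \<Longrightarrow> (\<integral>\<^sup>+w. ennreal (riesz (1 - \<mu>) w * d (x - w)) \<partial>lborel) = ennreal (lam * surv d x)"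
    and conv1: "\<mu> = 1 \<Longrightarrow> AE x in lborel. d x = lam * surv d x"
    and f: "\<And>u. u > 0 \<Longrightarrow> f u = C * (1 - (LINT t|lborel. d t * pos_deriv 0 k (u + c * t)))"
  shows "\<exists>g. caputo_right \<mu> f = Some g \<and>
     (\<forall>u>0. g u = C * c powr (- \<mu>) * lam * ((LINT t|lborel. d t * pos_deriv 0 k (u + c * t)) - k u))"
proof -
  note e0 = less_imp_le[OF ep]
  note [measurable] = borel_measurable_pos_deriv[OF k kap e0]
  define I where "I n u = (LINT t|lborel. d t * pos_deriv n k (u + c * t))" for n u
  have dexp: "integrable lborel (\<lambda>t. d t * exp (- e / 2 * c * t))"
    by (rule integrable_mult_exp[OF int d d0 ep c])
  have DI: "(I n has_real_derivative I (Suc n) u) (at u)" if "u > 0" for n u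
    unfolding I_def by (rule deriv_shift[OF k kap e0 d d0 c dexp that])
  define D where "D n u = (if n = 0 then C else 0) - C * I n u" for n u
  have f0: "f u = D 0 u" if "u > 0" for u using f[OF that] by (simp add: D_def I_def right_diff_distrib)
  have DD: "(D n has_real_derivative D (Suc n) u) (at u)" if "u > 0" for n u
  proof -
    have "((\<lambda>u. (if n = 0 then C else 0) - C * I n u) has_real_derivative 0 - C * I (Suc n) u) (at u)"
      by (intro DERIV_diff DERIV_const DERIV_cmult DI that)
    then show ?thesis by (simp add: D_def[abs_def])
  qed
  note S = integral_surv_deriv[OF k kap ep c _ d d0 dn d1 int]
  show ?thesis
  proof (cases "\<mu> < 1")
    case True
    define a where "a = 1 - \<mu>"
    have a: "a > 0" using True by (simp add: a_def)
    have G: "Gamma a > 0" by (rule Gamma_real_pos[OF a])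
    have N: "nat \<lfloor>\<mu>\<rfloor> + 1 = 1" using True mu by (simp add: floor_eq_iff)
    note it = iterated_deriv_eq[of f D 1, OF f0 DD]
    have sd: "surv d x \<ge> 0" for x unfolding surv_def by (auto intro!: integral_nonneg_AE simp: dn)
    have W: "integrable lborel (\<lambda>w. riesz a w * I 1 (x + c * w))"
      "c * (LINT w|lborel. riesz a w * I 1 (x + c * w)) = lam * (I 0 x - k x)" if x: "x > 0" for x
    proof -
      note ck = integral_conv_kernel[of "riesz a" d "\<lambda>t. pos_deriv 1 k (x + c * t)" "\<lambda>x. lam * surv d x",
          OF _ _ _ riesz_nonneg[OF a] dn conv[OF True, folded a_def]]
      have i: "integrable lborel (\<lambda>s. lam * surv d s * pos_deriv 1 k (x + c * s))"
        using S(1)[OF x] by (simp add: mult.assoc)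
      have e: "(LINT t|lborel. d t * pos_deriv 1 k (x + c * (w + t))) = I 1 (x + c * w)" for w
        by (simp add: I_def distrib_left add.assoc)
      show "integrable lborel (\<lambda>w. riesz a w * I 1 (x + c * w))"
        using ck(1)[OF _ _ _ _ i] sd lam by (simp add: e del: One_nat_def)
      have "(LINT w|lborel. riesz a w * I 1 (x + c * w)) = (LINT s|lborel. lam * (surv d s * pos_deriv 1 k (x + c * s)))"
        using ck(2)[OF _ _ _ _ i] sd lam by (simp add: e mult.assoc del: One_nat_def)
      then show "c * (LINT w|lborel. riesz a w * I 1 (x + c * w)) = lam * (I 0 x - k x)"
        using S(2)[OF x] by (simp add: I_def mult.left_commute del: One_nat_def)
    qed
    have rs: "riesz a (c * w) = c powr (a - 1) * riesz a w" for w
      using c by (cases "w > 0") (auto simp: riesz_def powr_mult zero_less_mult_iff)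
    have V: "integrable lborel (\<lambda>y. riesz a (y - x) * I 1 y)"
      "(LINT y|lborel. riesz a (y - x) * I 1 y) = c powr (- \<mu>) * lam * (I 0 x - k x)" if x: "x > 0" for x
    proof -
      have e: "riesz a ((x + c * w) - x) * I 1 (x + c * w) = c powr (a - 1) * (riesz a w * I 1 (x + c * w))" for w
        by (simp add: rs)
      have "integrable lborel (\<lambda>w. riesz a ((x + c * w) - x) * I 1 (x + c * w))"
        unfolding e using W(1)[OF x] by simp
      then show "integrable lborel (\<lambda>y. riesz a (y - x) * I 1 y)"
        using lborel_integrable_real_affine_iff[of c "\<lambda>y. riesz a (y - x) * I 1 y" x] c by simp
      have "(LINT y|lborel. riesz a (y - x) * I 1 y) = \<bar>c\<bar> *\<^sub>R (LINT w|lborel. riesz a ((x + c * w) - x) * I 1 (x + c * w))"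
        by (rule lborel_integral_real_affine) (use c in simp)
      also have "\<dots> = c powr (a - 1) * (c * (LINT w|lborel. riesz a w * I 1 (x + c * w)))"
        unfolding e using c by simp
      also have "\<dots> = c powr (- \<mu>) * lam * (I 0 x - k x)" unfolding W(2)[OF x] by (simp add: a_def)
      finally show "(LINT y|lborel. riesz a (y - x) * I 1 y) = c powr (- \<mu>) * lam * (I 0 x - k x)" .
    qed
    have e: "indicator {x..} y *\<^sub>R ((y - x) powr (real 1 - \<mu> - 1) * (deriv ^^ 1) f y)
        = - (Gamma a * C) * (riesz a (y - x) * I 1 y)" if x: "x > 0" for x y
    proof (cases "y > x")
      case True then show ?thesis using it(2)[of 1 y] x G by (simp add: riesz_def D_def a_def)
    next
      case False then show ?thesis by (cases "y = x") (auto simp: riesz_def)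
    qed
    have s: "set_integrable lborel {x..} (\<lambda>y. (y - x) powr (real 1 - \<mu> - 1) * (deriv ^^ 1) f y)" if x: "x > 0" for x
      unfolding set_integrable_def e[OF x] using V(1)[OF x] by simp
    have "(LINT y:{x..}|lborel. (y - x) powr (real 1 - \<mu> - 1) * (deriv ^^ 1) f y) = - (Gamma a * C) * (c powr (- \<mu>) * lam * (I 0 x - k x))"
      if x: "x > 0" for x
      unfolding set_lebesgue_integral_def e[OF x] using V(2)[OF x] by simp
    then show ?thesis
      unfolding caputo_right_def N Let_def I_def[symmetric] using it(1) s G
      by (simp add: a_def[symmetric] I_def[symmetric] mult_ac)
  next
    case False
    then have m1: "\<mu> = 1" using mu by simp
    have N: "nat \<lfloor>\<mu>\<rfloor> + 1 = 2" by (simp add: m1)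
    note it = iterated_deriv_eq[of f D 2, OF f0 DD]
    \<comment> \<open>The average of \<open>k\<close> is itself sectorial, so that
      \<open>weyl_one\<close> can integrate its second derivative.\<close>
    define \<nu> where "\<nu> = density lborel (\<lambda>x. ennreal (d x))"
    define A where "A = avg c \<nu> k"
    have "prob_space \<nu>"
      by (rule prob_spaceI) (use d1 int dn in \<open>simp add: \<nu>_def emeasure_density nn_integral_eq_integral\<close>)
    moreover have "AE y in \<nu>. y > 0"
      unfolding \<nu>_def by (subst AE_density) (use d0 in \<open>auto simp: not_le[symmetric]\<close>)
    ultimately have A: "sectorial \<kappa> e (B * (\<integral>y. exp (- e * c * y) \<partial>\<nu>)) A"
      unfolding A_def by (intro sectorial_avg[OF k kap e0 B c]) (simp_all add: \<nu>_def)
    have A0: "A u = I 0 u" if u: "u > 0" for u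
    proof -
      have "A u = (LINT t|lborel. d t * k (u + c * t))"
        unfolding A_def avg_def \<nu>_def using dn by (subst integral_real_density) auto
      also have "\<dots> = I 0 u" unfolding I_def
      proof (rule Bochner_Integration.integral_cong[OF refl])
        fix t :: real
        show "d t * k (u + c * t) = d t * pos_deriv 0 k (u + c * t)"
          using u c d0[of t] by (cases "t > 0") (auto simp: pos_deriv_def add_pos_pos)
      qed
      finally show ?thesis .
    qed
    have AI: "pos_deriv n A u = I n u" if u: "u > 0" for n u
      using iterated_deriv_eq(2)[of A I n n u, OF A0 DI] u by (simp add: pos_deriv_def)
    have V: "integrable lborel (\<lambda>w. riesz 1 w * I 2 (x + w))" "(LINT w|lborel. riesz 1 w * I 2 (x + w)) = - I 1 x" if x: "x > 0" for x
    proof -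
      have e: "riesz 1 w * I 2 (x + w) = riesz 1 w * pos_deriv (Suc 1) A (x + w)" for w
        using AI[of "x + w" 2] x by (cases "w > 0") (auto simp: add_pos_pos numeral_2_eq_2)
      show "integrable lborel (\<lambda>w. riesz 1 w * I 2 (x + w))"
        unfolding e by (rule integrable_weyl[OF A kap e0 ep x]) simp
      show "(LINT w|lborel. riesz 1 w * I 2 (x + w)) = - I 1 x"
        unfolding e weyl_one[OF A kap e0 ep x] AI[OF x] ..
    qed
    have V': "integrable lborel (\<lambda>y. riesz 1 (y - x) * I 2 y)" "(LINT y|lborel. riesz 1 (y - x) * I 2 y) = - I 1 x" if x: "x > 0" for x
    proof -
      have "integrable lborel (\<lambda>y. riesz 1 (- x + 1 * y) * I 2 (x + (- x + 1 * y)))"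
        by (rule lborel_integrable_real_affine[OF V(1)[OF x]]) simp
      then show "integrable lborel (\<lambda>y. riesz 1 (y - x) * I 2 y)" by simp
      have "(LINT w|lborel. riesz 1 w * I 2 (x + w))
          = \<bar>1\<bar> *\<^sub>R (LINT y|lborel. riesz 1 (- x + 1 * y) * I 2 (x + (- x + 1 * y)))"
        by (rule lborel_integral_real_affine) simp
      then show "(LINT y|lborel. riesz 1 (y - x) * I 2 y) = - I 1 x" using V(2)[OF x] by simp
    qed
    have I1: "I 1 x = lam * c powr (- 1) * (I 0 x - k x)" if x: "x > 0" for x
    proof -
      note [measurable] = borel_measurable_surv[OF d]
      have "I 1 x = (LINT s|lborel. lam * (surv d s * pos_deriv 1 k (x + c * s)))"
        unfolding I_def by (rule integral_cong_AE) (use conv1[OF m1] in \<open>auto elim!: eventually_mono\<close>)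
      then have "c * I 1 x = lam * (c * (LINT s|lborel. surv d s * pos_deriv 1 k (x + c * s)))"
        by (simp add: mult.left_commute)
      also have "\<dots> = lam * (I 0 x - k x)" using S(2)[OF x] by (simp only: I_def)
      finally show ?thesis using c by (simp add: powr_minus field_simps)
    qed
    have e: "indicator {x..} y *\<^sub>R ((y - x) powr (real 2 - \<mu> - 1) * (deriv ^^ 2) f y)
        = - C * (riesz 1 (y - x) * I 2 y)" if x: "x > 0" for x y
    proof (cases "y > x")
      case True then show ?thesis using it(2)[of 2 y] x by (simp add: riesz_def D_def m1)
    next
      case False then show ?thesis by (cases "y = x") (auto simp: riesz_def)
    qed
    have s: "set_integrable lborel {x..} (\<lambda>y. (y - x) powr (real 2 - \<mu> - 1) * (deriv ^^ 2) f y)" if x: "x > 0" for x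
      unfolding set_integrable_def e[OF x] using V'(1)[OF x] by simp
    have "(LINT y:{x..}|lborel. (y - x) powr (real 2 - \<mu> - 1) * (deriv ^^ 2) f y) = C * I 1 x"
      if x: "x > 0" for x
      unfolding set_lebesgue_integral_def e[OF x] using V'(2)[OF x] by simp
    then show ?thesis
      unfolding caputo_right_def N Let_def I_def[symmetric] using it(1) s I1
      by (simp add: m1 mult_ac)
  qed
qed

text \<open>With \<open>A\<close> the average of \<open>k\<close>, the Caputo part yields
  \<open>A - k\<close> and the zeroth-order part \<open>1 - A\<close>; their sum
  \<open>1 - k\<close> frees \<open>k\<close> from its average. The density is replaced by its
  positive part, which defines the same law.\<close>

lemma mittag_leffler_arrival_op_avg:
  assumes k: "sectorial \<kappa> e B k" and kap: "\<kappa> > 1" and ep: "e > 0" and B: "B \<ge> 0"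
    and [measurable]: "k \<in> borel_measurable borel"
    and c: "c > 0" and mu: "0 < \<mu>" "\<mu> \<le> 1" and lam: "lam > 0"
    and prob: "prob_space (mittag_leffler_law \<mu> lam)"
    and f: "\<And>u. u > 0 \<Longrightarrow> f u = C * (1 - avg c (mittag_leffler_law \<mu> lam) k u)"
  shows "\<exists>g. mittag_leffler_arrival_op c \<mu> lam f = Some g \<and> (\<forall>u>0. g u = C * lam * (1 - k u))"
proof -
  define d where "d x = max 0 (mittag_leffler_density \<mu> lam x)" for x
  have mlm: "mittag_leffler_density \<mu> lam = ml_kernel \<mu> lam 0"
    using ml_kernel_density[OF mu(1) lam] by (simp add: fun_eq_iff)
  have dm[measurable]: "d \<in> borel_measurable borel"
    unfolding d_def mlm using borel_measurable_ml_kernel[OF mu(1) lam] by measurable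
  note ml = mittag_leffler_density_AE_nonneg[OF mu(1) lam prob, folded d_def]
  have dn: "d t \<ge> 0" for t by (simp add: d_def)
  have d0: "d t = 0" if "t \<le> 0" for t using that by (simp add: d_def mittag_leffler_density_def)
  have dens: "mittag_leffler_law \<mu> lam = density lborel (\<lambda>x. ennreal (d x))"
    by (rule arg_cong[where f="density lborel"]) (auto simp: d_def max_def ennreal_neg)
  have fu: "f u = C * (1 - (LINT t|lborel. d t * pos_deriv 0 k (u + c * t)))" if u: "u > 0" for u
  proof -
    have "avg c (density lborel (\<lambda>x. ennreal (d x))) k u = (LINT t|lborel. d t * k (u + c * t))"
      unfolding avg_def using dn by (subst integral_real_density) auto
    also have "\<dots> = (LINT t|lborel. d t * pos_deriv 0 k (u + c * t))"
    proof (rule Bochner_Integration.integral_cong[OF refl])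
      fix t :: real
      show "d t * k (u + c * t) = d t * pos_deriv 0 k (u + c * t)"
        using u c d0[of t] by (cases "t > 0") (auto simp: pos_deriv_def add_pos_pos)
    qed
    finally show ?thesis using f[OF u] by (simp add: dens)
  qed
  have conv: "(\<integral>\<^sup>+w. ennreal (riesz (1 - \<mu>) w * d (x - w)) \<partial>lborel) = ennreal (lam * surv d x)" if m: "\<mu> < 1" for x
  proof (cases "x > 0")
    case True
    define a where "a = 1 - \<mu>"
    have a: "a > 0" using m by (simp add: a_def)
    have [measurable]: "ml_kernel \<mu> lam 0 \<in> borel_measurable borel" by (rule borel_measurable_ml_kernel[OF mu(1) lam])
    have "AE w in lborel. ml_kernel \<mu> lam 0 (x - w) = d (x - w)"
      using AE_borel_affine[of "-1" "\<lambda>y. ml_kernel \<mu> lam 0 y = d y" x] ml(3) by simp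
    then have AE: "AE w in lborel. riesz a w * ml_kernel \<mu> lam 0 (x - w) = riesz a w * d (x - w)"
      by eventually_elim simp
    have "integrable lborel (\<lambda>w. riesz a w * d (x - w))"
      by (rule integrable_cong_AE_imp[OF ml_kernel_riesz(1)[OF mu(1) lam order_refl a, of x]]) (use AE in auto)
    then have "(\<integral>\<^sup>+w. ennreal (riesz a w * d (x - w)) \<partial>lborel) = ennreal (LINT w|lborel. riesz a w * d (x - w))"
      by (rule nn_integral_eq_integral) (simp add: riesz_nonneg[OF a] dn)
    also have "(LINT w|lborel. riesz a w * d (x - w)) = (LINT w|lborel. riesz a w * ml_kernel \<mu> lam 0 (x - w))"
      by (rule integral_cong_AE) (use AE in \<open>auto elim!: eventually_mono\<close>)
    also have "\<dots> = ml_kernel \<mu> lam a x" using ml_kernel_riesz(2)[OF mu(1) lam order_refl a, of x] by simp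
    also have "\<dots> = lam * surv d x"
      using ml_kernel_resolvent[OF mu(1) lam less_imp_le[OF a], of x] ml(4)[OF True] True
      by (simp add: a_def riesz_one right_diff_distrib)
    finally show ?thesis by (simp add: a_def)
  next
    case False
    have "riesz (1 - \<mu>) w * d (x - w) = 0" for w using False d0[of "x - w"] by (cases "w > 0") auto
    then show ?thesis using False by (simp only: surv_def) simp
  qed
  have conv1: "AE x in lborel. d x = lam * surv d x" if m: "\<mu> = 1"
    using ml(3)
  proof eventually_elim
    fix x assume e: "ml_kernel \<mu> lam 0 x = d x"
    show "d x = lam * surv d x"
    proof (cases "x > 0")
      case True
      then show ?thesis using e ml_kernel_resolvent[OF mu(1) lam order_refl, of x] ml(4)[OF True]
        by (simp add: m riesz_one right_diff_distrib)
    qed (simp add: d0 surv_def)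
  qed
  define A where "A u = (LINT t|lborel. d t * pos_deriv 0 k (u + c * t))" for u
  obtain g where g: "caputo_right \<mu> f = Some g" "\<And>u. u > 0 \<Longrightarrow> g u = C * c powr (- \<mu>) * lam * (A u - k u)"
    using caputo_right_surv[OF k kap ep B _ c mu lam dm d0 dn ml(1,2) conv conv1 fu] unfolding A_def by auto
  have "c powr \<mu> * g u + lam * f u = C * lam * (1 - k u)" if u: "u > 0" for u
  proof -
    have "c powr \<mu> * c powr (- \<mu>) = 1" using c by (simp add: powr_minus)
    then have "c powr \<mu> * (C * c powr (- \<mu>) * lam * (A u - k u)) = C * lam * (A u - k u)"
      by (metis (no_types, lifting) mult.assoc mult.commute mult_1)
    then have "c powr \<mu> * g u = C * lam * (A u - k u)" by (simp only: g(2)[OF u])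
    moreover have "f u = C * (1 - A u)" using fu[OF u] by (simp only: A_def)
    ultimately have "c powr \<mu> * g u + lam * f u = C * lam * (A u - k u) + lam * (C * (1 - A u))" by (simp only:)
    then show ?thesis by (simp add: algebra_simps)
  qed
  then show ?thesis using g(1) by (simp add: mittag_leffler_arrival_op_def)
qed

section \<open>Compositions of partial operators\<close>

lemma odot_Suc: "a \<le> Suc b \<Longrightarrow> odot L a (Suc b) = L (Suc b) \<circ>\<^sub>m odot L a b"
  by (simp add: odot_def)

lemma odot_empty: "b < a \<Longrightarrow> odot L a b = Some"
  by (simp add: odot_def)

text \<open>\<open>R j\<close> is the invariant that holds before the operator of index
  \<open>j\<close> is applied; \<open>a = Suc b\<close> is the empty composition.\<close>

lemma odot_chain:
  assumes step: "\<And>j F. a \<le> j \<Longrightarrow> j \<le> b \<Longrightarrow> R j F \<Longrightarrow> \<exists>g. L j F = Some g \<and> R (Suc j) g"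
    and start: "R a F" and ab: "a \<le> Suc b"
  shows "\<exists>g. odot L a b F = Some g \<and> R (Suc b) g"
  using ab step
proof (induction b rule: nat_induct)
  case 0
  then show ?case using start odot_empty[of 0 a L] odot_Suc[of a 0]
    by (cases a) (auto simp: odot_def)
next
  case (Suc b)
  show ?case
  proof (cases "a = Suc (Suc b)")
    case True then show ?thesis using start by (simp add: odot_empty)
  next
    case False
    then have "a \<le> Suc b" using Suc.prems(1) by simp
    with Suc obtain g where "odot L a b F = Some g" "R (Suc b) g" by force
    with Suc.prems(2)[of "Suc b" g] \<open>a \<le> Suc b\<close> show ?thesis by (auto simp: odot_Suc)
  qed
qed

section \<open>Survival of a random walk\<close>

text \<open>Index \<open>k = 0\<close> counts: negative capital is immediate ruin, in agreement with
  \<open>\<phi> = 0\<close> on the negative half-line.\<close>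

definition never_below :: "real \<Rightarrow> (nat \<Rightarrow> real) set" where
  "never_below u = {\<omega>. \<forall>k. u + (\<Sum>i<k. \<omega> i) \<ge> 0}"

abbreviation walk_space :: "real measure \<Rightarrow> (nat \<Rightarrow> real) measure" where
  "walk_space \<nu> \<equiv> PiM UNIV (\<lambda>_. \<nu>)"

definition survival :: "real measure \<Rightarrow> real \<Rightarrow> real" where
  "survival \<nu> u = measure (walk_space \<nu>) (never_below u)"

lemma never_below_case_nat: "case_nat s \<omega> \<in> never_below u \<longleftrightarrow> u \<ge> 0 \<and> \<omega> \<in> never_below (u + s)"
proof -
  have "(\<forall>k. u + (\<Sum>i<k. case_nat s \<omega> i) \<ge> 0)
      \<longleftrightarrow> u \<ge> 0 \<and> (\<forall>k. u + (\<Sum>i<Suc k. case_nat s \<omega> i) \<ge> 0)"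
    by (metis (no_types, lifting) add_0_right lessThan_0 not0_implies_Suc sum.empty)
  also have "(\<forall>k. u + (\<Sum>i<Suc k. case_nat s \<omega> i) \<ge> 0) \<longleftrightarrow> (\<forall>k. u + s + (\<Sum>i<k. \<omega> i) \<ge> 0)"
    by (simp add: sum.lessThan_Suc_shift add.assoc del: sum.lessThan_Suc)
  finally show ?thesis by (simp add: never_below_def)
qed

lemma never_below_mono: "u \<le> v \<Longrightarrow> never_below u \<subseteq> never_below v"
  unfolding never_below_def using order_trans[OF _ add_right_mono] by blast

lemma never_below_neg: "u < 0 \<Longrightarrow> never_below u = {}"
  unfolding never_below_def by (auto intro!: exI[of _ 0] simp: not_le)

context
  fixes \<nu> :: "real measure"
  assumes prob\<nu>: "prob_space \<nu>" and sets\<nu>: "sets \<nu> = sets borel"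
begin

lemma space_nu: "space \<nu> = UNIV"
  using sets_eq_imp_space_eq[OF sets\<nu>] by simp

lemma space_seq: "space (walk_space \<nu>) = UNIV"
  by (auto simp: space_PiM space_nu)

lemma prob_space_seq: "prob_space (walk_space \<nu>)"
  by (intro prob_space_PiM prob\<nu>)

lemma measurable_partial_sum: "(\<lambda>\<omega>. \<Sum>i<k. \<omega> i) \<in> borel_measurable (walk_space \<nu>)"
proof -
  have "(\<lambda>\<omega>. \<omega> i) \<in> measurable (walk_space \<nu>) \<nu>" for i by measurable
  then have "(\<lambda>\<omega>. \<omega> i) \<in> borel_measurable (walk_space \<nu>)" for i
    using sets\<nu> measurable_cong_sets by blast
  then show ?thesis by measurable
qed

lemma sets_never_below: "never_below u \<in> sets (walk_space \<nu>)"
proof -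
  note [measurable] = measurable_partial_sum
  have "{\<omega> \<in> space (walk_space \<nu>). \<forall>k. u + (\<Sum>i<k. \<omega> i) \<ge> 0} \<in> sets (walk_space \<nu>)"
    by measurable
  then show ?thesis by (simp add: never_below_def space_seq)
qed

lemma survival_bounds: "0 \<le> survival \<nu> u" "survival \<nu> u \<le> 1"
  unfolding survival_def using prob_space.prob_le_1[OF prob_space_seq] by auto

lemma survival_mono: "u \<le> v \<Longrightarrow> survival \<nu> u \<le> survival \<nu> v"
  unfolding survival_def
  by (intro finite_measure.finite_measure_mono prob_space.finite_measure prob_space_seq never_below_mono sets_never_below)

lemma borel_measurable_survival: "survival \<nu> \<in> borel_measurable borel"
  by (rule borel_measurable_mono) (simp add: mono_def survival_mono)

lemma survival_neg: "u < 0 \<Longrightarrow> survival \<nu> u = 0"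
  by (simp add: survival_def never_below_neg)

text \<open>An i.i.d. sequence is its first term followed by an independent copy of the whole
  sequence; this is conditioning on the first step.\<close>

lemma emeasure_seq_iter:
  assumes A: "A \<in> sets (walk_space \<nu>)"
  shows "emeasure (walk_space \<nu>) A
    = (\<integral>\<^sup>+s. emeasure (walk_space \<nu>) {\<omega>. case_nat s \<omega> \<in> A} \<partial>\<nu>)"
proof -
  interpret prob_space \<nu> by (rule prob\<nu>)
  interpret sequence_space \<nu> by unfold_locales
  have m: "(\<lambda>(s, \<omega>). case_nat s \<omega>) \<in> measurable (\<nu> \<Otimes>\<^sub>M S) S" by measurable
  have "emeasure S A = emeasure (distr (\<nu> \<Otimes>\<^sub>M S) S (\<lambda>(s, \<omega>). case_nat s \<omega>)) A"
    by (simp add: PiM_iter)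
  also have "\<dots> = emeasure (\<nu> \<Otimes>\<^sub>M S) ((\<lambda>(s, \<omega>). case_nat s \<omega>) -` A \<inter> space (\<nu> \<Otimes>\<^sub>M S))"
    by (rule emeasure_distr[OF m A])
  also have "\<dots> = (\<integral>\<^sup>+s. emeasure S (Pair s -` ((\<lambda>(s, \<omega>). case_nat s \<omega>) -` A \<inter> space (\<nu> \<Otimes>\<^sub>M S))) \<partial>\<nu>)"
    by (rule sigma_finite_measure.emeasure_pair_measure_alt
          [OF prob_space_imp_sigma_finite[OF prob_space_seq] measurable_sets[OF m A]])
  finally have e: "emeasure S A = (\<integral>\<^sup>+s. emeasure S (Pair s -` ((\<lambda>(s, \<omega>). case_nat s \<omega>) -` A \<inter> space (\<nu> \<Otimes>\<^sub>M S))) \<partial>\<nu>)" .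
  have "Pair s -` ((\<lambda>(s, \<omega>). case_nat s \<omega>) -` A \<inter> space (\<nu> \<Otimes>\<^sub>M S)) = {\<omega>. case_nat s \<omega> \<in> A}" for s
    by (auto simp: space_pair_measure space_nu space_seq)
  then show ?thesis using e by (simp only:)
qed

lemma survival_renewal:
  assumes u: "u \<ge> 0"
  shows "survival \<nu> u = (LINT x|\<nu>. survival \<nu> (u + x))"
proof -
  interpret prob_space \<nu> by (rule prob\<nu>)
  interpret S: prob_space "walk_space \<nu>" by (rule prob_space_seq)
  have em: "emeasure (walk_space \<nu>) (never_below v) = ennreal (survival \<nu> v)" for v
    by (simp add: survival_def S.emeasure_eq_measure)
  have "ennreal (survival \<nu> u) = (\<integral>\<^sup>+x. ennreal (survival \<nu> (u + x)) \<partial>\<nu>)"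
    using emeasure_seq_iter[OF sets_never_below[of u]] u by (simp add: never_below_case_nat em)
  moreover have "(\<lambda>x. survival \<nu> (u + x)) \<in> borel_measurable \<nu>"
    using borel_measurable_survival sets\<nu> by (simp cong: measurable_cong_sets)
  ultimately show ?thesis
    using survival_bounds(1) by (subst integral_eq_nn_integral) (auto, metis enn2real_ennreal)
qed

text \<open>Lundberg's inequality, by induction on the time horizon: \<open>exp (- e u)\<close> dominates
  \<open>1\<close> for \<open>u < 0\<close> and is superharmonic for the walk.\<close>

lemma survival_Lundberg:
  assumes e: "e \<ge> 0" and sub: "(\<integral>\<^sup>+x. ennreal (exp (- e * x)) \<partial>\<nu>) \<le> 1"
  shows "1 - survival \<nu> u \<le> exp (- e * u)"
proof -
  interpret prob_space \<nu> by (rule prob\<nu>)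
  interpret S: prob_space "walk_space \<nu>" by (rule prob_space_seq)
  note [measurable] = measurable_partial_sum
  define R where "R n u = {\<omega> :: nat \<Rightarrow> real. \<exists>k\<le>n. u + (\<Sum>i<k. \<omega> i) < 0}" for n :: nat and u
  have Rm: "R n u \<in> sets (walk_space \<nu>)" for n u
  proof -
    have "{\<omega> \<in> space (walk_space \<nu>). \<exists>k\<in>{..n}. u + (\<Sum>i<k. \<omega> i) < 0} \<in> sets (walk_space \<nu>)"
      by measurable
    moreover have "{\<omega> \<in> space (walk_space \<nu>). \<exists>k\<in>{..n}. u + (\<Sum>i<k. \<omega> i) < 0} = R n u"
      by (auto simp: R_def space_seq)
    ultimately show ?thesis by simp
  qed
  have b: "emeasure (walk_space \<nu>) (R n u) \<le> ennreal (exp (- e * u))" for n u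
  proof (induction n arbitrary: u)
    case 0
    show ?case
    proof (cases "u < 0")
      case True
      then have "1 \<le> exp (- e * u)" using e by (simp add: mult_nonneg_nonpos)
      then have "1 \<le> ennreal (exp (- e * u))" using ennreal_leI[of 1] by simp
      then show ?thesis by (rule order_trans[OF S.emeasure_le_1])
    next
      case False then show ?thesis by (simp add: R_def)
    qed
  next
    case (Suc n)
    show ?case
    proof (cases "u < 0")
      case True
      then have "1 \<le> exp (- e * u)" using e by (simp add: mult_nonneg_nonpos)
      then have "1 \<le> ennreal (exp (- e * u))" using ennreal_leI[of 1] by simp
      then show ?thesis by (rule order_trans[OF S.emeasure_le_1])
    next
      case False
      have it: "case_nat s \<omega> \<in> R (Suc n) u \<longleftrightarrow> \<omega> \<in> R n (u + s)" for s \<omega>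
      proof -
        have "(\<exists>k\<le>Suc n. u + (\<Sum>i<k. case_nat s \<omega> i) < 0) \<longleftrightarrow> (\<exists>k\<le>n. u + (\<Sum>i<Suc k. case_nat s \<omega> i) < 0)"
        proof
          assume "\<exists>k\<le>Suc n. u + (\<Sum>i<k. case_nat s \<omega> i) < 0"
          then obtain k where k: "k \<le> Suc n" "u + (\<Sum>i<k. case_nat s \<omega> i) < 0" by blast
          then have "k \<noteq> 0" using False by (intro notI) simp
          then show "\<exists>k\<le>n. u + (\<Sum>i<Suc k. case_nat s \<omega> i) < 0" using k by (metis Suc_le_mono not0_implies_Suc)
        qed (metis Suc_le_mono)
        then show ?thesis
          by (simp add: R_def sum.lessThan_Suc_shift add.assoc del: sum.lessThan_Suc)
      qed
      have "emeasure (walk_space \<nu>) (R (Suc n) u) = (\<integral>\<^sup>+s. emeasure (walk_space \<nu>) (R n (u + s)) \<partial>\<nu>)"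
        unfolding emeasure_seq_iter[OF Rm[of "Suc n" u]] it by simp
      also have "\<dots> \<le> (\<integral>\<^sup>+s. ennreal (exp (- e * u)) * ennreal (exp (- e * s)) \<partial>\<nu>)"
        using Suc.IH[of "u + _"] by (intro nn_integral_mono) (simp add: ennreal_mult[symmetric] exp_add[symmetric] distrib_left)
      also have "\<dots> = ennreal (exp (- e * u)) * (\<integral>\<^sup>+s. ennreal (exp (- e * s)) \<partial>\<nu>)"
        using sets\<nu> by (intro nn_integral_cmult) (simp cong: measurable_cong_sets)
      also have "\<dots> \<le> ennreal (exp (- e * u)) * 1" by (rule mult_left_mono[OF sub]) simp
      finally show ?thesis by simp
    qed
  qed
  have inc: "incseq (\<lambda>n. R n u)" by (auto simp: incseq_def R_def intro: order_trans)
  have "(SUP n. emeasure (walk_space \<nu>) (R n u)) = emeasure (walk_space \<nu>) (\<Union>n. R n u)"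
    by (rule SUP_emeasure_incseq) (use Rm inc in auto)
  also have "(\<Union>n. R n u) = space (walk_space \<nu>) - never_below u"
  proof -
    have "(\<exists>n. \<exists>k\<le>n. u + (\<Sum>i<k. \<omega> i) < 0) \<longleftrightarrow> (\<exists>k. u + (\<Sum>i<k. \<omega> i) < 0)" for \<omega> :: "nat \<Rightarrow> real"
      by blast
    then show ?thesis by (simp add: set_eq_iff R_def never_below_def space_seq not_le)
  qed
  finally have "emeasure (walk_space \<nu>) (space (walk_space \<nu>) - never_below u) \<le> ennreal (exp (- e * u))"
    using SUP_least[of UNIV "\<lambda>n. emeasure (walk_space \<nu>) (R n u)", OF b] by simp
  then have "S.prob (space (walk_space \<nu>) - never_below u) \<le> exp (- e * u)"
    by (simp add: S.emeasure_eq_measure)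
  then show ?thesis using S.prob_compl[OF sets_never_below[of u]] by (simp add: survival_def)
qed

text \<open>Ruin is a strict inequality at a single index and persists under a slight increase of
  the capital, so \<open>never_below v\<close> shrinks to \<open>never_below u\<close> as
  \<open>v\<close> decreases to \<open>u\<close>. It provides the value of the final equation at
  0.\<close>

lemma survival_right_continuous: "(survival \<nu> \<longlongrightarrow> survival \<nu> u) (at_right u)"
proof -
  interpret S: prob_space "walk_space \<nu>" by (rule prob_space_seq)
  have i: "survival \<nu> v = (LINT \<omega>|walk_space \<nu>. indicator (never_below v) \<omega>)" for v
    using sets_never_below[of v] by (simp add: survival_def)
  show ?thesis unfolding tendsto_at_iff_sequentially comp_def
  proof (intro allI impI)
    fix X assume X: "\<forall>i::nat. X i \<in> {u<..} - {u}" "X \<longlonglongrightarrow> u"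
    show "(\<lambda>i. survival \<nu> (X i)) \<longlonglongrightarrow> survival \<nu> u"
      unfolding i
    proof (rule integral_dominated_convergence[where w="\<lambda>_. 1"])
      show "AE \<omega> in walk_space \<nu>. (\<lambda>i. indicator (never_below (X i)) \<omega> :: real) \<longlonglongrightarrow> indicator (never_below u) \<omega>"
      proof (intro AE_I2)
        fix \<omega>
        show "(\<lambda>i. indicator (never_below (X i)) \<omega> :: real) \<longlonglongrightarrow> indicator (never_below u) \<omega>"
        proof (cases "\<omega> \<in> never_below u")
          case True
          have "X i \<ge> u" for i using X(1) by (meson DiffD1 greaterThan_iff less_imp_le)
          then have "\<omega> \<in> never_below (X i)" for i using True never_below_mono by blast
          then show ?thesis using True by simp
        next
          case False
          then obtain k where k: "u + (\<Sum>i<k. \<omega> i) < 0" by (auto simp: never_below_def not_le)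
          have "eventually (\<lambda>i. X i < - (\<Sum>i<k. \<omega> i)) sequentially"
            using order_tendstoD(2)[OF X(2)] k by simp
          then have "eventually (\<lambda>i. indicator (never_below (X i)) \<omega> = (0::real)) sequentially"
            by eventually_elim (auto simp: never_below_def indicator_def not_le intro!: exI[of _ k])
          then show ?thesis using False tendsto_eventually by (simp add: tendsto_eventually)
        qed
      qed
    qed (use sets_never_below in \<open>auto simp: indicator_def\<close>)
  qed
qed

end

section \<open>The risk process as a random walk\<close>

context renewal_risk_model
begin

definition step :: "nat \<Rightarrow> 'a \<Rightarrow> real" where
  "step i \<omega> = c * T (Suc i) \<omega> - X (Suc i) \<omega>"

definition step_law :: "real measure" where
  "step_law = distr M borel (step 0)"

definition claims_by :: "real \<Rightarrow> 'a \<Rightarrow> nat set" where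
  "claims_by t \<omega> = {k. 1 \<le> k \<and> (\<Sum>i=1..k. T i \<omega>) \<le> t}"

lemma measurable_claim: "i \<ge> 1 \<Longrightarrow> X i \<in> borel_measurable M"
  using claims_indep by (simp add: indep_vars_def)

lemma measurable_waiting: "i \<ge> 1 \<Longrightarrow> T i \<in> borel_measurable M"
  using waiting_indep by (simp add: indep_vars_def)

lemma measurable_step: "step i \<in> borel_measurable M"
  unfolding step_def[abs_def] using measurable_claim[of "Suc i"] measurable_waiting[of "Suc i"] by simp

lemma measurable_sum_claim: "(\<lambda>\<omega>. \<Sum>i=1..k. X i \<omega>) \<in> borel_measurable M"
  by (intro borel_measurable_sum measurable_claim) auto

lemma measurable_sum_waiting: "(\<lambda>\<omega>. \<Sum>i=1..k. T i \<omega>) \<in> borel_measurable M"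
  by (intro borel_measurable_sum measurable_waiting) auto

lemma surplus_claims_by: "surplus u t \<omega> = u + c * t - (\<Sum>i=1..card (claims_by t \<omega>). X i \<omega>)"
  by (simp add: surplus_def claim_count_def claims_by_def)

text \<open>\<open>card\<close> of an infinite set is 0, so infinitely many claims by time
  \<open>t\<close> would leave the surplus at \<open>u + c * t > 0\<close>.\<close>

lemma finite_claims_by:
  assumes "u \<ge> 0" "t > 0" "surplus u t \<omega> < 0" shows "finite (claims_by t \<omega>)" "claims_by t \<omega> \<noteq> {}"
proof -
  have "u + c * t > 0" using assms premium_pos by (simp add: add_nonneg_pos)
  then have "card (claims_by t \<omega>) \<noteq> 0" using assms(3) by (intro notI) (simp add: surplus_claims_by)
  then show "finite (claims_by t \<omega>)" "claims_by t \<omega> \<noteq> {}" by (auto intro: card_ge_0_finite)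
qed

lemma surplus_eq:
  assumes "claims_by t \<omega> = claims_by t' \<omega>" "t' \<le> t" "surplus u t \<omega> < 0" shows "surplus u t' \<omega> < 0"
proof -
  have "c * t' \<le> c * t" using assms(2) premium_pos by simp
  then show ?thesis using assms(1,3) by (simp add: surplus_claims_by)
qed

text \<open>For measurability of the ruin event, on every path, including those with nonpositive
  waiting times. As the surplus only grows between claims, ruin shows already at the latest epoch
  before \<open>t\<close>; if all counted epochs are \<open>\<le> 0\<close>, it shows at a small
  time \<open>1 / (n + 1)\<close>.\<close>

lemma ruin_countable:
  assumes u: "u \<ge> 0"
  shows "(\<exists>t>0. surplus u t \<omega> < 0) \<longleftrightarrow>
    (\<exists>k. (\<Sum>i=1..k. T i \<omega>) > 0 \<and> surplus u (\<Sum>i=1..k. T i \<omega>) \<omega> < 0) \<or> (\<exists>n. surplus u (1 / real (Suc n)) \<omega> < 0)"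
    (is "?L \<longleftrightarrow> ?R")
proof
  assume ?L
  then obtain t where t: "t > 0" "surplus u t \<omega> < 0" by blast
  define S where "S k = (\<Sum>i=1..k. T i \<omega>)" for k
  have A: "claims_by t \<omega> = {k. 1 \<le> k \<and> S k \<le> t}" for t by (simp add: claims_by_def S_def)
  note fin = finite_claims_by[OF u t]
  show ?R
  proof (cases "\<exists>k\<in>claims_by t \<omega>. S k > 0")
    case True
    then obtain j where j: "j \<in> claims_by t \<omega>" "S j > 0" by blast
    have "Max (S ` claims_by t \<omega>) \<in> S ` claims_by t \<omega>" using fin by (intro Max_in) auto
    then obtain k where k: "k \<in> claims_by t \<omega>" "S k = Max (S ` claims_by t \<omega>)" by (metis imageE)
    have ge: "S i \<le> S k" if "i \<in> claims_by t \<omega>" for i using that fin k(2) by simp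
    have "S k > 0" using ge[OF j(1)] j(2) by simp
    moreover have "S k \<le> t" using k(1) by (simp add: A)
    moreover have "claims_by t \<omega> = claims_by (S k) \<omega>"
      using ge \<open>S k \<le> t\<close> by (auto simp: A)
    ultimately have "S k > 0 \<and> surplus u (S k) \<omega> < 0" using surplus_eq t(2) by blast
    then show ?thesis unfolding S_def by blast
  next
    case False
    obtain n where n: "inverse (real (Suc n)) < t" using reals_Archimedean[OF t(1)] by blast
    have p: "1 / real (Suc n) > 0" by simp
    have "claims_by t \<omega> = claims_by (1 / real (Suc n)) \<omega>"
    proof
      show "claims_by t \<omega> \<subseteq> claims_by (1 / real (Suc n)) \<omega>"
        using False p order_trans[OF _ less_imp_le[OF p]] unfolding A by (auto simp: not_less)
      show "claims_by (1 / real (Suc n)) \<omega> \<subseteq> claims_by t \<omega>"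
        using n by (auto simp: A inverse_eq_divide)
    qed
    then have "surplus u (1 / real (Suc n)) \<omega> < 0"
      using surplus_eq t(2) n by (metis inverse_eq_divide less_imp_le)
    then show ?thesis by blast
  qed
next
  have "1 / real (Suc n) > 0" for n by simp
  then show "?R \<Longrightarrow> ?L" by blast
qed

lemma measurable_surplus:
  assumes [measurable]: "\<tau> \<in> borel_measurable M"
  shows "(\<lambda>\<omega>. surplus u (\<tau> \<omega>) \<omega>) \<in> borel_measurable M"
proof -
  note [measurable] = measurable_sum_waiting measurable_sum_claim
  have "(\<lambda>\<omega>. claim_count (\<tau> \<omega>) \<omega>) \<in> measurable M (count_space UNIV)"
    unfolding claim_count_def by (rule measurable_card) measurable
  then have "(\<lambda>\<omega>. \<Sum>i=1..claim_count (\<tau> \<omega>) \<omega>. X i \<omega>) \<in> borel_measurable M"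
    by (rule measurable_compose_countable[rotated]) measurable
  then show ?thesis unfolding surplus_def by measurable
qed

lemma sets_ruin:
  assumes u: "u \<ge> 0" shows "{\<omega> \<in> space M. \<exists>t>0. surplus u t \<omega> < 0} \<in> events"
proof -
  note [measurable] = measurable_surplus[OF measurable_sum_waiting] measurable_sum_waiting
    measurable_surplus[OF borel_measurable_const]
  show ?thesis unfolding ruin_countable[OF u] by measurable
qed

text \<open>With positive waiting times exactly \<open>k\<close> claims have occurred at the
  \<open>k\<close>-th epoch, where the surplus is the walk after \<open>k\<close> steps; in between
  it only increases.\<close>

lemma ruin_walk:
  assumes u: "u \<ge> 0" and T: "\<And>i. i \<ge> 1 \<Longrightarrow> T i \<omega> > 0"
  shows "(\<exists>t>0. surplus u t \<omega> < 0) \<longleftrightarrow> (\<exists>k. u + (\<Sum>i<k. step i \<omega>) < 0)"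
proof -
  define S where "S k = (\<Sum>i=1..k. T i \<omega>)" for k
  have A: "claims_by t \<omega> = {k. 1 \<le> k \<and> S k \<le> t}" for t by (simp add: claims_by_def S_def)
  have sm: "strict_mono S"
    unfolding strict_mono_Suc_iff S_def using T by (simp add: sum.atLeast1_atMost_eq)
  have w: "u + c * S k - (\<Sum>i=1..k. X i \<omega>) = u + (\<Sum>i<k. step i \<omega>)" for k
    by (simp add: S_def step_def sum.atLeast1_atMost_eq sum_subtractf sum_distrib_left)
  have S0: "S 0 = 0" by (simp add: S_def)
  have cl: "claims_by (S k) \<omega> = {1..k}" for k
    using strict_mono_less_eq[OF sm] by (auto simp: A)
  show ?thesis
  proof
    assume "\<exists>k. u + (\<Sum>i<k. step i \<omega>) < 0"
    then obtain k where k: "u + (\<Sum>i<k. step i \<omega>) < 0" by blast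
    then have "k \<noteq> 0" using u by (intro notI) simp
    then have "S k > 0" using strict_monoD[OF sm, of 0 k] S0 by simp
    moreover have "surplus u (S k) \<omega> < 0" using k w[of k] by (simp add: surplus_claims_by cl)
    ultimately show "\<exists>t>0. surplus u t \<omega> < 0" by blast
  next
    assume "\<exists>t>0. surplus u t \<omega> < 0"
    then obtain t where t: "t > 0" "surplus u t \<omega> < 0" by blast
    note fin = finite_claims_by[OF u t]
    define m where "m = Max (claims_by t \<omega>)"
    have m: "m \<in> claims_by t \<omega>" unfolding m_def using fin by (intro Max_in) auto
    then have Sm: "S m \<le> t" by (simp add: A)
    have "claims_by t \<omega> = {1..m}"
    proof
      show "claims_by t \<omega> \<subseteq> {1..m}" using fin by (auto simp: m_def A)
      show "{1..m} \<subseteq> claims_by t \<omega>"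
        using Sm strict_mono_less_eq[OF sm] order_trans[of "S _" "S m" t] by (auto simp: A)
    qed
    then have "surplus u t \<omega> = u + c * t - (\<Sum>i=1..m. X i \<omega>)" by (simp add: surplus_claims_by)
    moreover have "c * S m \<le> c * t" using Sm premium_pos by simp
    ultimately show "\<exists>k. u + (\<Sum>i<k. step i \<omega>) < 0" using w[of m] t(2) by (intro exI[of _ m]) simp
  qed
qed

text \<open>A finite set of indices splits into claims and waiting times. Each part is a cylinder
  event of one sequence, so independence of the sequences as wholes applies first and independence
  within each of them second.\<close>

lemma indep_claims_waiting: "indep_vars (\<lambda>_. borel) (case_sum X T) ({1..} <+> {1..})"
  unfolding indep_vars_def2
proof (intro conjI ballI)
  show "random_variable borel (case_sum X T i)" if "i \<in> {1..} <+> {1..}" for i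
    using that measurable_claim measurable_waiting by auto
  show "indep_sets (\<lambda>i. {case_sum X T i -` A \<inter> space M |A. A \<in> sets borel}) ({1..} <+> {1..})"
  proof (rule indep_setsI)
    show "{case_sum X T i -` A \<inter> space M |A. A \<in> sets borel} \<subseteq> events" if "i \<in> {1..} <+> {1..}" for i
      using that measurable_claim measurable_waiting by (auto intro: measurable_sets)
    fix A and J :: "(nat + nat) set"
    assume J: "J \<noteq> {}" "J \<subseteq> {1..} <+> {1..}" "finite J"
      and A: "\<forall>j\<in>J. A j \<in> {case_sum X T j -` A \<inter> space M |A. A \<in> sets borel}"
    then obtain B where B: "\<And>j. j \<in> J \<Longrightarrow> B j \<in> sets borel" "\<And>j. j \<in> J \<Longrightarrow> A j = case_sum X T j -` B j \<inter> space M"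
      by (auto simp: subset_eq) metis
    define JX where "JX = {i. Inl i \<in> J}"
    define JT where "JT = {i. Inr i \<in> J}"
    have JJ: "J = Inl ` JX \<union> Inr ` JT"
    proof
      show "J \<subseteq> Inl ` JX \<union> Inr ` JT"
      proof
        fix x assume "x \<in> J" then show "x \<in> Inl ` JX \<union> Inr ` JT" by (cases x) (auto simp: JX_def JT_def)
      qed
    qed (auto simp: JX_def JT_def)
    have fX: "finite JX" "finite JT"
      using J(3) finite_vimageI[of J Inl] finite_vimageI[of J Inr] by (auto simp: JX_def JT_def vimage_def)
    have sX: "JX \<subseteq> {1..}" "JT \<subseteq> {1..}" using J(2) by (auto simp: JX_def JT_def)
    define CX where "CX = prod_emb {1..} (\<lambda>_. borel) JX (\<Pi>\<^sub>E i\<in>JX. B (Inl i))"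
    define CT where "CT = prod_emb {1..} (\<lambda>_. borel) JT (\<Pi>\<^sub>E i\<in>JT. B (Inr i))"
    have CX: "CX \<in> sets (PiM {1..} (\<lambda>_. borel))" "CT \<in> sets (PiM {1..} (\<lambda>_. borel))"
      unfolding CX_def CT_def using B(1) fX sX by (auto intro!: sets_PiM_I simp: JX_def JT_def)
    define evX where "evX = {\<omega> \<in> space M. \<forall>i\<in>JX. X i \<omega> \<in> B (Inl i)}"
    define evT where "evT = {\<omega> \<in> space M. \<forall>i\<in>JT. T i \<omega> \<in> B (Inr i)}"
    have vX: "(\<lambda>\<omega>. \<lambda>i\<in>{1..}. X i \<omega>) -` CX \<inter> space M = evX"
      using sX by (auto simp: CX_def evX_def prod_emb_def PiE_iff restrict_def extensional_def Pi_iff subset_eq)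
    have vT: "(\<lambda>\<omega>. \<lambda>i\<in>{1..}. T i \<omega>) -` CT \<inter> space M = evT"
      using sX by (auto simp: CT_def evT_def prod_emb_def PiE_iff restrict_def extensional_def Pi_iff subset_eq)
    have int: "(\<Inter>j\<in>J. A j) = evX \<inter> evT"
    proof -
      have "\<omega> \<in> (\<Inter>j\<in>J. A j) \<longleftrightarrow> \<omega> \<in> space M \<and> (\<forall>j\<in>J. case_sum X T j \<omega> \<in> B j)" for \<omega>
        using J(1) B(2) by auto
      also have "\<dots> \<omega> \<longleftrightarrow> \<omega> \<in> evX \<inter> evT" for \<omega>
        unfolding JJ evX_def evT_def ball_Un by auto
      finally show ?thesis by blast
    qed
    have pX: "prob evX = (\<Prod>i\<in>JX. prob (A (Inl i)))"
    proof (cases "JX = {}")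
      case True then show ?thesis by (simp add: evX_def prob_space)
    next
      case False
      have "prob (\<Inter>i\<in>JX. X i -` B (Inl i) \<inter> space M) = (\<Prod>i\<in>JX. prob (X i -` B (Inl i) \<inter> space M))"
        by (rule indep_varsD[OF claims_indep False fX(1) sX(1)]) (use B(1) in \<open>auto simp: JX_def\<close>)
      moreover have "(\<Inter>i\<in>JX. X i -` B (Inl i) \<inter> space M) = evX" using False by (auto simp: evX_def)
      moreover have "A (Inl i) = X i -` B (Inl i) \<inter> space M" if "i \<in> JX" for i
        using B(2)[of "Inl i"] that by (simp add: JX_def)
      ultimately show ?thesis by simp
    qed
    have pT: "prob evT = (\<Prod>i\<in>JT. prob (A (Inr i)))"
    proof (cases "JT = {}")
      case True then show ?thesis by (simp add: evT_def prob_space)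
    next
      case False
      have "prob (\<Inter>i\<in>JT. T i -` B (Inr i) \<inter> space M) = (\<Prod>i\<in>JT. prob (T i -` B (Inr i) \<inter> space M))"
        by (rule indep_varsD[OF waiting_indep False fX(2) sX(2)]) (use B(1) in \<open>auto simp: JT_def\<close>)
      moreover have "(\<Inter>i\<in>JT. T i -` B (Inr i) \<inter> space M) = evT" using False by (auto simp: evT_def)
      moreover have "A (Inr i) = T i -` B (Inr i) \<inter> space M" if "i \<in> JT" for i
        using B(2)[of "Inr i"] that by (simp add: JT_def)
      ultimately show ?thesis by simp
    qed
    have "prob (evX \<inter> evT) = prob evX * prob evT"
    proof -
      have "(\<lambda>\<omega>. (\<lambda>i\<in>{1..}. X i \<omega>, \<lambda>i\<in>{1..}. T i \<omega>)) -` (CX \<times> CT) \<inter> space M = evX \<inter> evT"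
        using vX vT by blast
      then show ?thesis using indep_varD[OF claims_waiting_indep CX] unfolding vX vT by simp
    qed
    also have "\<dots> = (\<Prod>j\<in>J. prob (A j))"
      unfolding pX pT JJ by (subst prod.union_disjoint) (use fX in \<open>auto simp: prod.reindex inj_on_def\<close>)
    finally show "prob (\<Inter>j\<in>J. A j) = (\<Prod>j\<in>J. prob (A j))" unfolding int .
  qed
qed

lemma indep_steps: "indep_vars (\<lambda>_. borel) step UNIV"
proof -
  have "indep_vars (\<lambda>_. borel) (\<lambda>j \<omega>. (\<lambda>f. c * f (Inr (Suc j)) - f (Inl (Suc j)))
      (restrict (\<lambda>i. case_sum X T i \<omega>) {Inl (Suc j), Inr (Suc j)})) UNIV"
  proof (rule indep_vars_compose2[OF indep_vars_restrict[OF indep_claims_waiting]])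
    show "disjoint_family_on (\<lambda>j. {Inl (Suc j), Inr (Suc j)}) UNIV" by (auto simp: disjoint_family_on_def)
    show "(\<lambda>f. c * f (Inr (Suc j)) - f (Inl (Suc j))) \<in> borel_measurable (PiM {Inl (Suc j), Inr (Suc j)} (\<lambda>_. borel))" for j
      by measurable
  qed auto
  then show ?thesis by (simp add: step_def[abs_def])
qed

lemma indep_claim_waiting:
  assumes i: "i \<ge> 1" shows "indep_var borel (X i) borel (T i)"
proof -
  have "indep_var borel ((\<lambda>f. f i) \<circ> (\<lambda>\<omega>. \<lambda>i\<in>{1..}. X i \<omega>)) borel ((\<lambda>f. f i) \<circ> (\<lambda>\<omega>. \<lambda>i\<in>{1..}. T i \<omega>))"
    by (rule indep_var_compose[OF claims_waiting_indep]) (use i in \<open>auto intro!: measurable_component_singleton\<close>)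
  then show ?thesis using i by (simp add: comp_def)
qed

lemma nn_integral_step:
  assumes [measurable]: "f \<in> borel_measurable borel" and i: "i \<ge> 1"
  shows "(\<integral>\<^sup>+\<omega>. f (c * T i \<omega> - X i \<omega>) \<partial>M) = (\<integral>\<^sup>+t. \<integral>\<^sup>+x. f (c * t - x) \<partial>distr M borel (X i) \<partial>distr M borel (T i))"
proof -
  note [measurable] = measurable_claim[OF i] measurable_waiting[OF i]
  have e: "distr M borel (X i) \<Otimes>\<^sub>M distr M borel (T i) = distr M (borel \<Otimes>\<^sub>M borel) (\<lambda>\<omega>. (X i \<omega>, T i \<omega>))"
    using indep_claim_waiting[OF i] unfolding indep_var_distribution_eq by blast
  interpret DX: prob_space "distr M borel (X i)" by (rule prob_space_distr) simp
  interpret DT: prob_space "distr M borel (T i)" by (rule prob_space_distr) simp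
  interpret P: pair_sigma_finite "distr M borel (X i)" "distr M borel (T i)" ..
  have "(\<integral>\<^sup>+\<omega>. f (c * T i \<omega> - X i \<omega>) \<partial>M) = (\<integral>\<^sup>+z. f (c * snd z - fst z) \<partial>distr M (borel \<Otimes>\<^sub>M borel) (\<lambda>\<omega>. (X i \<omega>, T i \<omega>)))"
    by (subst nn_integral_distr) auto
  also have "\<dots> = (\<integral>\<^sup>+t. \<integral>\<^sup>+x. f (c * t - x) \<partial>distr M borel (X i) \<partial>distr M borel (T i))"
    unfolding e[symmetric] using P.nn_integral_snd[of "\<lambda>z. f (c * snd z - fst z)"] by simp
  finally show ?thesis .
qed

lemma step_law_eq: "distr M borel (step i) = step_law"
proof (rule measure_eqI)
  have m: "step i \<in> borel_measurable M" for i by (rule measurable_step)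
  show "sets (distr M borel (step i)) = sets step_law" by (simp add: step_law_def)
  fix A assume "A \<in> sets (distr M borel (step i))"
  then have [measurable]: "A \<in> sets borel" by simp
  have "emeasure (distr M borel (step j)) A
      = (\<integral>\<^sup>+t. \<integral>\<^sup>+x. indicator A (c * t - x) \<partial>distr M borel (X 1) \<partial>distr M borel (T 1))" for j
  proof -
    have "emeasure (distr M borel (step j)) A = (\<integral>\<^sup>+y. indicator A y \<partial>distr M borel (step j))"
      by simp
    also have "\<dots> = (\<integral>\<^sup>+\<omega>. indicator A (c * T (Suc j) \<omega> - X (Suc j) \<omega>) \<partial>M)"
      using m[of j] by (subst nn_integral_distr) (auto simp: step_def)
    also have "\<dots> = (\<integral>\<^sup>+t. \<integral>\<^sup>+x. indicator A (c * t - x) \<partial>distr M borel (X (Suc j)) \<partial>distr M borel (T (Suc j)))"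
      by (rule nn_integral_step) auto
    also have "distr M borel (X (Suc j)) = distr M borel (X 1)" by (rule claims_ident) simp
    also have "distr M borel (T (Suc j)) = distr M borel (T 1)" by (rule waiting_ident) simp
    finally show ?thesis .
  qed
  then show "emeasure (distr M borel (step i)) A = emeasure step_law A" by (simp add: step_law_def)
qed

lemma prob_space_step_law: "prob_space step_law"
  unfolding step_law_def by (rule prob_space_distr) (rule measurable_step)

lemma sets_step_law: "sets step_law = sets borel"
  by (simp add: step_law_def)

text \<open>The step sequence has a product law, and almost surely ruin in continuous time is ruin
  of the walk.\<close>

theorem non_ruin_prob_survival:
  assumes T: "\<And>i. i \<ge> 1 \<Longrightarrow> AE \<omega> in M. T i \<omega> > 0"
  shows "non_ruin_prob u = survival step_law u"
proof (cases "u \<ge> 0")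
  case False
  then show ?thesis
    using survival_neg[OF prob_space_step_law sets_step_law] by (simp add: non_ruin_prob_def)
next
  case u: True
  define P where "P = walk_space step_law"
  have D: "distr M P (\<lambda>\<omega> i. step i \<omega>) = P"
  proof -
    have "distr M (PiM UNIV (\<lambda>_. borel)) (\<lambda>\<omega>. \<lambda>i\<in>UNIV. step i \<omega>) = PiM UNIV (\<lambda>i. distr M borel (step i))"
      using indep_steps indep_vars_iff_distr_eq_PiM[where I=UNIV and X=step and M'="\<lambda>_. borel"] measurable_step by simp
    then have "distr M (PiM UNIV (\<lambda>_. borel)) (\<lambda>\<omega> i. step i \<omega>) = P"
      by (simp add: step_law_eq P_def restrict_UNIV)
    moreover have "sets P = sets (PiM UNIV (\<lambda>_. borel))"
      unfolding P_def by (intro sets_PiM_cong) (simp_all add: sets_step_law)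
    ultimately show ?thesis by (metis distr_cong)
  qed
  have mP: "(\<lambda>\<omega> i. step i \<omega>) \<in> measurable M P"
  proof -
    have "step i \<in> measurable M step_law" for i
      using measurable_step measurable_cong_sets[OF refl sets_step_law] by blast
    then show ?thesis unfolding P_def by (intro measurable_PiM_single') (auto simp: step_law_def)
  qed
  have nb: "never_below u \<in> sets P" unfolding P_def by (rule sets_never_below[OF prob_space_step_law sets_step_law])
  have "survival step_law u = measure (distr M P (\<lambda>\<omega> i. step i \<omega>)) (never_below u)"
    unfolding D by (simp add: survival_def P_def)
  also have "\<dots> = prob ((\<lambda>\<omega> i. step i \<omega>) -` never_below u \<inter> space M)" by (rule measure_distr[OF mP nb])
  also have "\<dots> = prob (space M - {\<omega> \<in> space M. \<exists>t>0. surplus u t \<omega> < 0})"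
  proof (rule measure_eq_AE)
    have "AE \<omega> in M. \<forall>i. i \<ge> 1 \<longrightarrow> T i \<omega> > 0" using T by (auto simp: AE_all_countable)
    then show "AE \<omega> in M. \<omega> \<in> (\<lambda>\<omega> i. step i \<omega>) -` never_below u \<inter> space M
        \<longleftrightarrow> \<omega> \<in> space M - {\<omega> \<in> space M. \<exists>t>0. surplus u t \<omega> < 0}"
    proof eventually_elim
      fix \<omega> assume "\<forall>i. i \<ge> 1 \<longrightarrow> T i \<omega> > 0"
      then have "(\<exists>t>0. surplus u t \<omega> < 0) \<longleftrightarrow> (\<exists>k. u + (\<Sum>i<k. step i \<omega>) < 0)" by (intro ruin_walk[OF u]) simp
      then show "\<omega> \<in> (\<lambda>\<omega> i. step i \<omega>) -` never_below u \<inter> space M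
        \<longleftrightarrow> \<omega> \<in> space M - {\<omega> \<in> space M. \<exists>t>0. surplus u t \<omega> < 0}"
        by (auto simp: never_below_def not_less)
    qed
  qed (use measurable_sets[OF mP nb] sets_ruin[OF u] in auto)
  also have "\<dots> = 1 - prob {\<omega> \<in> space M. \<exists>t>0. surplus u t \<omega> < 0}" by (rule prob_compl[OF sets_ruin[OF u]])
  also have "{\<omega> \<in> space M. \<exists>t>0. surplus u t \<omega> < 0} = {\<omega> \<in> space M. (INF t\<in>{0<..}. ereal (surplus u t \<omega>)) < 0}"
    by (simp add: INF_less_iff Bex_def)
  finally show ?thesis using u by (simp add: non_ruin_prob_def ruin_prob_def)
qed

text \<open>Waiting time outside and claim inside is the order in which the operators strip the
  averages later.\<close>

lemma avg_step_law:
  assumes [measurable]: "f \<in> borel_measurable borel" and b: "\<And>x. 0 \<le> f x" "\<And>x. f x \<le> 1"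
  shows "avg 1 step_law f u = avg c (distr M borel (T 1)) (avg (- 1) (distr M borel (X 1)) f) u"
proof -
  note [measurable] = measurable_claim[of 1, simplified] measurable_waiting[of 1, simplified] measurable_step
  define LX where "LX = distr M borel (X 1)"
  define LT where "LT = distr M borel (T 1)"
  have [measurable_cong]: "sets LX = sets borel" "sets LT = sets borel" by (simp_all add: LX_def LT_def)
  interpret DX: prob_space LX unfolding LX_def by (rule prob_space_distr) simp
  interpret DT: prob_space LT unfolding LT_def by (rule prob_space_distr) simp
  have "ennreal (avg 1 step_law f u) = (\<integral>\<^sup>+\<omega>. ennreal (f (u + step 0 \<omega>)) \<partial>M)"
  proof -
    have "avg 1 step_law f u = (LINT \<omega>|M. f (u + step 0 \<omega>))"
      unfolding avg_def step_law_def by (subst integral_distr) auto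
    then show ?thesis
      by (subst nn_integral_eq_integral) (use b in \<open>auto intro!: integrable_const_bound[of _ 1]\<close>)
  qed
  also have "\<dots> = (\<integral>\<^sup>+t. \<integral>\<^sup>+x. ennreal (f (u + (c * t - x))) \<partial>LX \<partial>LT)"
    unfolding LX_def LT_def using nn_integral_step[of "\<lambda>y. ennreal (f (u + y))" 1] by (simp add: step_def)
  also have "\<dots> = (\<integral>\<^sup>+t. ennreal (avg (- 1) (LX) f (u + c * t)) \<partial>LT)"
  proof (rule nn_integral_cong)
    fix t
    have "(\<integral>\<^sup>+x. ennreal (f (u + (c * t - x))) \<partial>LX) = ennreal (LINT x|LX. f (u + (c * t - x)))"
      by (rule nn_integral_eq_integral) (use b in \<open>auto intro!: DX.integrable_const_bound[of _ 1]\<close>)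
    then show "(\<integral>\<^sup>+x. ennreal (f (u + (c * t - x))) \<partial>LX) = ennreal (avg (- 1) (LX) f (u + c * t))"
      by (simp add: avg_def algebra_simps)
  qed
  also have "\<dots> = ennreal (avg c (LT) (avg (- 1) (LX) f) u)"
  proof -
    have m: "avg (- 1) (LX) f \<in> borel_measurable borel" unfolding avg_def[abs_def] by measurable
    have "0 \<le> avg (- 1) (LX) f v" "avg (- 1) (LX) f v \<le> 1" for v
    proof -
      show "0 \<le> avg (- 1) (LX) f v" unfolding avg_def by (intro integral_nonneg_AE) (simp add: b)
      show "avg (- 1) (LX) f v \<le> 1" unfolding avg_def
        by (rule DX.integral_le_const) (use b in \<open>auto intro!: DX.integrable_const_bound[of _ 1]\<close>)
    qed
    then show ?thesis unfolding avg_def[of c] using m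
      by (subst nn_integral_eq_integral) (auto intro!: DT.integrable_const_bound[of _ 1])
  qed
  finally show ?thesis unfolding LX_def[symmetric] LT_def[symmetric]
    by (subst (asm) ennreal_inj) (auto simp: avg_def intro!: integral_nonneg_AE b)
qed

text \<open>This one number is both the quantity in Lundberg's inequality and the contraction factor
  of the fixed-point iteration.\<close>

lemma nn_integral_exp_step_law:
  "(\<integral>\<^sup>+y. ennreal (exp (- e * y)) \<partial>step_law)
    = (\<integral>\<^sup>+x. ennreal (exp (e * x)) \<partial>distr M borel (X 1)) * (\<integral>\<^sup>+t. ennreal (exp (- e * c * t)) \<partial>distr M borel (T 1))"
proof -
  note [measurable] = measurable_step
  have "(\<integral>\<^sup>+y. ennreal (exp (- e * y)) \<partial>step_law) = (\<integral>\<^sup>+\<omega>. ennreal (exp (- e * (c * T 1 \<omega> - X 1 \<omega>))) \<partial>M)"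
    unfolding step_law_def by (subst nn_integral_distr) (auto simp: step_def)
  also have "\<dots> = (\<integral>\<^sup>+t. \<integral>\<^sup>+x. ennreal (exp (- e * (c * t - x))) \<partial>distr M borel (X 1) \<partial>distr M borel (T 1))"
    by (rule nn_integral_step) auto
  also have "\<dots> = (\<integral>\<^sup>+t. (\<integral>\<^sup>+x. ennreal (exp (e * x)) \<partial>distr M borel (X 1)) * ennreal (exp (- e * c * t)) \<partial>distr M borel (T 1))"
  proof (rule nn_integral_cong)
    fix t
    have "ennreal (exp (- e * (c * t - x))) = ennreal (exp (e * x)) * ennreal (exp (- e * c * t))" for x
      by (simp add: ennreal_mult[symmetric] exp_add[symmetric] algebra_simps)
    then show "(\<integral>\<^sup>+x. ennreal (exp (- e * (c * t - x))) \<partial>distr M borel (X 1)) = (\<integral>\<^sup>+x. ennreal (exp (e * x)) \<partial>distr M borel (X 1)) * ennreal (exp (- e * c * t))"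
      by (simp add: nn_integral_multc)
  qed
  also have "\<dots> = (\<integral>\<^sup>+x. ennreal (exp (e * x)) \<partial>distr M borel (X 1)) * (\<integral>\<^sup>+t. ennreal (exp (- e * c * t)) \<partial>distr M borel (T 1))"
    by (rule nn_integral_cmult) auto
  finally show ?thesis .
qed

end

section \<open>Laws of sums and the fixed point\<close>

definition unit_fun :: "(real \<Rightarrow> real) \<Rightarrow> bool" where
  "unit_fun f \<longleftrightarrow> f \<in> borel_measurable borel \<and> (\<forall>x. 0 \<le> f x \<and> f x \<le> 1)"

definition borel_prob :: "real measure \<Rightarrow> bool" where
  "borel_prob \<nu> \<longleftrightarrow> prob_space \<nu> \<and> sets \<nu> = sets borel"

lemma integrable_unit_fun:
  assumes "borel_prob \<nu>" "unit_fun f" shows "integrable \<nu> (\<lambda>y. f (x + a * y))"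
proof -
  interpret prob_space \<nu> using assms by (simp add: borel_prob_def)
  have [measurable_cong]: "sets \<nu> = sets borel" and [measurable]: "f \<in> borel_measurable borel"
    using assms by (auto simp: borel_prob_def unit_fun_def)
  show ?thesis by (rule integrable_const_bound[of _ 1]) (use assms in \<open>auto simp: unit_fun_def\<close>)
qed

lemma ennreal_avg:
  assumes "borel_prob \<nu>" "unit_fun f"
  shows "ennreal (avg a \<nu> f x) = (\<integral>\<^sup>+y. ennreal (f (x + a * y)) \<partial>\<nu>)"
  unfolding avg_def using assms
  by (intro nn_integral_eq_integral[symmetric] integrable_unit_fun) (auto simp: unit_fun_def)

lemma unit_fun_avg:
  assumes n: "borel_prob \<nu>" and f: "unit_fun f" shows "unit_fun (avg a \<nu> f)"
proof -
  interpret prob_space \<nu> using n by (simp add: borel_prob_def)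
  have [measurable_cong]: "sets \<nu> = sets borel" and [measurable]: "f \<in> borel_measurable borel"
    using n f by (auto simp: borel_prob_def unit_fun_def)
  have "avg a \<nu> f \<in> borel_measurable borel" unfolding avg_def[abs_def] by measurable
  moreover have "0 \<le> avg a \<nu> f x" "avg a \<nu> f x \<le> 1" for x
    using f unfolding avg_def by (auto simp: unit_fun_def intro!: integral_nonneg_AE integral_le_const integrable_unit_fun[OF n f])
  ultimately show ?thesis by (simp add: unit_fun_def)
qed

lemma avg_one_minus:
  assumes n: "borel_prob \<nu>" and f: "unit_fun f"
  shows "avg a \<nu> (\<lambda>x. 1 - f x) x = 1 - avg a \<nu> f x"
proof -
  interpret prob_space \<nu> using n by (simp add: borel_prob_def)
  show ?thesis unfolding avg_def using integrable_unit_fun[OF n f] prob_space by simp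
qed

lemma avg_convolution:
  assumes m: "borel_prob \<mu>" and n: "borel_prob \<nu>" and f: "unit_fun f"
  shows "avg a (\<mu> \<star> \<nu>) f = avg a \<mu> (avg a \<nu> f)"
proof
  fix x
  have fin: "finite_measure \<mu>" "finite_measure \<nu>"
    using m n by (auto simp: borel_prob_def prob_space.finite_measure)
  have [measurable]: "f \<in> borel_measurable borel" using f by (simp add: unit_fun_def)
  have s[measurable_cong]: "sets \<mu> = sets borel" "sets \<nu> = sets borel" using m n by (auto simp: borel_prob_def)
  have "borel_prob (\<mu> \<star> \<nu>)"
  proof -
    interpret M: prob_space \<mu> using m by (simp add: borel_prob_def)
    interpret N: prob_space \<nu> using n by (simp add: borel_prob_def)
    interpret P: pair_prob_space \<mu> \<nu> ..
    have "(\<lambda>(x, y). x + y) \<in> measurable (\<mu> \<Otimes>\<^sub>M \<nu>) (borel :: real measure)"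
      by measurable
    then have "prob_space (\<mu> \<star> \<nu>)" unfolding convolution_def by (rule P.prob_space_distr)
    then show ?thesis by (simp add: borel_prob_def)
  qed
  then have "ennreal (avg a (\<mu> \<star> \<nu>) f x) = (\<integral>\<^sup>+z. ennreal (f (x + a * z)) \<partial>(\<mu> \<star> \<nu>))"
    by (rule ennreal_avg[OF _ f])
  also have "\<dots> = (\<integral>\<^sup>+y. \<integral>\<^sup>+z. ennreal (f (x + a * (y + z))) \<partial>\<nu> \<partial>\<mu>)"
    by (rule nn_integral_convolution[OF fin s(2) s(1)]) simp
  also have "\<dots> = (\<integral>\<^sup>+y. ennreal (avg a \<nu> f (x + a * y)) \<partial>\<mu>)"
    by (simp add: ennreal_avg[OF n f] distrib_left add.assoc)
  also have "\<dots> = ennreal (avg a \<mu> (avg a \<nu> f) x)"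
    by (rule ennreal_avg[OF m unit_fun_avg[OF n f], symmetric])
  finally show "avg a (\<mu> \<star> \<nu>) f x = avg a \<mu> (avg a \<nu> f) x"
    using unit_fun_avg[OF \<open>borel_prob (\<mu> \<star> \<nu>)\<close> f, of a] unit_fun_avg[OF m unit_fun_avg[OF n f], of a a]
    by (subst (asm) ennreal_inj) (auto simp: unit_fun_def)
qed

text \<open>Convolution of laws is composition of averages. Any enumeration \<open>js\<close> will
  do, so the averages can be arranged in whatever order the operators require.\<close>

lemma avg_law_of_sum:
  fixes V :: "'i \<Rightarrow> 'b \<Rightarrow> real"
  assumes N: "prob_space N" and ind: "prob_space.indep_vars N (\<lambda>_. borel) V (set js)" and dist: "distinct js"
    and f: "unit_fun f"
  shows "avg a (distr N borel (\<lambda>\<omega>. \<Sum>j\<in>set js. V j \<omega>)) f = foldr (\<lambda>j. avg a (distr N borel (V j))) js f"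
  using ind dist
proof (induction js)
  case Nil
  interpret prob_space N by fact
  have [measurable]: "f \<in> borel_measurable borel" using f by (simp add: unit_fun_def)
  show ?case by (simp add: fun_eq_iff avg_def integral_return)
next
  case (Cons j js)
  interpret prob_space N by fact
  have iv: "indep_var borel (V j) borel (\<lambda>\<omega>. \<Sum>j\<in>set js. V j \<omega>)"
    by (rule indep_vars_sum) (use Cons.prems in auto)
  note rv = indep_var_rv1[OF iv] indep_var_rv2[OF iv]
  have bp: "borel_prob (distr N borel Z)" if "random_variable borel Z" for Z
    using prob_space_distr[OF that] by (simp add: borel_prob_def)
  have "distr N borel (\<lambda>\<omega>. \<Sum>j\<in>set (j # js). V j \<omega>) = (distr N borel (V j) \<star> distr N borel (\<lambda>\<omega>. \<Sum>j\<in>set js. V j \<omega>))"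
    using sum_indep_random_variable[OF iv rv] Cons.prems by simp
  then have "avg a (distr N borel (\<lambda>\<omega>. \<Sum>j\<in>set (j # js). V j \<omega>)) f
      = avg a (distr N borel (V j)) (avg a (distr N borel (\<lambda>\<omega>. \<Sum>j\<in>set js. V j \<omega>)) f)"
    using avg_convolution[OF bp[OF rv(1)] bp[OF rv(2)] f] by simp
  moreover have "indep_vars (\<lambda>_. borel) V (set js)" by (rule indep_vars_subset[OF Cons.prems(1)]) auto
  ultimately show ?case using Cons by simp
qed

section \<open>Exponential moments under the net profit condition\<close>

lemma exp_le_quadratic:
  assumes "0 \<le> y" shows "exp y \<le> 1 + y + y\<^sup>2 / 2 * exp (y::real)"
proof -
  obtain t where t: "\<bar>t\<bar> \<le> \<bar>y\<bar>" "exp y = (\<Sum>m<2. y ^ m / fact m) + exp t / fact 2 * y ^ 2"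
    using Maclaurin_exp_le[of y 2] by blast
  have "exp t \<le> exp y" using t(1) assms by simp
  then have "exp t / 2 * y\<^sup>2 \<le> exp y / 2 * y\<^sup>2" by (intro mult_right_mono) auto
  then show ?thesis using t(2) by (simp add: numeral_2_eq_2 mult_ac)
qed

lemma exp_minus_le_quadratic:
  assumes "0 \<le> y" shows "exp (- y) \<le> 1 - y + y\<^sup>2 / 2 * exp (y::real)"
proof -
  obtain t where t: "\<bar>t\<bar> \<le> \<bar>- y\<bar>" "exp (- y) = (\<Sum>m<2. (- y) ^ m / fact m) + exp t / fact 2 * (- y) ^ 2"
    using Maclaurin_exp_le[of "- y" 2] by blast
  have "exp t \<le> exp y" using t(1) assms by simp
  then have "exp t / 2 * y\<^sup>2 \<le> exp y / 2 * y\<^sup>2" by (intro mult_right_mono) auto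
  then show ?thesis using t(2) by (simp add: numeral_2_eq_2 mult_ac)
qed

text \<open>\<open>e \<le> a / 2\<close> leaves a factor \<open>exp (a / 2 * x)\<close> to absorb
  \<open>x\<^sup>2\<close>, so the constant \<open>P\<close> of the remainder does not depend on
  \<open>e\<close>.\<close>

lemma exponential_moment_upper:
  assumes chi: "borel_prob \<xi>" and posX: "AE x in \<xi>. x > 0" and a: "a > 0"
    and mom: "integrable \<xi> (\<lambda>x. exp (a * x))"
  shows "integrable \<xi> (\<lambda>x. x)"
    and "\<exists>P\<ge>0. \<forall>e. 0 \<le> e \<and> e \<le> a / 2 \<longrightarrow> integrable \<xi> (\<lambda>x. exp (e * x)) \<and>
      (LINT x|\<xi>. exp (e * x)) \<le> 1 + e * (LINT x|\<xi>. x) + e\<^sup>2 * P"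
proof -
  interpret prob_space \<xi> using chi by (simp add: borel_prob_def)
  have [measurable_cong]: "sets \<xi> = sets borel" using chi by (simp add: borel_prob_def)
  show ix: "integrable \<xi> (\<lambda>x. x)"
  proof (rule Bochner_Integration.integrable_bound)
    show "integrable \<xi> (\<lambda>x. exp (a * x) / a)" using mom by simp
    show "AE x in \<xi>. norm x \<le> norm (exp (a * x) / a)"
      using posX
    proof eventually_elim
      fix x :: real assume "x > 0"
      have "a * x \<le> exp (a * x)" using exp_ge_add_one_self[of "a * x"] by linarith
      then show "norm x \<le> norm (exp (a * x) / a)" using \<open>x > 0\<close> a by (simp add: field_simps)
    qed
  qed simp
  define P where "P = (LINT x|\<xi>. 4 / a\<^sup>2 * exp (a * x))"
  show "\<exists>P\<ge>0. \<forall>e. 0 \<le> e \<and> e \<le> a / 2 \<longrightarrow> integrable \<xi> (\<lambda>x. exp (e * x)) \<and>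
      (LINT x|\<xi>. exp (e * x)) \<le> 1 + e * (LINT x|\<xi>. x) + e\<^sup>2 * P"
  proof (intro exI[of _ P] conjI allI impI)
    show "P \<ge> 0" unfolding P_def by (rule Bochner_Integration.integral_nonneg) simp
    fix e assume e: "0 \<le> e \<and> e \<le> a / 2"
    show ie: "integrable \<xi> (\<lambda>x. exp (e * x))"
    proof (rule Bochner_Integration.integrable_bound[OF mom])
      show "AE x in \<xi>. norm (exp (e * x)) \<le> norm (exp (a * x))"
        using posX by eventually_elim (use e a in \<open>auto intro!: mult_right_mono\<close>)
    qed simp
    have "(LINT x|\<xi>. exp (e * x)) \<le> (LINT x|\<xi>. 1 + e * x + e\<^sup>2 * (4 / a\<^sup>2 * exp (a * x)))"
    proof (rule integral_mono_AE[OF ie])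
      show "integrable \<xi> (\<lambda>x. 1 + e * x + e\<^sup>2 * (4 / a\<^sup>2 * exp (a * x)))" using ix mom by simp
      show "AE x in \<xi>. exp (e * x) \<le> 1 + e * x + e\<^sup>2 * (4 / a\<^sup>2 * exp (a * x))"
        using posX
      proof eventually_elim
        fix x :: real assume x: "x > 0"
        have p: "0 \<le> a / 2 * x" using a x by simp
        have "(a / 2 * x)\<^sup>2 / 2 \<le> exp (a / 2 * x)"
          using exp_lower_Taylor_quadratic[OF p] p by linarith
        then have 1: "x\<^sup>2 / 2 \<le> 4 / a\<^sup>2 * exp (a / 2 * x)" using a by (simp add: power_mult_distrib field_simps)
        have "e * x \<le> a / 2 * x" using e x by (intro mult_right_mono) auto
        then have 2: "exp (e * x) \<le> exp (a / 2 * x)" by simp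
        have "x\<^sup>2 / 2 * exp (e * x) \<le> 4 / a\<^sup>2 * exp (a / 2 * x) * exp (a / 2 * x)"
          using 1 2 by (intro mult_mono) auto
        also have "\<dots> = 4 / a\<^sup>2 * exp (a * x)" by (simp add: exp_add[symmetric])
        finally have "e\<^sup>2 * (x\<^sup>2 / 2 * exp (e * x)) \<le> e\<^sup>2 * (4 / a\<^sup>2 * exp (a * x))" by (rule mult_left_mono) simp
        moreover have "exp (e * x) \<le> 1 + e * x + (e * x)\<^sup>2 / 2 * exp (e * x)"
          using e x by (intro exp_le_quadratic) auto
        moreover have "(e * x)\<^sup>2 / 2 * exp (e * x) = e\<^sup>2 * (x\<^sup>2 / 2 * exp (e * x))"
          by (simp add: power_mult_distrib)
        ultimately show "exp (e * x) \<le> 1 + e * x + e\<^sup>2 * (4 / a\<^sup>2 * exp (a * x))" by linarith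
      qed
    qed
    also have "\<dots> = 1 + e * (LINT x|\<xi>. x) + e\<^sup>2 * P" using ix mom prob_space by (simp add: P_def)
    finally show "(LINT x|\<xi>. exp (e * x)) \<le> 1 + e * (LINT x|\<xi>. x) + e\<^sup>2 * P" .
  qed
qed

text \<open>The mean of \<open>\<tau>\<close> may be infinite, so it is truncated before expanding to second order.\<close>

lemma exponential_moment_lower:
  assumes tau: "borel_prob \<tau>" and posT: "AE t in \<tau>. t > 0" and c: "c > 0"
    and mean: "ennreal m < ennreal c * (\<integral>\<^sup>+t. ennreal t \<partial>\<tau>)"
  shows "\<exists>b>m. \<exists>Q\<ge>0. \<forall>e. 0 \<le> e \<and> e \<le> 1 \<longrightarrow> (LINT t|\<tau>. exp (- e * c * t)) \<le> 1 - e * b + e\<^sup>2 * Q"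
proof -
  interpret prob_space \<tau> using tau by (simp add: borel_prob_def)
  have [measurable_cong]: "sets \<tau> = sets borel" using tau by (simp add: borel_prob_def)
  have tr: "(SUP K::nat. min (ennreal t) (ennreal (real K))) = ennreal t" for t :: real
  proof (rule antisym)
    obtain K :: nat where "t \<le> real K" using real_arch_simple by blast
    then have "ennreal t \<le> min (ennreal t) (ennreal (real K))" by (simp add: ennreal_leI)
    also have "\<dots> \<le> (SUP K::nat. min (ennreal t) (ennreal (real K)))" by (rule SUP_upper) simp
    finally show "ennreal t \<le> (SUP K::nat. min (ennreal t) (ennreal (real K)))" .
  qed (auto intro!: SUP_least)
  have inc: "incseq (\<lambda>(K::nat) t. min (ennreal t) (ennreal (real K)))"
    by (intro incseq_SucI le_funI min.mono) (auto intro!: ennreal_leI)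
  have "(\<integral>\<^sup>+t. ennreal t \<partial>\<tau>) = (\<integral>\<^sup>+t. (SUP K::nat. min (ennreal t) (ennreal (real K))) \<partial>\<tau>)"
    by (simp add: tr)
  also have "\<dots> = (SUP K::nat. \<integral>\<^sup>+t. min (ennreal t) (ennreal (real K)) \<partial>\<tau>)"
    by (rule nn_integral_monotone_convergence_SUP[OF inc]) simp
  finally have "ennreal m < (SUP K::nat. ennreal c * (\<integral>\<^sup>+t. min (ennreal t) (ennreal (real K)) \<partial>\<tau>))"
    using mean by (simp add: SUP_mult_left_ennreal)
  then obtain K :: nat where K: "ennreal m < ennreal c * (\<integral>\<^sup>+t. min (ennreal t) (ennreal (real K)) \<partial>\<tau>)"
    unfolding less_SUP_iff by blast
  define k where "k = real K"
  define b where "b = c * (LINT t|\<tau>. min t k)"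
  have ik: "integrable \<tau> (\<lambda>t. min t k)"
    by (rule integrable_const_bound[of _ k]) (use posT in \<open>auto simp: k_def elim!: eventually_mono\<close>)
  have nn: "(\<integral>\<^sup>+t. min (ennreal t) (ennreal (real K)) \<partial>\<tau>) = ennreal (LINT t|\<tau>. min t k)"
  proof -
    have "(\<integral>\<^sup>+t. min (ennreal t) (ennreal (real K)) \<partial>\<tau>) = (\<integral>\<^sup>+t. ennreal (min t k) \<partial>\<tau>)"
      by (rule nn_integral_cong_AE, use posT in eventually_elim) (auto simp: k_def min_def)
    also have "\<dots> = ennreal (LINT t|\<tau>. min t k)"
      by (rule nn_integral_eq_integral[OF ik]) (use posT in \<open>auto simp: k_def elim!: eventually_mono\<close>)
    finally show ?thesis .
  qed
  have "ennreal m < ennreal b" using K c unfolding nn b_def by (simp add: ennreal_mult')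
  then have mb: "m < b" by (metis ennreal_leI linorder_not_less)
  define Q where "Q = (c * k)\<^sup>2 / 2 * exp (c * k)"
  have "(LINT t|\<tau>. exp (- e * c * t)) \<le> 1 - e * b + e\<^sup>2 * Q" if e: "0 \<le> e \<and> e \<le> 1" for e
  proof -
    have ie: "integrable \<tau> (\<lambda>t. exp (- e * c * t))"
      by (rule integrable_const_bound[of _ 1]) (use posT e c in \<open>auto elim!: eventually_mono\<close>)
    have "(LINT t|\<tau>. exp (- e * c * t)) \<le> (LINT t|\<tau>. 1 - e * c * min t k + e\<^sup>2 * Q)"
    proof (rule integral_mono_AE[OF ie])
      show "integrable \<tau> (\<lambda>t. 1 - e * c * min t k + e\<^sup>2 * Q)" using ik by simp
      show "AE t in \<tau>. exp (- e * c * t) \<le> 1 - e * c * min t k + e\<^sup>2 * Q" using posT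
      proof eventually_elim
        fix t :: real assume t: "t > 0"
        define y where "y = e * c * min t k"
        have k0: "k \<ge> 0" by (simp add: k_def)
        have y0: "y \<ge> 0" using e c t k0 by (simp add: y_def)
        have "e * c * min t k \<le> e * c * k" using e c by (intro mult_left_mono) auto
        then have y1: "y \<le> e * (c * k)" by (simp add: y_def mult.assoc)
        also have "\<dots> \<le> 1 * (c * k)" using e c k0 by (intro mult_right_mono) auto
        finally have y2: "y \<le> c * k" by simp
        have "exp (- e * c * t) \<le> exp (- y)" unfolding y_def using e c by (simp add: mult_left_mono)
        also have "\<dots> \<le> 1 - y + y\<^sup>2 / 2 * exp y" by (rule exp_minus_le_quadratic[OF y0])
        also have "y\<^sup>2 / 2 * exp y \<le> (e * (c * k))\<^sup>2 / 2 * exp (c * k)"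
          using y0 y1 y2 by (intro mult_mono divide_right_mono power_mono) auto
        also have "\<dots> = e\<^sup>2 * Q" by (simp add: Q_def power_mult_distrib)
        finally show "exp (- e * c * t) \<le> 1 - e * c * min t k + e\<^sup>2 * Q" by (simp add: y_def)
      qed
    qed
    also have "\<dots> = 1 - e * b + e\<^sup>2 * Q" using ik prob_space by (simp add: b_def)
    finally show ?thesis .
  qed
  moreover have "Q \<ge> 0" by (simp add: Q_def)
  ultimately show ?thesis using mb by blast
qed

text \<open>The product of the two second-order bounds is \<open>1 + e * (m - b + O(e))\<close>,
  where \<open>m\<close> is the mean claim and \<open>b > m\<close> the mean premium income over a
  truncated waiting time; it drops below 1 for small \<open>e\<close>.\<close>

lemma exponential_moment_less_one:
  assumes chi: "borel_prob \<xi>" and posX: "AE x in \<xi>. x > 0" and a: "a > 0"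
    and mom: "integrable \<xi> (\<lambda>x. exp (a * x))"
    and tau: "borel_prob \<tau>" and posT: "AE t in \<tau>. t > 0" and c: "c > 0"
    and mean: "(\<integral>\<^sup>+x. ennreal x \<partial>\<xi>) < ennreal c * (\<integral>\<^sup>+t. ennreal t \<partial>\<tau>)"
  shows "\<exists>e. 0 < e \<and> e < a \<and> (LINT x|\<xi>. exp (e * x)) * (LINT t|\<tau>. exp (- e * c * t)) < 1"
proof -
  note U = exponential_moment_upper[OF chi posX a mom]
  define m where "m = (LINT x|\<xi>. x)"
  have "(\<integral>\<^sup>+x. ennreal x \<partial>\<xi>) = ennreal m"
    unfolding m_def by (rule nn_integral_eq_integral[OF U(1)]) (use posX in \<open>auto elim!: eventually_mono\<close>)
  then obtain b Q where b: "b > m" and Q: "Q \<ge> 0"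
    "\<And>e. 0 \<le> e \<Longrightarrow> e \<le> 1 \<Longrightarrow> (LINT t|\<tau>. exp (- e * c * t)) \<le> 1 - e * b + e\<^sup>2 * Q"
    using exponential_moment_lower[OF tau posT c, of m] mean by auto
  obtain P where P: "P \<ge> 0"
    "\<And>e. 0 \<le> e \<Longrightarrow> e \<le> a / 2 \<Longrightarrow> (LINT x|\<xi>. exp (e * x)) \<le> 1 + e * m + e\<^sup>2 * P"
    using U(2) unfolding m_def by blast
  have "((\<lambda>e::real. (m - b) + e * (P + Q - m * b) + e\<^sup>2 * (m * Q - b * P) + e ^ 3 * (P * Q)) \<longlongrightarrow>
      (m - b) + 0 * (P + Q - m * b) + 0\<^sup>2 * (m * Q - b * P) + 0 ^ 3 * (P * Q)) (at_right 0)"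
    by (intro tendsto_intros)
  then have "eventually (\<lambda>e::real. (m - b) + e * (P + Q - m * b) + e\<^sup>2 * (m * Q - b * P) + e ^ 3 * (P * Q) < 0) (at_right 0)"
    using b by (intro order_tendstoD(2)) auto
  moreover have "eventually (\<lambda>e::real. e < min 1 (a / 2)) (at_right 0)"
    using a by (intro order_tendstoD(2)[OF tendsto_ident_at]) auto
  ultimately have "eventually (\<lambda>e::real. 0 < e \<and> e < min 1 (a / 2) \<and>
      (m - b) + e * (P + Q - m * b) + e\<^sup>2 * (m * Q - b * P) + e ^ 3 * (P * Q) < 0) (at_right 0)"
    using eventually_at_right_less[of "0::real"] by eventually_elim auto
  then obtain e :: real where e: "0 < e" "e < min 1 (a / 2)"
    "(m - b) + e * (P + Q - m * b) + e\<^sup>2 * (m * Q - b * P) + e ^ 3 * (P * Q) < 0"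
    using eventually_happens[of _ "at_right (0::real)"] by (auto simp: trivial_limit_at_right_real)
  have x0: "0 \<le> (LINT x|\<xi>. exp (e * x))" "0 \<le> (LINT t|\<tau>. exp (- e * c * t))"
    by (auto intro!: Bochner_Integration.integral_nonneg)
  have xP: "(LINT x|\<xi>. exp (e * x)) \<le> 1 + e * m + e\<^sup>2 * P" using P(2)[of e] e by simp
  have "(LINT x|\<xi>. exp (e * x)) * (LINT t|\<tau>. exp (- e * c * t)) \<le> (1 + e * m + e\<^sup>2 * P) * (1 - e * b + e\<^sup>2 * Q)"
    using xP Q(2)[of e] e x0 order_trans[OF x0(1) xP] by (intro mult_mono) auto
  also have "\<dots> = 1 + e * ((m - b) + e * (P + Q - m * b) + e\<^sup>2 * (m * Q - b * P) + e ^ 3 * (P * Q))"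
    by (simp add: algebra_simps power2_eq_square power3_eq_cube)
  also have "\<dots> < 1" using mult_pos_neg[OF e(1) e(3)] by simp
  finally show ?thesis using e a by (intro exI[of _ e]) auto
qed

lemma sectorial_cong:
  assumes "\<And>x. x > 0 \<Longrightarrow> f x = g x" shows "sectorial \<kappa> lam B f \<longleftrightarrow> sectorial \<kappa> lam B g"
  unfolding sectorial_def using assms by auto

text \<open>The iterates extend analytically to a fixed sector with a common bound and converge
  on the half-line, so by Montel's theorem the limit extends as well.\<close>

lemma sectorial_fixed_point:
  assumes nu: "borel_prob \<nu>" and psi: "unit_fun \<psi>" and neg: "\<And>x. x < 0 \<Longrightarrow> \<psi> x = 1"
    and dec: "\<And>x. \<psi> x \<le> exp (- e * x)" and fix': "\<And>u. u \<ge> 0 \<Longrightarrow> \<psi> u = avg 1 \<nu> \<psi> u"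
    and int: "integrable \<nu> (\<lambda>x. exp (- e * x))" and rho: "(LINT x|\<nu>. exp (- e * x)) < 1"
    and e: "e \<ge> 0" and kap: "\<kappa> > 1"
    and sect: "\<And>f. unit_fun f \<Longrightarrow> (\<And>x. x < 0 \<Longrightarrow> f x = 1) \<Longrightarrow> sectorial \<kappa> e 1 f \<Longrightarrow> sectorial \<kappa> e 1 (avg 1 \<nu> f)"
  shows "sectorial \<kappa> e 1 \<psi>"
proof -
  have [measurable_cong]: "sets \<nu> = sets borel" using nu by (simp add: borel_prob_def)
  define \<rho> where "\<rho> = (LINT x|\<nu>. exp (- e * x))"
  have r0: "\<rho> \<ge> 0" unfolding \<rho>_def by (rule Bochner_Integration.integral_nonneg) simp
  \<comment> \<open>Started from 0 on the half-line, the iteration has \<psi> itself as its first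
    error, which \<open>dec\<close> bounds in the weight \<open>exp (- e * x)\<close>; every step
    contracts this error by \<rho>. The value 1 for negative capital is restored at each
    step.\<close>
  define F where "F = rec_nat (\<lambda>x::real. if x < 0 then 1 else 0) (\<lambda>_ f x. if x < 0 then 1 else avg 1 \<nu> f x)"
  have F0: "F 0 = (\<lambda>x. if x < 0 then 1 else 0)" and FS: "F (Suc n) = (\<lambda>x. if x < 0 then 1 else avg 1 \<nu> (F n) x)" for n
    unfolding F_def by simp_all
  have F: "unit_fun (F n) \<and> (\<forall>x<0. F n x = 1) \<and> sectorial \<kappa> e 1 (F n) \<and> (\<forall>x. \<bar>\<psi> x - F n x\<bar> \<le> \<rho> ^ n * exp (- e * x))" for n
  proof (induction n)
    case 0
    have "sectorial \<kappa> e 1 (F 0)" unfolding sectorial_def by (rule exI[of _ "\<lambda>_. 0"]) (auto simp: F0)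
    moreover have "\<bar>\<psi> x - F 0 x\<bar> \<le> exp (- e * x)" for x
      using dec[of x] neg[of x] psi by (auto simp: F0 unit_fun_def)
    ultimately show ?case by (auto simp: F0 unit_fun_def)
  next
    case (Suc n)
    then have IH: "unit_fun (F n)" "\<And>x. x < 0 \<Longrightarrow> F n x = 1" "sectorial \<kappa> e 1 (F n)"
      "\<And>x. \<bar>\<psi> x - F n x\<bar> \<le> \<rho> ^ n * exp (- e * x)" by blast+
    have uA: "unit_fun (avg 1 \<nu> (F n))" by (rule unit_fun_avg[OF nu IH(1)])
    then have [measurable]: "avg 1 \<nu> (F n) \<in> borel_measurable borel" by (simp add: unit_fun_def)
    have "F (Suc n) \<in> borel_measurable borel" unfolding FS by measurable
    then have "unit_fun (F (Suc n))" using uA by (auto simp: FS unit_fun_def)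
    moreover have "sectorial \<kappa> e 1 (F (Suc n))"
    proof -
      have "F (Suc n) x = avg 1 \<nu> (F n) x" if "x > 0" for x using that by (simp add: FS)
      then have "sectorial \<kappa> e 1 (F (Suc n)) = sectorial \<kappa> e 1 (avg 1 \<nu> (F n))" by (rule sectorial_cong)
      then show ?thesis using sect[OF IH(1) IH(2) IH(3)] by simp
    qed
    moreover have "\<bar>\<psi> x - F (Suc n) x\<bar> \<le> \<rho> ^ Suc n * exp (- e * x)" for x
    proof (cases "x < 0")
      case True then show ?thesis using neg r0 by (simp add: FS)
    next
      case False
      have i1: "integrable \<nu> (\<lambda>y. \<psi> (x + y))" and i2: "integrable \<nu> (\<lambda>y. F n (x + y))"
        using integrable_unit_fun[OF nu psi, of x 1] integrable_unit_fun[OF nu IH(1), of x 1] by simp_all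
      have "\<psi> x - F (Suc n) x = avg 1 \<nu> \<psi> x - avg 1 \<nu> (F n) x" using fix'[of x] False by (simp add: FS)
      also have "\<dots> = (LINT y|\<nu>. \<psi> (x + y) - F n (x + y))" using i1 i2 by (simp add: avg_def)
      finally have "\<bar>\<psi> x - F (Suc n) x\<bar> = norm (LINT y|\<nu>. \<psi> (x + y) - F n (x + y))" by simp
      also have "\<dots> \<le> (LINT y|\<nu>. \<rho> ^ n * exp (- e * x) * exp (- e * y))"
      proof (rule Bochner_Integration.integral_norm_bound_integral)
        show "norm (\<psi> (x + y) - F n (x + y)) \<le> \<rho> ^ n * exp (- e * x) * exp (- e * y)" for y
        proof -
          have "\<bar>\<psi> (x + y) - F n (x + y)\<bar> \<le> \<rho> ^ n * exp (- e * (x + y))" by (rule IH(4))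
          then show ?thesis by (simp add: distrib_left exp_add[symmetric] mult.assoc)
        qed
      qed (use i1 i2 int in auto)
      also have "\<dots> = \<rho> ^ n * exp (- e * x) * \<rho>" by (simp add: \<rho>_def)
      finally show ?thesis by (simp add: mult_ac)
    qed
    moreover have "\<forall>x<0. F (Suc n) x = 1" by (simp add: FS)
    ultimately show ?case by blast
  qed
  have lim: "(\<lambda>n. F n x) \<longlonglongrightarrow> \<psi> x" for x
  proof -
    have "(\<lambda>n. \<rho> ^ n * exp (- e * x)) \<longlonglongrightarrow> 0 * exp (- e * x)"
      using r0 rho by (intro tendsto_mult LIMSEQ_power_zero tendsto_const) (auto simp: \<rho>_def)
    then have "(\<lambda>n. \<psi> x - F n x) \<longlonglongrightarrow> 0"
    proof (intro Lim_null_comparison[of "\<lambda>n. \<psi> x - F n x" "\<lambda>n. \<rho> ^ n * exp (- e * x)"])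
      have "norm (\<psi> x - F n x) \<le> \<rho> ^ n * exp (- e * x)" for n using F[of n] unfolding real_norm_def by blast
      then show "eventually (\<lambda>n. norm (\<psi> x - F n x) \<le> \<rho> ^ n * exp (- e * x)) sequentially"
        by (rule always_eventually[OF allI])
      show "(\<lambda>n. \<rho> ^ n * exp (- e * x)) \<longlonglongrightarrow> 0"
        using \<open>(\<lambda>n. \<rho> ^ n * exp (- e * x)) \<longlonglongrightarrow> 0 * exp (- e * x)\<close> by simp
    qed
    from tendsto_diff[OF tendsto_const[of "\<psi> x"] this] show ?thesis by simp
  qed
  have "sectorial \<kappa> e 1 (F n)" for n using F[of n] by blast
  then show ?thesis by (rule sectorial_limit[where f=F, OF _ lim kap e])
qed

section \<open>Applying the operators\<close>

lemma unit_fun_foldr_avg: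
  "(\<And>j. j \<in> set js \<Longrightarrow> borel_prob (L j)) \<Longrightarrow> unit_fun f \<Longrightarrow> unit_fun (foldr (\<lambda>j. avg a (L j)) js f)"
  by (induction js) (auto intro: unit_fun_avg)

text \<open>Right shifts never worsen an exponentially weighted bound, so \<open>B\<close> is
  kept.\<close>

lemma sectorial_foldr_avg:
  assumes f: "unit_fun f" "sectorial \<kappa> e B f" and k: "\<kappa> > 1" and e: "e \<ge> 0" and B: "B \<ge> 0" and c: "c > 0"
    and L: "\<And>j. j \<in> set js \<Longrightarrow> borel_prob (L j) \<and> (AE y in L j. y > 0)"
  shows "sectorial \<kappa> e B (foldr (\<lambda>j. avg c (L j)) js f)"
  using L
proof (induction js)
  case (Cons j js)
  define g where "g = foldr (\<lambda>j. avg c (L j)) js f"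
  have g: "unit_fun g" "sectorial \<kappa> e B g"
    using Cons unit_fun_foldr_avg[of js L f c] f by (auto simp: g_def)
  have Lj: "prob_space (L j)" "sets (L j) = sets borel" "AE y in L j. y > 0"
    using Cons.prems[of j] by (auto simp: borel_prob_def)
  interpret prob_space "L j" by fact
  have [measurable]: "(\<lambda>y. exp (- e * c * y)) \<in> borel_measurable (L j)"
    using Lj(2) by (simp cong: measurable_cong_sets)
  have le: "AE y in L j. norm (exp (- e * c * y)) \<le> 1"
    using Lj(3) by eventually_elim (use e c in simp)
  have i: "integrable (L j) (\<lambda>y. exp (- e * c * y))" by (rule integrable_const_bound[OF le]) measurable
  have "(LINT y|L j. exp (- e * c * y)) \<le> 1"
    by (rule integral_le_const[OF i]) (use le in simp)
  then have "B * (LINT y|L j. exp (- e * c * y)) \<le> B" using B mult_left_le by blast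
  moreover have "0 \<le> B * (LINT y|L j. exp (- e * c * y))"
    using B by (intro mult_nonneg_nonneg Bochner_Integration.integral_nonneg) auto
  moreover have "sectorial \<kappa> e (B * (LINT y|L j. exp (- e * c * y))) (avg c (L j) g)"
    by (rule sectorial_avg[OF g(2) k e B c Lj]) (use g(1) in \<open>simp add: unit_fun_def\<close>)
  ultimately have "sectorial \<kappa> e B (avg c (L j) g)" by (intro sectorial_mono[of \<kappa> e _ _ B e]) (use k in auto)
  then show ?case by (simp add: g_def)
qed (simp add: f)

lemma borel_prob_gamma_law: "s > 0 \<Longrightarrow> \<alpha> > 0 \<Longrightarrow> borel_prob (gamma_law s \<alpha>)"
  by (simp add: borel_prob_def prob_space_gamma_law)

lemma avg_gamma_neg:
  assumes f: "unit_fun f" and neg: "\<And>x. x < 0 \<Longrightarrow> f x = 1" and s: "s > 0" "\<alpha> > 0" and x: "x < 0"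
  shows "avg (- 1) (gamma_law s \<alpha>) f x = 1"
proof -
  interpret prob_space "gamma_law s \<alpha>" by (rule prob_space_gamma_law[OF s])
  have [measurable]: "f \<in> borel_measurable borel" using f by (simp add: unit_fun_def)
  have "avg (- 1) (gamma_law s \<alpha>) f x = (LINT y|gamma_law s \<alpha>. 1)"
    unfolding avg_def
    by (rule integral_cong_AE) (use AE_gamma_law_pos[of s \<alpha>] neg x in \<open>auto elim!: eventually_mono\<close>)
  then show ?thesis using prob_space by simp
qed

abbreviation gamma_avgs :: "(nat \<Rightarrow> real) \<Rightarrow> (nat \<Rightarrow> real) \<Rightarrow> nat list \<Rightarrow> (real \<Rightarrow> real) \<Rightarrow> real \<Rightarrow> real" where
  "gamma_avgs s \<alpha> ks f \<equiv> foldr (\<lambda>k. avg (- 1) (gamma_law (s k) (\<alpha> k))) ks f"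

lemma gamma_avgs_props:
  assumes f: "unit_fun f" and neg: "\<And>x. x < 0 \<Longrightarrow> f x = 1"
    and p: "\<And>k. k \<in> set ks \<Longrightarrow> s k > 0 \<and> \<alpha> k > 0"
  shows "unit_fun (gamma_avgs s \<alpha> ks f)" and "\<And>x. x < 0 \<Longrightarrow> gamma_avgs s \<alpha> ks f x = 1"
proof -
  have "unit_fun (gamma_avgs s \<alpha> ks f) \<and> (\<forall>x<0. gamma_avgs s \<alpha> ks f x = 1)"
    using p
  proof (induction ks)
    case (Cons k ks)
    define g where "g = gamma_avgs s \<alpha> ks f"
    have g: "unit_fun g" "\<And>x. x < 0 \<Longrightarrow> g x = 1" using Cons by (auto simp: g_def)
    have "s k > 0" "\<alpha> k > 0" using Cons.prems[of k] by auto
    then show ?case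
      using unit_fun_avg[OF borel_prob_gamma_law g(1)] avg_gamma_neg[OF g] by (simp add: g_def)
  qed (use f neg in auto)
  then show "unit_fun (gamma_avgs s \<alpha> ks f)" "\<And>x. x < 0 \<Longrightarrow> gamma_avgs s \<alpha> ks f x = 1" by auto
qed

text \<open>The bound \<open>\<ge> 1\<close> is carried along because
  \<open>sectorial_avg_gamma\<close> needs it to cover the constant 1 on the negative
  half-line.\<close>

lemma sectorial_gamma_avgs:
  assumes f: "unit_fun f" and neg: "\<And>x. x < 0 \<Longrightarrow> f x = 1" and sf: "sectorial \<kappa> e 1 f"
    and k: "\<kappa> > 1" and e: "0 \<le> e"
    and p: "\<And>k. k \<in> set ks \<Longrightarrow> s k > 0 \<and> \<alpha> k > 0 \<and> e < \<alpha> k" and dist: "distinct ks"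
  shows "(\<Prod>k\<in>set ks. (\<kappa> * \<alpha> k / (\<alpha> k - e)) powr s k) \<ge> 1 \<and>
    sectorial \<kappa> e (\<Prod>k\<in>set ks. (\<kappa> * \<alpha> k / (\<alpha> k - e)) powr s k) (gamma_avgs s \<alpha> ks f)"
  using p dist
proof (induction ks)
  case (Cons i ks)
  define B where "B = (\<Prod>k\<in>set ks. (\<kappa> * \<alpha> k / (\<alpha> k - e)) powr s k)"
  define g where "g = gamma_avgs s \<alpha> ks f"
  have IH: "B \<ge> 1" "sectorial \<kappa> e B g" using Cons by (auto simp: B_def g_def)
  have g: "unit_fun g" "\<And>x. x < 0 \<Longrightarrow> g x = 1"
    using gamma_avgs_props[of f ks s \<alpha>] f neg Cons.prems(1) by (auto simp: g_def)
  have i: "s i > 0" "\<alpha> i > 0" "e < \<alpha> i" using Cons.prems(1)[of i] by auto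
  have "\<alpha> i - e \<le> \<kappa> * \<alpha> i" using mult_right_mono[of 1 \<kappa> "\<alpha> i"] k i e by linarith
  then have "1 \<le> \<kappa> * \<alpha> i / (\<alpha> i - e)" using i e by (simp add: le_divide_eq)
  then have A: "1 \<le> (\<kappa> * \<alpha> i / (\<alpha> i - e)) powr s i" using i by (intro ge_one_powr_ge_zero) auto
  have "(\<Prod>k\<in>set (i # ks). (\<kappa> * \<alpha> k / (\<alpha> k - e)) powr s k) = B * (\<kappa> * \<alpha> i / (\<alpha> i - e)) powr s i"
    using Cons.prems(2) by (simp add: B_def mult.commute)
  moreover have "B * (\<kappa> * \<alpha> i / (\<alpha> i - e)) powr s i \<ge> 1" using mult_mono[OF IH(1) A] IH(1) by simp
  moreover have "sectorial \<kappa> e (B * (\<kappa> * \<alpha> i / (\<alpha> i - e)) powr s i) (avg (- 1) (gamma_law (s i) (\<alpha> i)) g)"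
    by (rule sectorial_avg_gamma[OF IH(2) k i(1) e i(3) IH(1) g(2)]) (use g(1) in \<open>auto simp: unit_fun_def\<close>)
  ultimately show ?case by (simp add: g_def)
qed (use sf in simp)

text \<open>\<open>ts\<close> lists the averages that the operators \<open>a..l\<close> leave
  standing: \<open>a = 1\<close> with \<open>ts = []\<close> yields the equation,
  \<open>a = 2\<close> with \<open>ts = [1]\<close> the function to which the last operator of the
  initial values is applied.\<close>

lemma claim_odot:
  assumes psi: "unit_fun \<psi>" "\<And>x. x < 0 \<Longrightarrow> \<psi> x = 1"
    and p: "\<And>k. k \<in> {1..l} \<Longrightarrow> s k > 0 \<and> \<alpha> k > 0" and ts: "set ts \<subseteq> {1..l}"
    and cont: "\<And>ks x. set ks \<subseteq> {1..l} \<Longrightarrow> distinct ks \<Longrightarrow> x > 0 \<Longrightarrow> isCont (gamma_avgs s \<alpha> ks \<psi>) x"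
    and a: "1 \<le> a" "a \<le> Suc l" and dist: "distinct ([a..<Suc l] @ ts)"
    and F: "\<And>u. u > 0 \<Longrightarrow> F u = C * (1 - gamma_avgs s \<alpha> ([a..<Suc l] @ ts) \<psi> u)"
  shows "\<exists>g. odot (\<lambda>k. left_frac_op (\<alpha> k) (s k)) a l F = Some g \<and>
    (\<forall>u>0. g u = C * (\<Prod>k\<in>{a..l}. \<alpha> k powr s k) * (1 - gamma_avgs s \<alpha> ts \<psi> u))"
proof -
  define P where "P j = gamma_avgs s \<alpha> ([j..<Suc l] @ ts) \<psi>" for j
  define R where "R j F \<longleftrightarrow> (\<forall>u>0. F u = C * (\<Prod>k\<in>{a..<j}. \<alpha> k powr s k) * (1 - P j u))" for j and F :: "real \<Rightarrow> real"
  have "\<exists>g. odot (\<lambda>k. left_frac_op (\<alpha> k) (s k)) a l F = Some g \<and> R (Suc l) g"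
  proof (rule odot_chain[where R=R])
    show "R a F" unfolding R_def using F by (simp add: P_def)
    show "a \<le> Suc l" by fact
    fix j G assume j: "a \<le> j" "j \<le> l" and G: "R j G"
    have sj: "s j > 0" "\<alpha> j > 0" using p[of j] j a by auto
    have sub: "set ([Suc j..<Suc l] @ ts) \<subseteq> {1..l}" using ts j a by auto
    have pr: "unit_fun (P (Suc j))" "\<And>x. x < 0 \<Longrightarrow> P (Suc j) x = 1"
    proof -
      have q: "s k > 0 \<and> \<alpha> k > 0" if "k \<in> set ([Suc j..<Suc l] @ ts)" for k
        by (rule p) (use that sub in blast)
      show "unit_fun (P (Suc j))" unfolding P_def by (rule gamma_avgs_props(1)[OF psi q])
      show "P (Suc j) x = 1" if "x < 0" for x unfolding P_def by (rule gamma_avgs_props(2)[OF psi q that])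
    qed
    define h where "h x = 1 - P (Suc j) x" for x
    have Pj: "P j = avg (- 1) (gamma_law (s j) (\<alpha> j)) (P (Suc j))"
      using j by (simp add: P_def upt_conv_Cons del: upt_Suc)
    have "\<exists>g. left_frac_op (\<alpha> j) (s j) G = Some g \<and>
        (s j = s j \<longrightarrow> (\<forall>u>0. g u = C * (\<Prod>k\<in>{a..<j}. \<alpha> k powr s k) * \<alpha> j powr s j * h u)) \<and> (s j < s j \<longrightarrow> (g \<longlongrightarrow> 0) (at_right 0))"
    proof (rule left_frac_op_avg[where B=1])
      have d: "distinct ([Suc j..<Suc l] @ ts)"
      proof -
        have "{Suc j..<Suc l} \<subseteq> {a..<Suc l}" using j by auto
        moreover have "distinct ts" "{a..<Suc l} \<inter> set ts = {}" using dist by (simp_all del: upt_Suc)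
        ultimately have "distinct ts" "{Suc j..<Suc l} \<inter> set ts = {}" by blast+
        then show ?thesis by (simp del: upt_Suc)
      qed
      show "isCont h x" if "x > 0" for x
        unfolding h_def[abs_def] P_def by (rule isCont_diff[OF continuous_const cont[OF sub d that]])
      show "h \<in> borel_measurable borel"
        using pr(1) unfolding h_def[abs_def] by (intro borel_measurable_diff) (simp_all add: unit_fun_def)
      show "h x = 0" if "x < 0" for x using pr(2)[OF that] by (simp add: h_def)
      show "\<bar>h x\<bar> \<le> 1" for x using pr(1) by (auto simp: h_def unit_fun_def abs_le_iff)
      show "G u = C * (\<Prod>k\<in>{a..<j}. \<alpha> k powr s k) * avg (- 1) (gamma_law (s j) (\<alpha> j)) h u" if "u > 0" for u
        using G that avg_one_minus[OF borel_prob_gamma_law[OF sj] pr(1), of "-1" u]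
        by (simp add: R_def Pj h_def[abs_def])
    qed (use sj in auto)
    then obtain g where g: "left_frac_op (\<alpha> j) (s j) G = Some g"
      "\<And>u. u > 0 \<Longrightarrow> g u = C * (\<Prod>k\<in>{a..<j}. \<alpha> k powr s k) * \<alpha> j powr s j * h u" by blast
    have "(\<Prod>k\<in>{a..<Suc j}. \<alpha> k powr s k) = (\<Prod>k\<in>{a..<j}. \<alpha> k powr s k) * \<alpha> j powr s j" using j by simp
    then have "R (Suc j) g" unfolding R_def using g(2) by (simp add: h_def)
    then show "\<exists>g. left_frac_op (\<alpha> j) (s j) G = Some g \<and> R (Suc j) g" using g(1) by blast
  qed
  moreover have "P (Suc l) = gamma_avgs s \<alpha> ts \<psi>" by (simp add: P_def)
  ultimately show ?thesis unfolding R_def atLeastLessThanSuc_atLeastAtMost by simp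
qed

text \<open>Gamma averages are outermost and are stripped first, as the operators demand. They act
  on \<open>1 - G\<close>, which is bounded without decay (weight 0); the Mittag-Leffler steps use
  the decay of \<open>Q\<close> itself.\<close>

lemma arrival_odot:
  assumes P: "unit_fun P" "sectorial \<kappa> e B P" and kap: "\<kappa> > 1" and e: "e > 0" and B: "B \<ge> 0" and c: "c > 0"
    and pg: "\<And>i. i \<in> {1..m} \<Longrightarrow> r i > 0 \<and> lam1 i > 0"
    and pm: "\<And>j. j \<in> {1..n} \<Longrightarrow> 0 < \<mu> j \<and> \<mu> j \<le> 1 \<and> lam2 j > 0"
    and ml: "\<And>j. j \<in> {1..n} \<Longrightarrow> prob_space (mittag_leffler_law (\<mu> j) (lam2 j))"
    and F: "\<And>u. u > 0 \<Longrightarrow> F u = 1 - foldr (\<lambda>i. avg c (gamma_law (r i) (lam1 i))) [1..<Suc m]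
        (foldr (\<lambda>j. avg c (mittag_leffler_law (\<mu> j) (lam2 j))) [1..<Suc n] P) u"
  shows "\<exists>g. arrival_op m n c r lam1 \<mu> lam2 F = Some g \<and>
    (\<forall>u>0. g u = (\<Prod>i=1..m. lam1 i powr r i) * (\<Prod>j=1..n. lam2 j) * (1 - P u))"
proof -
  define M where "M j = mittag_leffler_law (\<mu> j) (lam2 j)" for j
  define Q where "Q j = foldr (\<lambda>j. avg c (M j)) [j..<Suc n] P" for j
  define G where "G i = foldr (\<lambda>i. avg c (gamma_law (r i) (lam1 i))) [i..<Suc m] (Q 1)" for i
  have e0: "e \<ge> 0" using e by simp
  have Mp: "borel_prob (M j)" "AE y in M j. y > 0" if "j \<in> {1..n}" for j
  proof -
    show "borel_prob (M j)" using ml[OF that] by (simp add: borel_prob_def M_def)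
    show "AE y in M j. y > 0" unfolding M_def
      by (rule AE_mittag_leffler_law_pos) (use pm[OF that] in auto)
  qed
  have Gp: "borel_prob (gamma_law (r i) (lam1 i)) \<and> (AE y in gamma_law (r i) (lam1 i). y > 0)" if "i \<in> {1..m}" for i
    using borel_prob_gamma_law pg[OF that] AE_gamma_law_pos by blast
  have Qp: "unit_fun (Q j)" "sectorial \<kappa> e B (Q j)" if "j \<ge> 1" for j
  proof -
    show "unit_fun (Q j)" unfolding Q_def by (rule unit_fun_foldr_avg[OF _ P(1)]) (use Mp that in auto)
    show "sectorial \<kappa> e B (Q j)" unfolding Q_def
      by (rule sectorial_foldr_avg[OF P kap e0 B c]) (use Mp that in auto)
  qed
  have Gs: "unit_fun (G i)" "sectorial \<kappa> e B (G i)" if "i \<ge> 1" for i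
  proof -
    show "unit_fun (G i)" unfolding G_def by (rule unit_fun_foldr_avg[OF _ Qp(1)]) (use Gp that in auto)
    show "sectorial \<kappa> e B (G i)" unfolding G_def
      by (rule sectorial_foldr_avg[OF Qp kap e0 B c]) (use Gp that in auto)
  qed
  define R where "R i F \<longleftrightarrow> (\<forall>u>0. F u = (\<Prod>k\<in>{1..<i}. lam1 k powr r k) * (1 - G i u))" for i and F :: "real \<Rightarrow> real"
  have "\<exists>g. odot (\<lambda>i. gamma_arrival_op c (r i) (lam1 i)) 1 m F = Some g \<and> R (Suc m) g"
  proof (rule odot_chain[where R=R])
    show "R 1 F" unfolding R_def using F by (simp add: G_def Q_def M_def)
    fix i H assume i: "1 \<le> i" "i \<le> m" and H: "R i H"
    have ri: "r i > 0" "lam1 i > 0" using pg[of i] i by auto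
    have Gi: "G i = avg c (gamma_law (r i) (lam1 i)) (G (Suc i))"
      using i by (simp add: G_def upt_conv_Cons del: upt_Suc)
    have u: "unit_fun (G (Suc i))" using Gs by simp
    have "sectorial \<kappa> 0 B (G (Suc i))" using Gs(2)[of "Suc i"] sectorial_mono[of \<kappa> e B _ B 0] e B kap by auto
    then have h: "sectorial \<kappa> 0 (1 + B) (\<lambda>x. 1 - G (Suc i) x)" by (rule sectorial_one_minus)
    have "\<exists>g. gamma_arrival_op c (r i) (lam1 i) H = Some g \<and>
        (\<forall>u>0. g u = (\<Prod>k\<in>{1..<i}. lam1 k powr r k) * lam1 i powr r i * (1 - G (Suc i) u))"
    proof (rule gamma_arrival_op_avg[OF h kap _ ri c])
      show "(\<lambda>x. 1 - G (Suc i) x) \<in> borel_measurable borel"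
        using u by (intro borel_measurable_diff) (simp_all add: unit_fun_def)
      show "H u = (\<Prod>k\<in>{1..<i}. lam1 k powr r k) * avg c (gamma_law (r i) (lam1 i)) (\<lambda>x. 1 - G (Suc i) x) u"
        if "u > 0" for u
        using H that avg_one_minus[OF borel_prob_gamma_law[OF ri] u, of c] by (simp add: R_def Gi)
    qed
    then show "\<exists>g. gamma_arrival_op c (r i) (lam1 i) H = Some g \<and> R (Suc i) g"
      using i by (simp add: R_def)
  qed simp
  then obtain g1 where g1: "odot (\<lambda>i. gamma_arrival_op c (r i) (lam1 i)) 1 m F = Some g1" "R (Suc m) g1" by blast
  define C where "C = (\<Prod>i=1..m. lam1 i powr r i)"
  define R' where "R' j F \<longleftrightarrow> (\<forall>u>0. F u = C * (\<Prod>k\<in>{1..<j}. lam2 k) * (1 - Q j u))" for j and F :: "real \<Rightarrow> real"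
  have "\<exists>g. odot (\<lambda>j. mittag_leffler_arrival_op c (\<mu> j) (lam2 j)) 1 n g1 = Some g \<and> R' (Suc n) g"
  proof (rule odot_chain[where R=R'])
    show "R' 1 g1" using g1(2) unfolding R_def R'_def
      by (simp add: C_def G_def atLeastLessThanSuc_atLeastAtMost)
    fix j H assume j: "1 \<le> j" "j \<le> n" and H: "R' j H"
    have mj: "0 < \<mu> j" "\<mu> j \<le> 1" "lam2 j > 0" using pm[of j] j by auto
    have Qj: "Q j = avg c (M j) (Q (Suc j))"
      using j by (simp add: Q_def upt_conv_Cons del: upt_Suc)
    have "\<exists>g. mittag_leffler_arrival_op c (\<mu> j) (lam2 j) H = Some g \<and>
        (\<forall>u>0. g u = (C * (\<Prod>k\<in>{1..<j}. lam2 k)) * lam2 j * (1 - Q (Suc j) u))"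
    proof (rule mittag_leffler_arrival_op_avg[OF Qp(2) kap e B _ c mj])
      show "Q (Suc j) \<in> borel_measurable borel" using Qp(1)[of "Suc j"] by (simp add: unit_fun_def)
      show "prob_space (mittag_leffler_law (\<mu> j) (lam2 j))"
        using ml[of j] j by simp
      show "H u = C * (\<Prod>k\<in>{1..<j}. lam2 k) *
          (1 - avg c (mittag_leffler_law (\<mu> j) (lam2 j)) (Q (Suc j)) u)"
        if "u > 0" for u using H that by (simp add: R'_def Qj M_def)
    qed simp
    then show "\<exists>g. mittag_leffler_arrival_op c (\<mu> j) (lam2 j) H = Some g \<and> R' (Suc j) g"
      using j by (simp add: R'_def mult.assoc)
  qed simp
  then show ?thesis using g1(1)
    by (auto simp: arrival_op_def R'_def C_def Q_def atLeastLessThanSuc_atLeastAtMost)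
qed

text \<open>Independence makes the moment a product, and tilting the gamma density gives each
  factor.\<close>

lemma nn_integral_exp_sum_gamma:
  fixes l :: nat
  assumes N: "prob_space N" and ind: "prob_space.indep_vars N (\<lambda>_. borel) W {1..l}"
    and law: "\<And>k. k \<in> {1..l} \<Longrightarrow> distributed N lborel (W k) (gamma_density (s k) (\<alpha> k))"
    and p: "\<And>k. k \<in> {1..l} \<Longrightarrow> s k > 0 \<and> e < \<alpha> k" and e: "0 \<le> e"
  shows "(\<integral>\<^sup>+x. ennreal (exp (e * x)) \<partial>distr N borel (\<lambda>\<omega>. \<Sum>k=1..l. W k \<omega>))
    = ennreal (\<Prod>k=1..l. (\<alpha> k / (\<alpha> k - e)) powr s k)"
proof -
  interpret prob_space N by fact
  have rv[measurable]: "W k \<in> borel_measurable N" if "k \<in> {1..l}" for k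
    using distributed_measurable[OF law[OF that]] by simp
  have rvs: "(\<lambda>\<omega>. \<Sum>k=1..l. W k \<omega>) \<in> borel_measurable N" by (intro borel_measurable_sum rv)
  have pe: "ennreal (exp (e * (\<Sum>k=1..l. W k \<omega>))) = (\<Prod>k\<in>{1..l}. ennreal (exp (e * W k \<omega>)))" for \<omega>
  proof -
    have "exp (e * (\<Sum>k=1..l. W k \<omega>)) = (\<Prod>k\<in>{1..l}. exp (e * W k \<omega>))"
      unfolding sum_distrib_left by (rule exp_sum) simp
    then show ?thesis by (simp only: prod_ennreal exp_ge_zero)
  qed
  have "(\<integral>\<^sup>+x. ennreal (exp (e * x)) \<partial>distr N borel (\<lambda>\<omega>. \<Sum>k=1..l. W k \<omega>))
      = (\<integral>\<^sup>+\<omega>. (\<Prod>k\<in>{1..l}. ennreal (exp (e * W k \<omega>))) \<partial>N)"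
    unfolding pe[symmetric] using rvs by (subst nn_integral_distr) simp_all
  also have "\<dots> = (\<Prod>k\<in>{1..l}. \<integral>\<^sup>+\<omega>. ennreal (exp (e * W k \<omega>)) \<partial>N)"
  proof (rule indep_vars_nn_integral)
    show "indep_vars (\<lambda>_. borel) (\<lambda>k \<omega>. ennreal (exp (e * W k \<omega>))) {1..l}"
      by (rule indep_vars_compose2[OF ind, where Y="\<lambda>_ x. ennreal (exp (e * x))" and N="\<lambda>_. borel"]) measurable
  qed auto
  also have "\<dots> = (\<Prod>k\<in>{1..l}. ennreal ((\<alpha> k / (\<alpha> k - e)) powr s k))"
  proof (rule prod.cong[OF refl])
    fix k assume k: "k \<in> {1..l}"
    have sk: "s k > 0" "\<alpha> k - e > 0" "e < \<alpha> k" using p[OF k] by auto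
    have "(\<integral>\<^sup>+\<omega>. ennreal (exp (e * W k \<omega>)) \<partial>N) = (\<integral>\<^sup>+x. ennreal (gamma_density (s k) (\<alpha> k) x) * ennreal (exp (e * x)) \<partial>lborel)"
      by (rule distributed_nn_integral[OF law[OF k], symmetric]) simp
    also have "\<dots> = (\<integral>\<^sup>+x. ennreal ((\<alpha> k / (\<alpha> k - e)) powr s k) * ennreal (gamma_density (s k) (\<alpha> k - e) x) \<partial>lborel)"
      using gamma_density_tilt[OF e sk(3), of "s k"] by (intro nn_integral_cong) (simp add: ennreal_mult'[symmetric] ennreal_mult''[symmetric])
    also have "\<dots> = ennreal ((\<alpha> k / (\<alpha> k - e)) powr s k)"
      using nn_integral_gamma_density[OF sk(1,2)] by (simp add: nn_integral_cmult)
    finally show "(\<integral>\<^sup>+\<omega>. ennreal (exp (e * W k \<omega>)) \<partial>N) = ennreal ((\<alpha> k / (\<alpha> k - e)) powr s k)" .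
  qed
  also have "\<dots> = ennreal (\<Prod>k=1..l. (\<alpha> k / (\<alpha> k - e)) powr s k)" by (rule prod_ennreal) simp
  finally show ?thesis .
qed

text \<open>\<open>MT\<close> and \<open>MX\<close> are auxiliary spaces: the decompositions into
  sums concern the laws of \<open>T\<close> and \<open>X\<close>, not the variables on
  \<open>M\<close>.\<close>

theorem theorem3:
  fixes M :: "'a measure" and MT :: "'b measure" and MX :: "'d measure"
    and c :: real and X T :: "nat \<Rightarrow> 'a \<Rightarrow> real"
    and m n l :: nat
    and r lam1 \<mu> lam2 s \<alpha> :: "nat \<Rightarrow> real"
    and Y Z :: "nat \<Rightarrow> 'b \<Rightarrow> real" and W :: "nat \<Rightarrow> 'd \<Rightarrow> real"
    and \<phi> :: "real \<Rightarrow> real" and \<Lambda> :: real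
  assumes model: "renewal_risk_model M c X T"
    and mn: "m \<noteq> 0 \<or> n \<noteq> 0" and l: "l \<ge> 1"
    and params_gamma: "\<And>i. i \<in> {1..m} \<Longrightarrow> r i > 0 \<and> lam1 i > 0"
    and params_ML: "\<And>j. j \<in> {1..n} \<Longrightarrow> 0 < \<mu> j \<and> \<mu> j \<le> 1 \<and> lam2 j > 0"
    and params_claim: "\<And>k. k \<in> {1..l} \<Longrightarrow> s k > 0 \<and> \<alpha> k > 0"
    and MT: "prob_space MT"
    and YZ_indep: "prob_space.indep_vars MT (\<lambda>_. borel) (case_sum Y Z) ({1..m} <+> {1..n})"
    and Y_law: "\<And>i. i \<in> {1..m} \<Longrightarrow> distributed MT lborel (Y i) (gamma_density (r i) (lam1 i))"
    and Z_law: "\<And>j. j \<in> {1..n} \<Longrightarrow> distributed MT lborel (Z j) (mittag_leffler_density (\<mu> j) (lam2 j))"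
    and T_law: "\<And>k. k \<ge> 1 \<Longrightarrow>
      distr M borel (T k) = distr MT borel (\<lambda>\<omega>. (\<Sum>i=1..m. Y i \<omega>) + (\<Sum>j=1..n. Z j \<omega>))"
    and MX: "prob_space MX"
    and W_indep: "prob_space.indep_vars MX (\<lambda>_. borel) W {1..l}"
    and W_law: "\<And>k. k \<in> {1..l} \<Longrightarrow> distributed MX lborel (W k) (gamma_density (s k) (\<alpha> k))"
    and X_law: "\<And>i. i \<ge> 1 \<Longrightarrow>
      distr M borel (X i) = distr MX borel (\<lambda>\<omega>. \<Sum>k=1..l. W k \<omega>)"
  defines "\<phi> \<equiv> renewal_risk_model.non_ruin_prob M c X T"
    and "\<Lambda> \<equiv> (\<Prod>i=1..m. lam1 i powr r i) * (\<Prod>j=1..n. lam2 j)"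
  shows "(\<exists>g. (claim_op l s \<alpha> \<circ>\<^sub>m arrival_op m n c r lam1 \<mu> lam2) \<phi> = Some g
            \<and> (\<forall>u>0. g u = \<Lambda> * (\<Prod>k=1..l. \<alpha> k powr s k) * \<phi> u)
            \<and> (g \<longlongrightarrow> \<Lambda> * (\<Prod>k=1..l. \<alpha> k powr s k) * \<phi> 0) (at_right 0))
       \<and> (\<phi> \<longlongrightarrow> 1) at_top
       \<and> (\<forall>k'::nat. 1 \<le> k' \<and> int k' \<le> \<lceil>\<Sum>k=1..l. s k\<rceil> - 1 \<longrightarrow>
            (\<exists>g. (left_frac_op (\<alpha> 1) (s 1 - real k')
                   \<circ>\<^sub>m odot (\<lambda>k. left_frac_op (\<alpha> k) (s k)) 2 l
                   \<circ>\<^sub>m arrival_op m n c r lam1 \<mu> lam2) \<phi> = Some g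
               \<and> (g \<longlongrightarrow> 0) (at_right 0)))"
proof -
  interpret renewal_risk_model M c X T by (rule model)
  interpret MT: prob_space MT by (rule MT)
  interpret MX: prob_space MX by (rule MX)
  have c: "c > 0" by (rule premium_pos)
  define LX where "LX = distr M borel (X 1)"
  define LT where "LT = distr M borel (T 1)"
  define ml where "ml j = mittag_leffler_law (\<mu> j) (lam2 j)" for j

  have rvY: "Y i \<in> borel_measurable MT" and lawY: "distr MT borel (Y i) = gamma_law (r i) (lam1 i)"
    if "i \<in> {1..m}" for i
  proof -
    show "Y i \<in> borel_measurable MT" using distributed_measurable[OF Y_law[OF that]] by simp
    have "distr MT borel (Y i) = distr MT lborel (Y i)" by (rule distr_cong) auto
    then show "distr MT borel (Y i) = gamma_law (r i) (lam1 i)"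
      using distributed_distr_eq_density[OF Y_law[OF that]] by simp
  qed
  have rvZ: "Z j \<in> borel_measurable MT" and lawZ: "distr MT borel (Z j) = ml j"
    if "j \<in> {1..n}" for j
  proof -
    show "Z j \<in> borel_measurable MT" using distributed_measurable[OF Z_law[OF that]] by simp
    have "distr MT borel (Z j) = distr MT lborel (Z j)" by (rule distr_cong) auto
    then show "distr MT borel (Z j) = ml j"
      using distributed_distr_eq_density[OF Z_law[OF that]] by (simp add: ml_def)
  qed
  have rvW: "W k \<in> borel_measurable MX" and lawW: "distr MX borel (W k) = gamma_law (s k) (\<alpha> k)"
    if "k \<in> {1..l}" for k
  proof -
    show "W k \<in> borel_measurable MX" using distributed_measurable[OF W_law[OF that]] by simp
    have "distr MX borel (W k) = distr MX lborel (W k)" by (rule distr_cong) auto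
    then show "distr MX borel (W k) = gamma_law (s k) (\<alpha> k)"
      using distributed_distr_eq_density[OF W_law[OF that]] by simp
  qed
  have mlp: "prob_space (ml j)" if "j \<in> {1..n}" for j
    using MT.prob_space_distr[OF rvZ[OF that]] lawZ[OF that] by simp

  have bLX: "borel_prob LX" and bLT: "borel_prob LT"
    unfolding borel_prob_def LX_def LT_def
    by (auto intro!: prob_space_distr measurable_claim measurable_waiting)
  have LXpos: "AE x in LX. x > 0"
    unfolding LX_def using claims_pos[of 1] measurable_claim[of 1] by (subst AE_distr_iff) auto

  have Ypos: "AE \<omega> in MT. \<forall>i\<in>{1..m}. Y i \<omega> > 0"
  proof (rule AE_finite_allI)
    fix i assume i: "i \<in> {1..m}"
    have "AE x in distr MT borel (Y i). x > 0" unfolding lawY[OF i] by (rule AE_gamma_law_pos)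
    then show "AE \<omega> in MT. Y i \<omega> > 0" using rvY[OF i] by (subst (asm) AE_distr_iff) auto
  qed simp
  have Zpos: "AE \<omega> in MT. \<forall>j\<in>{1..n}. Z j \<omega> > 0"
  proof (rule AE_finite_allI)
    fix j assume j: "j \<in> {1..n}"
    have p: "\<mu> j > 0" "lam2 j > 0" using params_ML[OF j] by auto
    have "AE x in distr MT borel (Z j). x > 0" unfolding lawZ[OF j] ml_def
      by (rule AE_mittag_leffler_law_pos[OF p])
    then show "AE \<omega> in MT. Z j \<omega> > 0" using rvZ[OF j] by (subst (asm) AE_distr_iff) auto
  qed simp
  have rvS: "(\<lambda>\<omega>. (\<Sum>i=1..m. Y i \<omega>) + (\<Sum>j=1..n. Z j \<omega>)) \<in> borel_measurable MT"
    by (intro borel_measurable_add borel_measurable_sum rvY rvZ)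
  have LTpos: "AE t in LT. t > 0"
  proof -
    have "AE \<omega> in MT. (\<Sum>i=1..m. Y i \<omega>) + (\<Sum>j=1..n. Z j \<omega>) > 0"
      using Ypos Zpos
    proof eventually_elim
      fix \<omega> assume Y: "\<forall>i\<in>{1..m}. Y i \<omega> > 0" and Z: "\<forall>j\<in>{1..n}. Z j \<omega> > 0"
      have "(\<Sum>i=1..m. Y i \<omega>) \<ge> 0" "(\<Sum>j=1..n. Z j \<omega>) \<ge> 0"
        using Y Z by (auto intro!: sum_nonneg simp: less_imp_le)
      moreover have "(\<Sum>i=1..m. Y i \<omega>) > 0" if "m \<noteq> 0" using Y that by (intro sum_pos) auto
      moreover have "(\<Sum>j=1..n. Z j \<omega>) > 0" if "n \<noteq> 0" using Z that by (intro sum_pos) auto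
      ultimately show "(\<Sum>i=1..m. Y i \<omega>) + (\<Sum>j=1..n. Z j \<omega>) > 0"
        using mn by (auto intro: add_pos_nonneg add_nonneg_pos)
    qed
    then show ?thesis unfolding LT_def T_law[OF order_refl] using rvS by (subst AE_distr_iff) auto
  qed
  have Tpos: "AE \<omega> in M. T i \<omega> > 0" if "i \<ge> 1" for i
  proof -
    have "AE t in distr M borel (T i). t > 0" using LTpos unfolding LT_def waiting_ident[OF that] .
    then show ?thesis using measurable_waiting[OF that] by (subst (asm) AE_distr_iff) auto
  qed

  \<comment> \<open>The order of the indices is left open: the equation uses the natural one, the
    initial values the one with 1 innermost.\<close>
  have avgX: "avg (- 1) LX f = gamma_avgs s \<alpha> ks f"
    if f: "unit_fun f" and ks: "set ks = {1..l}" "distinct ks" for f ks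
  proof -
    have "avg (- 1) LX f = avg (- 1) (distr MX borel (\<lambda>\<omega>. \<Sum>k\<in>set ks. W k \<omega>)) f"
      using X_law[of 1] by (simp add: LX_def ks(1))
    also have "\<dots> = foldr (\<lambda>k. avg (- 1) (distr MX borel (W k))) ks f"
      by (rule avg_law_of_sum[OF MX _ ks(2) f]) (use W_indep ks(1) in simp)
    also have "\<dots> = gamma_avgs s \<alpha> ks f"
      by (rule foldr_cong) (use lawW ks(1) in auto)
    finally show ?thesis .
  qed
  have avgT: "avg c LT f = foldr (\<lambda>i. avg c (gamma_law (r i) (lam1 i))) [1..<Suc m] (foldr (\<lambda>j. avg c (ml j)) [1..<Suc n] f)"
    if f: "unit_fun f" for f
  proof -
    \<comment> \<open>Gamma indices precede the Mittag-Leffler ones, so that their averages come out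
      outermost.\<close>
    define js where "js = map Inl [1..<Suc m] @ map Inr [1..<Suc n]"
    have set: "set js = {1..m} <+> {1..n}" by (auto simp: js_def Plus_def)
    have dist: "distinct js" by (auto simp: js_def distinct_map)
    have "(\<Sum>j\<in>set js. case_sum Y Z j \<omega>) = (\<Sum>i=1..m. Y i \<omega>) + (\<Sum>j=1..n. Z j \<omega>)" for \<omega>
      unfolding set by (subst sum.Plus) (auto simp: comp_def)
    then have "avg c LT f = avg c (distr MT borel (\<lambda>\<omega>. \<Sum>j\<in>set js. case_sum Y Z j \<omega>)) f"
      using T_law[of 1] by (simp add: LT_def)
    also have "\<dots> = foldr (\<lambda>j. avg c (distr MT borel (case_sum Y Z j))) js f"
      by (rule avg_law_of_sum[OF MT _ dist f]) (use YZ_indep set in simp)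
    also have "\<dots> = foldr (\<lambda>i. avg c (distr MT borel (Y i))) [1..<Suc m] (foldr (\<lambda>j. avg c (distr MT borel (Z j))) [1..<Suc n] f)"
      unfolding js_def by (simp add: foldr_map comp_def del: upt_Suc)
    also have "\<dots> = foldr (\<lambda>i. avg c (gamma_law (r i) (lam1 i))) [1..<Suc m] (foldr (\<lambda>j. avg c (ml j)) [1..<Suc n] f)"
    proof -
      have "foldr (\<lambda>j. avg c (distr MT borel (Z j))) [1..<Suc n] f = foldr (\<lambda>j. avg c (ml j)) [1..<Suc n] f"
        by (rule foldr_cong) (use lawZ in auto)
      moreover have "foldr (\<lambda>i. avg c (distr MT borel (Y i))) [1..<Suc m] g = foldr (\<lambda>i. avg c (gamma_law (r i) (lam1 i))) [1..<Suc m] g" for g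
        by (rule foldr_cong) (use lawY in auto)
      ultimately show ?thesis by simp
    qed
    finally show ?thesis .
  qed

  define EmX where "EmX e = (\<Prod>k=1..l. (\<alpha> k / (\<alpha> k - e)) powr s k)" for e
  have expX: "has_bochner_integral LX (\<lambda>x. exp (e * x)) (EmX e)"
    if e: "0 \<le> e" "\<And>k. k \<in> {1..l} \<Longrightarrow> e < \<alpha> k" for e
  proof (rule has_bochner_integral_nn_integral)
    show "(\<lambda>x. exp (e * x)) \<in> borel_measurable LX" using bLX by (simp add: borel_prob_def cong: measurable_cong_sets)
    show "(\<integral>\<^sup>+x. ennreal (exp (e * x)) \<partial>LX) = ennreal (EmX e)"
      unfolding LX_def X_law[OF order_refl] EmX_def
      by (rule nn_integral_exp_sum_gamma[OF MX W_indep W_law]) (use params_claim e in auto)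
    show "0 \<le> EmX e" by (simp add: EmX_def prod_nonneg)
  qed auto
  obtain e where e: "0 < e" "\<And>k. k \<in> {1..l} \<Longrightarrow> e < \<alpha> k"
    and rho: "EmX e * (LINT t|LT. exp (- e * c * t)) < 1"
  proof -
    \<comment> \<open>Half the smallest rate is strictly below every \<open>\<alpha> k\<close>, so
      the claims have a finite exponential moment of order \<open>a\<close>.\<close>
    define a where "a = Min (\<alpha> ` {1..l}) / 2"
    have "Min (\<alpha> ` {1..l}) \<in> \<alpha> ` {1..l}" using l by (intro Min_in) auto
    then have am: "Min (\<alpha> ` {1..l}) > 0" using params_claim by auto
    then have a: "a > 0" by (simp add: a_def)
    have al: "a < \<alpha> k" if "k \<in> {1..l}" for k
    proof -
      have "Min (\<alpha> ` {1..l}) \<le> \<alpha> k" using that by (intro Min_le) auto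
      then show ?thesis using am by (simp add: a_def)
    qed
    have mean: "(\<integral>\<^sup>+x. ennreal x \<partial>LX) < ennreal c * (\<integral>\<^sup>+t. ennreal t \<partial>LT)"
      unfolding LX_def LT_def using net_profit[OF order_refl] measurable_claim[OF order_refl] measurable_waiting[OF order_refl]
      by (simp add: nn_integral_distr)
    have mom: "integrable LX (\<lambda>x. exp (a * x))" using expX[of a] a al by (auto intro: integrable.intros)
    from exponential_moment_less_one[OF bLX LXpos a mom bLT LTpos c mean]
    obtain e where e: "0 < e" "e < a" "(LINT x|LX. exp (e * x)) * (LINT t|LT. exp (- e * c * t)) < 1" by blast
    have "e < \<alpha> k" if "k \<in> {1..l}" for k using al[OF that] e(2) by simp
    moreover from this have "(LINT x|LX. exp (e * x)) = EmX e"
      using expX[of e] e(1) by (auto intro!: has_bochner_integral_integral_eq)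
    ultimately show ?thesis using that[of e] e by simp
  qed
  define EmT where "EmT = (LINT t|LT. exp (- e * c * t))"
  have EmT0: "EmT \<ge> 0" unfolding EmT_def by (rule Bochner_Integration.integral_nonneg) simp
  define S where "S = (\<Sum>k=1..l. s k)"
  \<comment> \<open>The gamma averages of one claim cost \<open>\<kappa> powr S\<close> in total. As
    \<kappa> decreases to 1 the product tends to a value below 1, which leaves room for some
    \<open>\<kappa> > 1\<close>.\<close>
  obtain \<kappa> where kap: "\<kappa> > 1" and kaprho: "\<kappa> powr S * (EmX e * EmT) < 1"
  proof -
    have "((\<lambda>\<kappa>. \<kappa> powr S * (EmX e * EmT)) \<longlongrightarrow> 1 powr S * (EmX e * EmT)) (at_right 1)"
      by (intro tendsto_intros) auto
    then have "eventually (\<lambda>\<kappa>. \<kappa> powr S * (EmX e * EmT) < 1) (at_right 1)"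
      using rho by (intro order_tendstoD(2)) (auto simp: EmT_def)
    then have "eventually (\<lambda>\<kappa>::real. 1 < \<kappa> \<and> \<kappa> powr S * (EmX e * EmT) < 1) (at_right 1)"
      using eventually_at_right_less[of "1::real"] by eventually_elim auto
    then show ?thesis using that eventually_happens[of _ "at_right (1::real)"]
      by (auto simp: trivial_limit_at_right_real)
  qed

  define \<psi> where "\<psi> u = 1 - survival step_law u" for u
  note sl = prob_space_step_law sets_step_law
  have bsl: "borel_prob step_law" using sl by (simp add: borel_prob_def)
  have phi: "\<phi> u = survival step_law u" for u
    unfolding \<phi>_def by (rule non_ruin_prob_survival[OF Tpos])
  have usv: "unit_fun (survival step_law)"
    using borel_measurable_survival[OF sl] survival_bounds[OF sl] by (simp add: unit_fun_def)
  have upsi: "unit_fun \<psi>"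
    using usv unfolding unit_fun_def \<psi>_def[abs_def] by (auto intro!: borel_measurable_diff)
  have negpsi: "\<psi> x = 1" if "x < 0" for x using survival_neg[OF sl that] by (simp add: \<psi>_def)
  have iT: "integrable LT (\<lambda>t. exp (- e * c * t))"
  proof -
    have fin: "finite_measure LT" using bLT by (simp add: borel_prob_def prob_space.finite_measure)
    show ?thesis
    proof (rule finite_measure.integrable_const_bound[OF fin, of _ 1])
      show "AE t in LT. norm (exp (- e * c * t)) \<le> 1" using LTpos by eventually_elim (use e c in simp)
      show "(\<lambda>t. exp (- e * c * t)) \<in> borel_measurable LT" using bLT by (simp add: borel_prob_def cong: measurable_cong_sets)
    qed
  qed
  have stepexp: "(\<integral>\<^sup>+y. ennreal (exp (- e * y)) \<partial>step_law) = ennreal (EmX e * EmT)"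
  proof -
    note X' = expX[OF less_imp_le[OF e(1)] e(2)]
    have "(\<integral>\<^sup>+x. ennreal (exp (e * x)) \<partial>LX) = ennreal (EmX e)"
      using nn_integral_eq_integral[OF integrable.intros[OF X']] has_bochner_integral_integral_eq[OF X'] by simp
    moreover have "(\<integral>\<^sup>+t. ennreal (exp (- e * c * t)) \<partial>LT) = ennreal EmT"
      unfolding EmT_def by (rule nn_integral_eq_integral[OF iT]) simp
    ultimately show ?thesis using nn_integral_exp_step_law[of e] EmT0
      by (simp add: LX_def LT_def ennreal_mult'')
  qed
  have rho1: "EmX e * EmT < 1" using rho by (simp add: EmT_def)
  have EmX0: "EmX e \<ge> 0" by (simp add: EmX_def prod_nonneg)
  have hstep: "has_bochner_integral step_law (\<lambda>y. exp (- e * y)) (EmX e * EmT)"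
    by (rule has_bochner_integral_nn_integral)
      (use stepexp EmX0 EmT0 sl in \<open>auto simp: cong: measurable_cong_sets\<close>)
  have Lund: "\<psi> u \<le> exp (- e * u)" for u
    unfolding \<psi>_def by (rule survival_Lundberg[OF sl less_imp_le[OF e(1)]])
      (use stepexp rho1 in \<open>simp add: ennreal_le_1\<close>)
  have avgstep: "avg 1 step_law f = avg c LT (avg (- 1) LX f)" if "unit_fun f" for f
    using avg_step_law[of f] that by (auto simp: unit_fun_def LX_def LT_def fun_eq_iff)
  have renew: "\<psi> u = avg 1 step_law \<psi> u" if "u \<ge> 0" for u
    using survival_renewal[OF sl that] avg_one_minus[OF bsl usv, of 1 u]
    by (simp add: \<psi>_def[abs_def] avg_def)
  have pc: "s k > 0 \<and> \<alpha> k > 0 \<and> e < \<alpha> k" if "k \<in> {1..l}" for k using params_claim[OF that] e(2)[OF that] by simp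
  define B where "B = (\<Prod>k\<in>{1..l}. (\<kappa> * \<alpha> k / (\<alpha> k - e)) powr s k)"
  have sg: "B \<ge> 1 \<and> sectorial \<kappa> e B (avg (- 1) LX f)"
    if f: "unit_fun f" "\<And>x. x < 0 \<Longrightarrow> f x = 1" "sectorial \<kappa> e 1 f" for f
    using sectorial_gamma_avgs[OF f kap less_imp_le[OF e(1)], of "[1..<Suc l]" s \<alpha>] pc avgX[OF f(1), of "[1..<Suc l]"]
    by (simp add: B_def atLeastLessThanSuc_atLeastAtMost del: upt_Suc)
  \<comment> \<open>One full step of the walk thus maps functions with sectorial bound 1 to
    functions with sectorial bound at most 1.\<close>
  have BET: "B * EmT \<le> 1"
  proof -
    have "B = (\<Prod>k\<in>{1..l}. \<kappa> powr s k * (\<alpha> k / (\<alpha> k - e)) powr s k)"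
      unfolding B_def
    proof (rule prod.cong[OF refl])
      fix k assume "k \<in> {1..l}"
      then have "0 \<le> \<alpha> k / (\<alpha> k - e)" using pc[of k] by simp
      then show "(\<kappa> * \<alpha> k / (\<alpha> k - e)) powr s k = \<kappa> powr s k * (\<alpha> k / (\<alpha> k - e)) powr s k"
        using powr_mult[of \<kappa> "\<alpha> k / (\<alpha> k - e)" "s k"] kap by simp
    qed
    also have "\<dots> = \<kappa> powr S * EmX e"
      using kap by (simp add: prod.distrib EmX_def S_def powr_sum)
    finally show ?thesis using kaprho by (simp add: mult.assoc)
  qed
  have psi_sect: "sectorial \<kappa> e 1 \<psi>"
  proof (rule sectorial_fixed_point[OF bsl upsi negpsi Lund renew integrable.intros[OF hstep]])
    show "(LINT x|step_law. exp (- e * x)) < 1" using has_bochner_integral_integral_eq[OF hstep] rho1 by simp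
    fix f assume f: "unit_fun f" "\<And>x. x < 0 \<Longrightarrow> f x = 1" "sectorial \<kappa> e 1 f"
    note sgf = sg[OF f]
    have "sectorial \<kappa> e (B * EmT) (avg c LT (avg (- 1) LX f))"
      unfolding EmT_def
      by (rule sectorial_avg) (use sgf kap e c bLT LTpos unit_fun_avg[OF bLX f(1)] in \<open>auto simp: borel_prob_def unit_fun_def\<close>)
    then show "sectorial \<kappa> e 1 (avg 1 step_law f)"
      unfolding avgstep[OF f(1)] using BET EmT0 sgf kap
      by (intro sectorial_mono[of \<kappa> e "B * EmT" _ 1 e]) (auto intro!: mult_nonneg_nonneg)
  qed (use e kap in auto)

  \<comment> \<open>\<psi> averaged over a claim only: the arrival operators lead from \<phi> to a
    multiple of \<open>1 - P\<close>, the claim operators from there to a multiple of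
    \<open>1 - \<psi> = \<phi>\<close>.\<close>
  define P where "P = avg (- 1) LX \<psi>"
  have uP: "unit_fun P" unfolding P_def by (rule unit_fun_avg[OF bLX upsi])
  have sP: "B \<ge> 1" "sectorial \<kappa> e B P" using sg[OF upsi negpsi psi_sect] by (auto simp: P_def)
  have phiP: "\<phi> u = 1 - foldr (\<lambda>i. avg c (gamma_law (r i) (lam1 i))) [1..<Suc m] (foldr (\<lambda>j. avg c (ml j)) [1..<Suc n] P) u"
    if "u > 0" for u
  proof -
    have "\<phi> u = 1 - \<psi> u" by (simp add: phi \<psi>_def)
    also have "\<psi> u = avg c LT P u" using renew[of u] that avgstep[OF upsi] by (simp add: P_def)
    finally show ?thesis unfolding avgT[OF uP] .
  qed
  obtain h where h: "arrival_op m n c r lam1 \<mu> lam2 \<phi> = Some h" "\<And>u. u > 0 \<Longrightarrow> h u = \<Lambda> * (1 - P u)"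
    using arrival_odot[OF uP sP(2) kap e(1) _ c params_gamma params_ML mlp[unfolded ml_def] phiP[unfolded ml_def]] sP(1)
    unfolding \<Lambda>_def by auto

  have cont: "isCont (gamma_avgs s \<alpha> ks \<psi>) x" if ks: "set ks \<subseteq> {1..l}" "distinct ks" and x: "x > 0" for ks x
  proof -
    have p: "s k > 0 \<and> \<alpha> k > 0 \<and> e < \<alpha> k" if "k \<in> set ks" for k using pc ks that by blast
    have "sectorial \<kappa> e (\<Prod>k\<in>set ks. (\<kappa> * \<alpha> k / (\<alpha> k - e)) powr s k) (gamma_avgs s \<alpha> ks \<psi>)"
      by (rule conjunct2[OF sectorial_gamma_avgs[of \<psi> \<kappa> e ks s \<alpha>]])
        (use upsi negpsi psi_sect kap e(1) p ks(2) in auto)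
    from sectorial_derivs(1)[OF this kap x, of 0] show ?thesis by (auto intro: DERIV_isCont)
  qed
  have pc': "s k > 0 \<and> \<alpha> k > 0" if "k \<in> {1..l}" for k using pc[OF that] by simp
  have PP: "P = gamma_avgs s \<alpha> ks \<psi>" if "set ks = {1..l}" "distinct ks" for ks
    unfolding P_def by (rule avgX[OF upsi that])

  show ?thesis
  proof (intro conjI allI impI)
    define A where "A = (\<Prod>k=1..l. \<alpha> k powr s k)"
    have hF: "h u = \<Lambda> * (1 - gamma_avgs s \<alpha> ([1..<Suc l] @ []) \<psi> u)" if "u > 0" for u
      using h(2)[OF that] PP[of "[1..<Suc l]"] by (simp add: atLeastLessThanSuc_atLeastAtMost del: upt_Suc)
    obtain g where g: "odot (\<lambda>k. left_frac_op (\<alpha> k) (s k)) 1 l h = Some g" "\<And>u. u > 0 \<Longrightarrow> g u = \<Lambda> * A * (1 - \<psi> u)"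
    proof -
      have "\<exists>g. odot (\<lambda>k. left_frac_op (\<alpha> k) (s k)) 1 l h = Some g \<and>
          (\<forall>u>0. g u = \<Lambda> * (\<Prod>k\<in>{1..l}. \<alpha> k powr s k) * (1 - gamma_avgs s \<alpha> [] \<psi> u))"
        by (rule claim_odot[where ts="[]" and l=l, OF upsi negpsi pc' _ cont _ _ _ hF]) auto
      then show ?thesis using that by (auto simp: A_def)
    qed
    have gphi: "g u = \<Lambda> * A * \<phi> u" if "u > 0" for u using g(2)[OF that] by (simp add: phi \<psi>_def)
    have "(\<phi> \<longlongrightarrow> \<phi> 0) (at_right 0)"
      unfolding phi[abs_def] by (rule survival_right_continuous[OF sl])
    then have "((\<lambda>u. \<Lambda> * A * \<phi> u) \<longlongrightarrow> \<Lambda> * A * \<phi> 0) (at_right 0)" by (intro tendsto_mult tendsto_const)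
    moreover have "eventually (\<lambda>u. \<Lambda> * A * \<phi> u = g u) (at_right 0)"
      using eventually_at_right_less[of 0] by eventually_elim (simp add: gphi)
    ultimately have "(g \<longlongrightarrow> \<Lambda> * A * \<phi> 0) (at_right 0)" by (rule Lim_transform_eventually)
    then show "\<exists>g. (claim_op l s \<alpha> \<circ>\<^sub>m arrival_op m n c r lam1 \<mu> lam2) \<phi> = Some g
            \<and> (\<forall>u>0. g u = \<Lambda> * (\<Prod>k=1..l. \<alpha> k powr s k) * \<phi> u)
            \<and> (g \<longlongrightarrow> \<Lambda> * (\<Prod>k=1..l. \<alpha> k powr s k) * \<phi> 0) (at_right 0)"
      using g(1) gphi h(1) by (intro exI[of _ g]) (simp add: claim_op_def A_def)
    show "(\<phi> \<longlongrightarrow> 1) at_top"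
    proof (rule tendsto_sandwich)
      show "eventually (\<lambda>u. 1 - exp (- e * u) \<le> \<phi> u) at_top" using Lund by (simp add: phi \<psi>_def algebra_simps)
      show "eventually (\<lambda>u. \<phi> u \<le> 1) at_top" using survival_bounds(2)[OF sl] by (simp add: phi)
      have "filterlim (\<lambda>u. - e * u) at_bot at_top" using e(1) by real_asymp
      then have "((\<lambda>u. 1 - exp (- e * u)) \<longlongrightarrow> 1 - 0) at_top"
        by (intro tendsto_diff tendsto_const filterlim_compose[OF exp_at_bot])
      then show "((\<lambda>u. 1 - exp (- e * u)) \<longlongrightarrow> 1) at_top" by simp
    qed simp
  next
    fix k' :: nat assume k': "1 \<le> k' \<and> int k' \<le> \<lceil>\<Sum>k=1..l. s k\<rceil> - 1"
    have 1: "1 \<in> {1..l}" using l by simp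
    \<comment> \<open>With index 1 innermost, stripping \<open>2..l\<close> leaves exactly the
      average over the first gamma law.\<close>
    have list: "set ([2..<Suc l] @ [1]) = {1..l}" "distinct ([2..<Suc l] @ [1])" using l by auto
    have hF: "h u = \<Lambda> * (1 - gamma_avgs s \<alpha> ([2..<Suc l] @ [1]) \<psi> u)" if "u > 0" for u
      using h(2)[OF that] PP[OF list] by simp
    obtain q where q: "odot (\<lambda>k. left_frac_op (\<alpha> k) (s k)) 2 l h = Some q"
      "\<And>u. u > 0 \<Longrightarrow> q u = \<Lambda> * (\<Prod>k\<in>{2..l}. \<alpha> k powr s k) * (1 - gamma_avgs s \<alpha> [1] \<psi> u)"
    proof -
      have "\<exists>g. odot (\<lambda>k. left_frac_op (\<alpha> k) (s k)) 2 l h = Some g \<and>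
          (\<forall>u>0. g u = \<Lambda> * (\<Prod>k\<in>{2..l}. \<alpha> k powr s k) * (1 - gamma_avgs s \<alpha> [1] \<psi> u))"
        by (rule claim_odot[where ts="[1]" and l=l, OF upsi negpsi pc' _ cont _ _ list(2) hF]) (use l in auto)
      then show ?thesis using that by blast
    qed
    define f where "f x = 1 - \<psi> x" for x
    have s1: "s 1 > 0" "\<alpha> 1 > 0" using pc'[OF 1] by auto
    \<comment> \<open>By \<open>k' \<ge> 1\<close> the order is strictly below \<open>s 1\<close>;
      what remains is a fractional integral of order \<open>k'\<close>, which vanishes at 0.\<close>
    have "\<exists>g. left_frac_op (\<alpha> 1) (s 1 - real k') q = Some g \<and>
        (s 1 - real k' = s 1 \<longrightarrow> (\<forall>u>0. g u = \<Lambda> * (\<Prod>k\<in>{2..l}. \<alpha> k powr s k) * \<alpha> 1 powr s 1 * f u)) \<and>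
        (s 1 - real k' < s 1 \<longrightarrow> (g \<longlongrightarrow> 0) (at_right 0))"
    proof (rule left_frac_op_avg[where B=1 and h=f])
      show "isCont f x" if "x > 0" for x
        unfolding f_def[abs_def] using cont[of "[]" x] that by (intro isCont_diff continuous_const) simp
      show "f \<in> borel_measurable borel" using upsi unfolding f_def[abs_def]
        by (intro borel_measurable_diff) (simp_all add: unit_fun_def)
      show "f x = 0" if "x < 0" for x using negpsi[OF that] by (simp add: f_def)
      show "\<bar>f x\<bar> \<le> 1" for x using upsi by (auto simp: f_def unit_fun_def abs_le_iff)
      show "q u = \<Lambda> * (\<Prod>k\<in>{2..l}. \<alpha> k powr s k) * avg (- 1) (gamma_law (s 1) (\<alpha> 1)) f u" if "u > 0" for u
        using q(2)[OF that] avg_one_minus[OF borel_prob_gamma_law[OF s1] upsi, of "-1" u]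
        by (simp add: f_def[abs_def])
    qed (use s1 in auto)
    then obtain g where "left_frac_op (\<alpha> 1) (s 1 - real k') q = Some g" "(g \<longlongrightarrow> 0) (at_right 0)"
      using k' by auto
    then show "\<exists>g. (left_frac_op (\<alpha> 1) (s 1 - real k')
                   \<circ>\<^sub>m odot (\<lambda>k. left_frac_op (\<alpha> k) (s k)) 2 l
                   \<circ>\<^sub>m arrival_op m n c r lam1 \<mu> lam2) \<phi> = Some g
               \<and> (g \<longlongrightarrow> 0) (at_right 0)"
      using q(1) h(1) by (intro exI[of _ g]) simp
  qed
qed

end
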